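(* Let $\Gamma$ be a (Gromov) hyperbolic group. If $H^2(\Gamma,\mathbb{R})\neq 0$, then $\Gamma$ is not uniform-to-local stable with respect to the class $\mathcal{B}$ of unital tracial $C^*$-algebras.
   Context: A unital $C^*$-algebra is called tracial here if it admits a tracial state. $H^2(\Gamma,\mathbb{R})$ is group cohomology with trivial coefficients. For a class $\mathcal{B}$ of unital $C^*$-algebras, a countable discrete group $\Gamma$ is uniform-to-local $\mathcal{B}$-stable if for any sequence of unital maps $\rho_n:\Gamma\to U(B_n)$ (that is, $\rho_n(e)=1$) into unitary groups of algebras $B_n\in\mathcal{B}$ with $\lim_{n\to\infty}\sup_{s,t\in\Gamma}\|\rho_n(st)-\rho_n(s)\rho_n(t)\|=0$, there exists a sequence of group homomorphisms $\pi_n:\Gamma\to U(B_n)$ with $\lim_{n\to\infty}\|\rho_n(s)-\pi_n(s)\|=0$ for all $s\in\Gamma$. *)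

theory Defs
  imports
    "HOL-Analysis.Analysis"
    "HOL-Algebra.Generated_Groups"
    "HOL-Algebra.Module"
begin

section \<open>Unital C*-algebras and tracial states\<close>

definition complex_ring :: "complex ring"
  where "complex_ring = \<lparr>carrier = UNIV, mult = (*), one = 1, zero = 0, add = (+)\<rparr>"

record 'b cstar_algebra = "(complex, 'b) module" +
  adj :: "'b \<Rightarrow> 'b"
  nrm :: "'b \<Rightarrow> real"

locale unital_cstar_algebra = ring B + Scal: Module.module complex_ring B
  for B :: "'b cstar_algebra" (structure) +
  assumes smult_mult_left:
      "\<lbrakk>x \<in> carrier B; y \<in> carrier B\<rbrakk> \<Longrightarrow> (a \<odot> x) \<otimes> y = a \<odot> (x \<otimes> y)"
    and smult_mult_right:
      "\<lbrakk>x \<in> carrier B; y \<in> carrier B\<rbrakk> \<Longrightarrow> x \<otimes> (a \<odot> y) = a \<odot> (x \<otimes> y)"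
    and adj_closed: "x \<in> carrier B \<Longrightarrow> adj B x \<in> carrier B"
    and adj_adj: "x \<in> carrier B \<Longrightarrow> adj B (adj B x) = x"
    and adj_add: "\<lbrakk>x \<in> carrier B; y \<in> carrier B\<rbrakk> \<Longrightarrow> adj B (x \<oplus> y) = adj B x \<oplus> adj B y"
    and adj_smult: "x \<in> carrier B \<Longrightarrow> adj B (a \<odot> x) = cnj a \<odot> adj B x"
    and adj_mult: "\<lbrakk>x \<in> carrier B; y \<in> carrier B\<rbrakk> \<Longrightarrow> adj B (x \<otimes> y) = adj B y \<otimes> adj B x"
    and nrm_nonneg: "x \<in> carrier B \<Longrightarrow> 0 \<le> nrm B x"
    and nrm_eq_0_iff: "x \<in> carrier B \<Longrightarrow> nrm B x = 0 \<longleftrightarrow> x = \<zero>"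
    and nrm_smult: "x \<in> carrier B \<Longrightarrow> nrm B (a \<odot> x) = cmod a * nrm B x"
    and nrm_add: "\<lbrakk>x \<in> carrier B; y \<in> carrier B\<rbrakk> \<Longrightarrow> nrm B (x \<oplus> y) \<le> nrm B x + nrm B y"
    and nrm_mult: "\<lbrakk>x \<in> carrier B; y \<in> carrier B\<rbrakk> \<Longrightarrow> nrm B (x \<otimes> y) \<le> nrm B x * nrm B y"
    and cstar_identity: "x \<in> carrier B \<Longrightarrow> nrm B (adj B x \<otimes> x) = (nrm B x)\<^sup>2"
    and nrm_complete:
      "\<lbrakk>\<And>n. \<sigma> n \<in> carrier B;
        \<And>\<epsilon>. \<epsilon> > 0 \<Longrightarrow> \<exists>N. \<forall>m\<ge>N. \<forall>n\<ge>N. nrm B (\<sigma> m \<ominus> \<sigma> n) < \<epsilon>\<rbrakk>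
       \<Longrightarrow> \<exists>x\<in>carrier B. (\<lambda>n. nrm B (\<sigma> n \<ominus> x)) \<longlonglongrightarrow> 0"

text \<open>For a positive functional on a unital algebra, being a state (norm one) means being unital.\<close>

definition tracial_state :: "'b cstar_algebra \<Rightarrow> ('b \<Rightarrow> complex) \<Rightarrow> bool" where
  "tracial_state B \<tau> \<longleftrightarrow>
     (\<forall>x\<in>carrier B. \<forall>y\<in>carrier B. \<tau> (x \<oplus>\<^bsub>B\<^esub> y) = \<tau> x + \<tau> y) \<and>
     (\<forall>a. \<forall>x\<in>carrier B. \<tau> (a \<odot>\<^bsub>B\<^esub> x) = a * \<tau> x) \<and>
     (\<forall>x\<in>carrier B. \<tau> (adj B x \<otimes>\<^bsub>B\<^esub> x) \<in> \<real> \<and> 0 \<le> Re (\<tau> (adj B x \<otimes>\<^bsub>B\<^esub> x))) \<and>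
     \<tau> \<one>\<^bsub>B\<^esub> = 1 \<and>
     (\<forall>x\<in>carrier B. \<forall>y\<in>carrier B. \<tau> (x \<otimes>\<^bsub>B\<^esub> y) = \<tau> (y \<otimes>\<^bsub>B\<^esub> x))"

definition tracial_cstar_algebras :: "'b cstar_algebra set" where
  "tracial_cstar_algebras = {B. unital_cstar_algebra B \<and> (\<exists>\<tau>. tracial_state B \<tau>)}"

definition unitary_group :: "'b cstar_algebra \<Rightarrow> 'b monoid" where
  "unitary_group B =
     \<lparr>carrier = {u \<in> carrier B. adj B u \<otimes>\<^bsub>B\<^esub> u = \<one>\<^bsub>B\<^esub> \<and> u \<otimes>\<^bsub>B\<^esub> adj B u = \<one>\<^bsub>B\<^esub>},
      mult = mult B, one = \<one>\<^bsub>B\<^esub>\<rparr>"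


section \<open>Uniform-to-local stability\<close>

text \<open>
  The algebras in the class have carriers inside the type \<open>'b\<close>. For a countable group and the class of
  tracial algebras the choice of \<open>'b\<close> is immaterial once it has at least the cardinality of the
  continuum: a failure of stability restricts to the unital C*-subalgebras generated by
  the images of the given maps, which are separable, and tracial states restrict to them.
  Unitaries have norm at most one, so the supremum below is taken over a bounded set.
\<close>

definition uniform_to_local_stable ::
    "'b cstar_algebra set \<Rightarrow> ('g, 'm) monoid_scheme \<Rightarrow> bool" where
  "uniform_to_local_stable \<B> G \<longleftrightarrow>
     (\<forall>(B :: nat \<Rightarrow> 'b cstar_algebra) (\<rho> :: nat \<Rightarrow> 'g \<Rightarrow> 'b).
        (\<forall>n. B n \<in> \<B>) \<and>
        (\<forall>n. \<rho> n \<in> carrier G \<rightarrow> carrier (unitary_group (B n))) \<and>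
        (\<forall>n. \<rho> n \<one>\<^bsub>G\<^esub> = \<one>\<^bsub>B n\<^esub>) \<and>
        (\<lambda>n. SUP (s, t) \<in> carrier G \<times> carrier G.
                nrm (B n) (\<rho> n (s \<otimes>\<^bsub>G\<^esub> t) \<ominus>\<^bsub>B n\<^esub> \<rho> n s \<otimes>\<^bsub>B n\<^esub> \<rho> n t)) \<longlonglongrightarrow> 0
        \<longrightarrow> (\<exists>\<pi> :: nat \<Rightarrow> 'g \<Rightarrow> 'b.
              (\<forall>n. \<pi> n \<in> hom G (unitary_group (B n))) \<and>
              (\<forall>s\<in>carrier G. (\<lambda>n. nrm (B n) (\<rho> n s \<ominus>\<^bsub>B n\<^esub> \<pi> n s)) \<longlonglongrightarrow> 0)))"


section \<open>Hyperbolic groups\<close>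

definition word_length :: "('g, 'm) monoid_scheme \<Rightarrow> 'g set \<Rightarrow> 'g \<Rightarrow> nat" where
  "word_length G S g =
     (LEAST n. \<exists>ws. length ws = n \<and> set ws \<subseteq> S \<union> (\<lambda>s. inv\<^bsub>G\<^esub> s) ` S \<and>
        foldr (\<otimes>\<^bsub>G\<^esub>) ws \<one>\<^bsub>G\<^esub> = g)"

definition word_dist :: "('g, 'm) monoid_scheme \<Rightarrow> 'g set \<Rightarrow> 'g \<Rightarrow> 'g \<Rightarrow> real" where
  "word_dist G S g h = real (word_length G S (inv\<^bsub>G\<^esub> g \<otimes>\<^bsub>G\<^esub> h))"

text \<open>Gromov's four-point condition, applied to the word metric of a finite generating set.\<close>

definition gromov_product :: "('a \<Rightarrow> 'a \<Rightarrow> real) \<Rightarrow> 'a \<Rightarrow> 'a \<Rightarrow> 'a \<Rightarrow> real" where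
  "gromov_product d w x y = (d w x + d w y - d x y) / 2"

definition gromov_hyperbolic :: "'a set \<Rightarrow> ('a \<Rightarrow> 'a \<Rightarrow> real) \<Rightarrow> bool" where
  "gromov_hyperbolic X d \<longleftrightarrow>
     (\<exists>\<delta>. \<forall>w\<in>X. \<forall>x\<in>X. \<forall>y\<in>X. \<forall>z\<in>X.
        min (gromov_product d w x y) (gromov_product d w y z) - \<delta> \<le> gromov_product d w x z)"

definition hyperbolic_group :: "('g, 'm) monoid_scheme \<Rightarrow> bool" where
  "hyperbolic_group G \<longleftrightarrow> group G \<and>
     (\<exists>S. finite S \<and> S \<subseteq> carrier G \<and> generate G S = carrier G \<and>
          gromov_hyperbolic (carrier G) (word_dist G S))"


section \<open>Second cohomology with trivial real coefficients\<close>

text \<open>Inhomogeneous cochains (bar resolution); cochains are extensional, so that equality of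
  functions is equality on the group.\<close>

definition cochains2 :: "('g, 'm) monoid_scheme \<Rightarrow> ('g \<times> 'g \<Rightarrow> real) monoid" where
  "cochains2 G =
     \<lparr>carrier = carrier G \<times> carrier G \<rightarrow>\<^sub>E UNIV,
      mult = (\<lambda>c c'. restrict (\<lambda>p. c p + c' p) (carrier G \<times> carrier G)),
      one = restrict (\<lambda>_. 0) (carrier G \<times> carrier G)\<rparr>"

definition cocycles2 :: "('g, 'm) monoid_scheme \<Rightarrow> ('g \<times> 'g \<Rightarrow> real) set" where
  "cocycles2 G = {c \<in> carrier (cochains2 G).
     \<forall>g\<in>carrier G. \<forall>h\<in>carrier G. \<forall>k\<in>carrier G.
       c (h, k) - c (g \<otimes>\<^bsub>G\<^esub> h, k) + c (g, h \<otimes>\<^bsub>G\<^esub> k) - c (g, h) = 0}"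

definition coboundary1 :: "('g, 'm) monoid_scheme \<Rightarrow> ('g \<Rightarrow> real) \<Rightarrow> 'g \<times> 'g \<Rightarrow> real" where
  "coboundary1 G \<phi> =
     restrict (\<lambda>(g, h). \<phi> h - \<phi> (g \<otimes>\<^bsub>G\<^esub> h) + \<phi> g) (carrier G \<times> carrier G)"

definition H2_real :: "('g, 'm) monoid_scheme \<Rightarrow> ('g \<times> 'g \<Rightarrow> real) set monoid" where
  "H2_real G = (cochains2 G)\<lparr>carrier := cocycles2 G\<rparr> Mod range (coboundary1 G)"

end

theory Submission
  imports Defs
begin

text \<open>
  On a hyperbolic group every real 2-cocycle is cohomologous to a bounded one. Read an alternating
  cocycle as an area of triangles and let \<open>P(x,y)\<close> be the supremum, over all paths from \<open>x\<close> to \<open>y\<close>,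
  of the enclosed area minus a large multiple of the length; the linear isoperimetric inequality makes
  it finite. Near-optimal paths are quasigeodesics, so they pass close to the centre of any
  triangle, and correcting the cocycle by the coboundary of \<open>(P(x,y) - P(y,x))/2\<close> makes it bounded.

  Let \<open>\<theta>\<close> be such a bounded cocycle that is not a coboundary. The twisted left regular representations
  with multiplier \<open>exp (i \<theta> / n)\<close> take values in tracial C*-algebras and their defects tend to 0
  uniformly. If homomorphisms \<open>\<pi>\<^sub>n\<close> were pointwise close to them, then the trace of the logarithm, which is
  additive on products near 1 and invariant under conjugation, applied to \<open>\<pi>\<^sub>n(s)\<^sup>* u\<^sub>n(s)\<close>
  would exhibit \<open>\<theta>\<close> as a coboundary on every finite set, hence everywhere.
\<close>

section \<open>Bounded representatives of cocycles on hyperbolic graphs\<close>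

text \<open>Stability promises closeness only at each group element separately, so each finite set
  of elements gets its own index \<open>n\<close> and its own primitive of
  \<open>\<theta> / (n + 1)\<close>. After rescaling, the primitives for different finite sets need
  be neither compatible nor bounded, so no limit of them can be taken; instead an infinite linear
  system is solved because all its finite subsystems are solvable. The trace is applied to the
  logarithm because the logarithm of a product differs from the sum of the logarithms by a series of
  commutators, on which a trace vanishes; no commutator estimates are needed. Boundedness of
  \<open>\<theta>\<close> matters because only then does division by \<open>n + 1\<close> make the
  defect small on the whole group at once. This division stays within cocycles because the
  coefficients are real.\<close>

text \<open>A discrete geodesic hyperbolic space with a homogeneous cocycle. \<open>d_split\<close>
  provides geodesics, and \<open>local_bound\<close> is what remains of an invariant cocycle on a
  Cayley graph with finite balls; symmetries return only in \<open>P_invariant\<close>.\<close>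

locale hyperbolic_cocycle =
  fixes X :: "'a set" and d :: "'a \<Rightarrow> 'a \<Rightarrow> nat" and \<delta> :: real and f :: "'a \<Rightarrow> 'a \<Rightarrow> 'a \<Rightarrow> real"
  assumes d_eq_0_iff: "\<lbrakk>x \<in> X; y \<in> X\<rbrakk> \<Longrightarrow> d x y = 0 \<longleftrightarrow> x = y"
    and d_sym: "\<lbrakk>x \<in> X; y \<in> X\<rbrakk> \<Longrightarrow> d x y = d y x"
    and d_triangle: "\<lbrakk>x \<in> X; y \<in> X; z \<in> X\<rbrakk> \<Longrightarrow> d x z \<le> d x y + d y z"
    and d_split: "\<lbrakk>x \<in> X; y \<in> X; d x y = m + n\<rbrakk> \<Longrightarrow> \<exists>z\<in>X. d x z = m \<and> d z y = n"
    and four_point: "\<lbrakk>w \<in> X; x \<in> X; y \<in> X; z \<in> X\<rbrakk> \<Longrightarrow>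
      min (gromov_product (\<lambda>x y. real (d x y)) w x y) (gromov_product (\<lambda>x y. real (d x y)) w y z) - \<delta>
        \<le> gromov_product (\<lambda>x y. real (d x y)) w x z"
    and cocycle: "\<lbrakk>x \<in> X; y \<in> X; z \<in> X; w \<in> X\<rbrakk> \<Longrightarrow> f y z w - f x z w + f x y w - f x y z = 0"
    and swap12: "\<lbrakk>x \<in> X; y \<in> X; z \<in> X\<rbrakk> \<Longrightarrow> f y x z = - f x y z"
    and swap23: "\<lbrakk>x \<in> X; y \<in> X; z \<in> X\<rbrakk> \<Longrightarrow> f x z y = - f x y z"
    and local_bound: "\<exists>M. \<forall>x\<in>X. \<forall>y\<in>X. \<forall>z\<in>X. d x y \<le> N \<longrightarrow> d x z \<le> N \<longrightarrow> \<bar>f x y z\<bar> \<le> M"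
begin

abbreviation gp :: "'a \<Rightarrow> 'a \<Rightarrow> 'a \<Rightarrow> real"
  where "gp \<equiv> gromov_product (\<lambda>x y. real (d x y))"

section \<open>Paths and the areas they enclose\<close>

definition path :: "'a list \<Rightarrow> bool" where
  "path xs \<longleftrightarrow> xs \<noteq> [] \<and> set xs \<subseteq> X \<and> successively (\<lambda>x y. d x y \<le> 1) xs"

text \<open>By the cocycle identity \<open>f b\<close> is a primitive of \<open>f\<close>, as in
  coning a cycle off at \<open>b\<close>; this function integrates it along the path.\<close>

fun fan :: "'a \<Rightarrow> 'a list \<Rightarrow> real" where
  "fan b (x # y # zs) = f b x y + fan b (y # zs)"
| "fan b _ = 0"

text \<open>The apex of the cone is the first vertex; on closed paths every other apex gives the
  same value, by \<open>fan_rebase\<close>.\<close>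

definition area :: "'a list \<Rightarrow> real" where
  "area xs = fan (hd xs) xs"

definition len :: "'a list \<Rightarrow> nat" where
  "len xs = length xs - 1"

lemma f_degenerate:
  assumes "x \<in> X" "y \<in> X"
  shows "f x x y = 0" "f x y y = 0" "f x y x = 0"
proof -
  show 1: "f x x y = 0" using swap12[of x x y] assms by simp
  show "f x y y = 0" using swap23[of x y y] assms by simp
  show "f x y x = 0" using swap23[of x x y] 1 assms by simp
qed

lemma fan_append:
  assumes "ws \<noteq> []"
  shows "fan b (us @ ws) = fan b (us @ [hd ws]) + fan b ws"
proof (induction us)
  case Nil
  then show ?case by simp
next
  case (Cons u us)
  then show ?case using assms by (cases us; cases ws) auto
qed

lemma fan_append2:
  assumes "ws \<noteq> []"
  shows "fan b (ws @ vs) = fan b ws + fan b (last ws # vs)"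
proof -
  have "fan b (butlast ws @ (last ws # vs)) = fan b (butlast ws @ [last ws]) + fan b (last ws # vs)"
    using fan_append[of "last ws # vs" b "butlast ws"] by simp
  moreover have "butlast ws @ (last ws # vs) = ws @ vs"
    using assms by (metis append.assoc append_Cons append_Nil append_butlast_last_id)
  ultimately show ?thesis using assms by simp
qed

text \<open>The cocycle identity shows that each edge contributes the increment of
  \<open>f b' b\<close> along it, and these increments telescope.\<close>

lemma fan_rebase:
  assumes "b \<in> X" "b' \<in> X" "set xs \<subseteq> X" "xs \<noteq> []"
  shows "fan b' xs = fan b xs + f b' b (last xs) - f b' b (hd xs)"
  using assms(3,4)
proof (induction xs rule: induct_list012)
  case (3 x y zs)
  have "f b x y - f b' x y + f b' b y - f b' b x = 0"
    using cocycle[of b' b x y] assms 3 by auto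
  then show ?case using 3 by auto
qed auto

lemma fan_rev:
  assumes "b \<in> X" "set xs \<subseteq> X"
  shows "fan b (rev xs) = - fan b xs"
  using assms(2)
proof (induction xs rule: induct_list012)
  case (3 x y zs)
  have "fan b (rev (x # y # zs)) = fan b (rev (y # zs)) + fan b (last (rev (y # zs)) # [x])"
    using fan_append2[of "rev (y # zs)" b "[x]"] by simp
  also have "last (rev (y # zs)) = y" by simp
  finally show ?case using 3 swap23[of b x y] assms by auto
qed auto

lemma pathD: "path xs \<Longrightarrow> xs \<noteq> []" "path xs \<Longrightarrow> set xs \<subseteq> X"
  "path xs \<Longrightarrow> hd xs \<in> X" "path xs \<Longrightarrow> last xs \<in> X"
  unfolding path_def by auto

lemma path_rev: "path xs \<Longrightarrow> path (rev xs)"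
  unfolding path_def
  by (auto simp: successively_rev elim!: successively_mono) (metis d_sym subsetD)

lemma area_rev:
  assumes "path xs"
  shows "area (rev xs) = - area xs"
proof -
  note p = pathD[OF assms]
  have "fan (last xs) (rev xs) = fan (hd xs) (rev xs) + f (last xs) (hd xs) (last (rev xs)) - f (last xs) (hd xs) (hd (rev xs))"
    using fan_rebase[of "hd xs" "last xs" "rev xs"] p by auto
  moreover have "last (rev xs) = hd xs" "hd (rev xs) = last xs" using p by (auto simp: last_rev hd_rev)
  ultimately show ?thesis unfolding area_def
    using p fan_rev f_degenerate by auto
qed

text \<open>The extra triangle in the area comes from moving the apex of \<open>ys\<close> to the
  start of \<open>xs\<close>.\<close>

lemma path_join:
  assumes "path xs" "path ys" "last xs = hd ys"
  shows "path (xs @ tl ys)" "hd (xs @ tl ys) = hd xs" "last (xs @ tl ys) = last ys"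
    "len (xs @ tl ys) = len xs + len ys"
    "area (xs @ tl ys) = area xs + area ys + f (hd xs) (hd ys) (last ys)"
proof -
  note p = pathD[OF assms(1)] and q = pathD[OF assms(2)]
  obtain y ys' where ys: "ys = y # ys'" using q by (cases ys) auto
  show "path (xs @ tl ys)" using assms ys unfolding path_def
    by (cases ys') (auto simp: successively_append_iff)
  show hd: "hd (xs @ tl ys) = hd xs" using p by simp
  show "last (xs @ tl ys) = last ys" using ys assms by (cases ys') auto
  show "len (xs @ tl ys) = len xs + len ys" unfolding len_def using p q ys by (cases xs) auto
  have "fan (hd xs) (xs @ tl ys) = fan (hd xs) xs + fan (hd xs) ys"
    using fan_append2[of xs "hd xs" "tl ys"] p assms ys by simp
  also have "fan (hd xs) ys = fan (hd ys) ys + f (hd xs) (hd ys) (last ys) - f (hd xs) (hd ys) (hd ys)"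
    by (rule fan_rebase) (use p q in auto)
  finally show "area (xs @ tl ys) = area xs + area ys + f (hd xs) (hd ys) (last ys)"
    unfolding area_def hd using p q f_degenerate by simp
qed

text \<open>The old and the new piece share both endpoints, so a change of apex alters their two
  fans by the same amount.\<close>

lemma path_replace:
  assumes "path (us @ ws @ vs)" "path \<gamma>" "ws \<noteq> []" "hd \<gamma> = hd ws" "last \<gamma> = last ws"
  shows "path ws" "path (us @ \<gamma> @ vs)" "hd (us @ \<gamma> @ vs) = hd (us @ ws @ vs)"
    "last (us @ \<gamma> @ vs) = last (us @ ws @ vs)"
    "area (us @ ws @ vs) - area (us @ \<gamma> @ vs) = area ws - area \<gamma>"
proof -
  note g = pathD[OF assms(2)] and p = pathD[OF assms(1)]
  show ws: "path ws" using assms unfolding path_def by (auto simp: successively_append_iff)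
  note w = pathD[OF ws]
  show pg: "path (us @ \<gamma> @ vs)" using assms unfolding path_def by (auto simp: successively_append_iff)
  show hd: "hd (us @ \<gamma> @ vs) = hd (us @ ws @ vs)" using assms g by (cases us) auto
  show "last (us @ \<gamma> @ vs) = last (us @ ws @ vs)" using assms g by (cases vs rule: rev_cases) auto
  define b where "b = hd (us @ ws @ vs)"
  have b: "b \<in> X" using p b_def by simp
  have "fan b (us @ ws @ vs) - fan b (us @ \<gamma> @ vs) = fan b ws - fan b \<gamma>"
    using assms g by (simp add: fan_append[of "_ @ vs"] fan_append2)
  also have "\<dots> = area ws - area \<gamma>"
    unfolding area_def using fan_rebase[of "hd ws" b ws] fan_rebase[of "hd ws" b \<gamma>] assms(4,5) b w g by simp
  finally show "area (us @ ws @ vs) - area (us @ \<gamma> @ vs) = area ws - area \<gamma>"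
    unfolding area_def hd b_def .
qed

lemma ex_geodesic:
  assumes "x \<in> X" "y \<in> X"
  shows "\<exists>\<gamma>. path \<gamma> \<and> hd \<gamma> = x \<and> last \<gamma> = y \<and> len \<gamma> = d x y"
  using assms
proof (induction "d x y" arbitrary: x)
  case 0
  then show ?case using d_eq_0_iff by (intro exI[of _ "[x]"]) (auto simp: path_def len_def)
next
  case (Suc n)
  obtain z where z: "z \<in> X" "d x z = 1" "d z y = n"
    using d_split[of x y 1 n] Suc by auto
  obtain \<gamma> where g: "path \<gamma>" "hd \<gamma> = z" "last \<gamma> = y" "len \<gamma> = n" using Suc z by metis
  then have "path (x # \<gamma>)" using z Suc unfolding path_def by (cases \<gamma>) auto
  moreover have "len (x # \<gamma>) = Suc n" "last (x # \<gamma>) = y"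
    using g pathD(1) unfolding len_def by (auto simp: neq_Nil_conv path_def)
  ultimately show ?case using Suc by (intro exI[of _ "x # \<gamma>"]) auto
qed

lemma path_nth:
  assumes "path xs"
  shows "\<And>i. i \<le> len xs \<Longrightarrow> xs ! i \<in> X" "hd xs = xs ! 0" "last xs = xs ! len xs"
  using pathD[OF assms] unfolding len_def
  by (auto simp: hd_conv_nth last_conv_nth neq_Nil_conv less_Suc_eq_le) (metis length_Cons less_Suc_eq_le nth_mem list.set_intros(1) subsetD insertE list.simps(15))

lemma path_dist_le:
  assumes "path xs" "i \<le> j" "j \<le> len xs"
  shows "d (xs ! i) (xs ! j) \<le> j - i"
  using assms(2,3)
proof (induction j rule: dec_induct)
  case base
  then show ?case using d_eq_0_iff[of "xs!i" "xs!i"] path_nth[OF assms(1)] by auto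
next
  case (step n)
  have "d (xs ! n) (xs ! Suc n) \<le> 1"
    using assms(1) step unfolding path_def len_def by (auto simp: successively_conv_nth)
  moreover have "d (xs ! i) (xs ! Suc n) \<le> d (xs ! i) (xs ! n) + d (xs ! n) (xs ! Suc n)"
    using step assms by (intro d_triangle path_nth[OF assms(1)]) auto
  ultimately show ?case using step by auto
qed

section \<open>Local geodesics and the linear isoperimetric inequality\<close>

lemma delta_nonneg: "x \<in> X \<Longrightarrow> \<delta> \<ge> 0"
  using four_point[of x x x x] by simp

lemma gp_self: "\<lbrakk>w \<in> X; x \<in> X\<rbrakk> \<Longrightarrow> gp w w x = 0" "\<lbrakk>w \<in> X; x \<in> X\<rbrakk> \<Longrightarrow> gp w x w = 0"
  using d_eq_0_iff[of w w] d_sym[of w x] unfolding gromov_product_def by auto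

text \<open>Local-to-global principle: along samples taken every \<open>h\<close> steps, the
  four-point condition passes the bound \<delta> on the Gromov product from one corner to the next,
  so each sample is at least \<open>h - 2 * \<delta>\<close> further from the start.\<close>

lemma local_geodesic_not_closed:
  fixes h :: nat
  assumes p: "path xs" and h: "real h \<ge> 4 * \<delta> + 1"
    and loc: "\<And>i j. \<lbrakk>i < j; j \<le> len xs; j - i \<le> 2 * h\<rbrakk> \<Longrightarrow> d (xs ! i) (xs ! j) = j - i"
    and long: "len xs \<ge> 2 * h"
  shows "hd xs \<noteq> last xs"
proof -
  define y where "y m = xs ! (m * h)" for m
  have d0: "\<delta> \<ge> 0" using delta_nonneg pathD(3)[OF p] by blast
  have h1: "h \<ge> 1" using h d0 by (cases h) auto
  note inX = path_nth(1)[OF p]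
  have main: "gp (y m) (y 0) (y (Suc m)) \<le> \<delta> \<and> real (d (y 0) (y (Suc m))) \<ge> Suc m * (h - 2 * \<delta>)"
    if "Suc m * h \<le> len xs" for m
    using that
  proof (induction m)
    case 0
    have "d (y 0) (y 1) = h" using loc[of 0 h] 0 h1 by (simp add: y_def)
    then show ?case using d0 gp_self[of "y 0" "y (Suc 0)"] inX 0 by (auto simp: y_def)
  next
    case (Suc m)
    have Y: "y k \<in> X" if "k \<le> Suc (Suc m)" for k
      unfolding y_def using Suc.prems that
      by (intro inX) (meson le_trans mult_le_mono1)
    have d1: "d (y m) (y (Suc m)) = h" "d (y (Suc m)) (y (Suc (Suc m))) = h"
       "d (y m) (y (Suc (Suc m))) = 2 * h"
      unfolding y_def
      using loc[of "m * h" "Suc m * h"] loc[of "Suc m * h" "Suc (Suc m) * h"] loc[of "m * h" "Suc (Suc m) * h"] h1 Suc.prems by auto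
    have IH: "gp (y m) (y 0) (y (Suc m)) \<le> \<delta>" "real (d (y 0) (y (Suc m))) \<ge> Suc m * (h - 2 * \<delta>)"
      using Suc by auto
    have s: "d (y (Suc m)) (y m) = d (y m) (y (Suc m))" "d (y (Suc m)) (y 0) = d (y 0) (y (Suc m))"
      "d (y 0) (y m) = d (y m) (y 0)" using d_sym Y by auto
    have a: "gp (y (Suc m)) (y m) (y 0) = h - gp (y m) (y 0) (y (Suc m))"
      using d1 s unfolding gromov_product_def by (auto simp: field_simps)
    have b: "gp (y (Suc m)) (y m) (y (Suc (Suc m))) = 0"
      using d1 s unfolding gromov_product_def by auto
    \<comment> \<open>The first entry of the minimum is at least \<open>h - \<delta>\<close>, which
      exceeds \<delta>; hence the second entry must be the small one.\<close>
    have "min (gp (y (Suc m)) (y m) (y 0)) (gp (y (Suc m)) (y 0) (y (Suc (Suc m)))) - \<delta> \<le> 0"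
      using four_point[of "y (Suc m)" "y m" "y 0" "y (Suc (Suc m))"] Y b by auto
    then have c: "gp (y (Suc m)) (y 0) (y (Suc (Suc m))) \<le> \<delta>" using a IH h d0 by linarith
    have "real (d (y 0) (y (Suc (Suc m)))) = d (y 0) (y (Suc m)) + h - 2 * gp (y (Suc m)) (y 0) (y (Suc (Suc m)))"
      using d1 s unfolding gromov_product_def by (auto simp: field_simps)
    also have "\<dots> \<ge> Suc m * (h - 2 * \<delta>) + (h - 2 * \<delta>)" using c IH by linarith
    finally show ?case using c by (simp add: algebra_simps)
  qed
  define m where "m = len xs div h"
  define r where "r = len xs mod h"
  have m: "m \<ge> 2" "m * h + r = len xs" "r < h" unfolding m_def r_def
    using long h1 by (auto simp: less_eq_div_iff_mult_less_eq)
  have dr: "d (y m) (last xs) \<le> r"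
    using path_dist_le[OF p, of "m * h" "len xs"] m path_nth[OF p] by (auto simp: y_def)
  have "real (d (y 0) (y m)) \<ge> m * (h - 2 * \<delta>)" using main[of "m - 1"] m by auto
  moreover have "real m * (h - 2 * \<delta>) \<ge> 2 * (h - 2 * \<delta>)" using m h d0 by (intro mult_right_mono) auto
  \<comment> \<open>The choice \<open>h \<ge> 4 * \<delta> + 1\<close> pays off: two sampled steps
    already outweigh the leftover \<open>r < h\<close>.\<close>
  moreover have "2 * (real h - 2 * \<delta>) > real r" proof -
    have "real r < real h" using m by simp
    moreover have "2 * (real h - 2 * \<delta>) \<ge> real h + 1" using h by argo
    ultimately show ?thesis by linarith
  qed
  ultimately have "real (d (y 0) (y m)) > r" by linarith
  moreover have "d (y 0) (y m) = d (y m) (y 0)" using m by (intro d_sym) (auto simp: y_def intro!: inX)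
  ultimately have "y 0 \<noteq> last xs" using dr by auto
  then show ?thesis using path_nth[OF p] by (auto simp: y_def)
qed

lemma fan_bound:
  assumes "path xs" "b \<in> X" "M \<ge> 0" "\<And>x y. \<lbrakk>x \<in> set xs; y \<in> set xs\<rbrakk> \<Longrightarrow> \<bar>f b x y\<bar> \<le> M"
  shows "\<bar>fan b xs\<bar> \<le> M * len xs"
  using assms
proof (induction xs rule: induct_list012)
  case (3 x y zs)
  have "\<bar>fan b (y # zs)\<bar> \<le> M * len (y # zs)" using 3 by (intro 3) (auto simp: path_def)
  moreover have "\<bar>f b x y\<bar> \<le> M" using 3 by auto
  ultimately show ?case by (auto simp: len_def algebra_simps)
qed (auto simp: len_def)

text \<open>Dehn's algorithm. A closed path of length at least \<open>2 * h\<close> cannot be a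
  local geodesic, so some piece of length at most \<open>2 * h\<close> has a shorter replacement.
  Each replacement saves at least one edge and changes the area by that of a loop of length at most
  \<open>4 * h\<close>, which \<open>local_bound\<close> controls.\<close>

lemma isoperimetric:
  "\<exists>A\<ge>1::real. \<forall>xs. path xs \<longrightarrow> hd xs = last xs \<longrightarrow> \<bar>area xs\<bar> \<le> A * len xs"
proof -
  obtain h :: nat where h: "real h \<ge> 4 * \<delta> + 1" using real_arch_simple by blast
  obtain M where M: "\<And>x y z. \<lbrakk>x \<in> X; y \<in> X; z \<in> X; d x y \<le> 4 * h; d x z \<le> 4 * h\<rbrakk> \<Longrightarrow> \<bar>f x y z\<bar> \<le> M"
    using local_bound[of "4 * h"] by blast
  define M' where "M' = max M 0"
  have small: "\<bar>area xs\<bar> \<le> M' * len xs" if "path xs" "len xs \<le> 4 * h" for xs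
    unfolding area_def
  proof (rule fan_bound)
    fix x y assume xy: "x \<in> set xs" "y \<in> set xs"
    have *: "d (hd xs) u \<le> 4 * h \<and> u \<in> X" if "u \<in> set xs" for u
    proof -
      obtain i where "i < length xs" "u = xs ! i" using \<open>u \<in> set xs\<close> by (metis in_set_conv_nth)
      then show ?thesis using path_dist_le[OF \<open>path xs\<close>, of 0 i] path_nth[OF \<open>path xs\<close>] \<open>len xs \<le> 4 * h\<close>
        by (force simp: len_def)
    qed
    then show "\<bar>f (hd xs) x y\<bar> \<le> M'" using M[of "hd xs" x y] xy pathD(3)[OF \<open>path xs\<close>] by (force simp: M'_def)
  qed (use that pathD in \<open>auto simp: M'_def\<close>)
  \<comment> \<open>\<open>M'\<close> covers the short loops, \<open>M' * (4 * h)\<close> pays for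
    one replacement, and 1 lets additive errors be absorbed into multiples of \<open>A\<close>
    later.\<close>
  define A where "A = max 1 (max M' (M' * (4 * h)))"
  have A: "A \<ge> 1" "A \<ge> M' * (4 * h)" "A \<ge> M'"
    unfolding A_def by linarith+
  have "\<bar>area xs\<bar> \<le> A * len xs" if "path xs" "hd xs = last xs" for xs
    using that
  proof (induction "len xs" arbitrary: xs rule: less_induct)
    case less
    note p = less(2)
    show ?case
    proof (cases "len xs < 2 * h")
      case True
      then have "\<bar>area xs\<bar> \<le> M' * len xs" using small[OF p] by auto
      also have "\<dots> \<le> A * len xs" using A by (intro mult_right_mono) auto
      finally show ?thesis .
    next
      case False
      then obtain i j where ij: "i < j" "j \<le> len xs" "j - i \<le> 2 * h" "d (xs ! i) (xs ! j) \<noteq> j - i"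
        using local_geodesic_not_closed[OF p h] less by (meson not_less)
      then have short: "d (xs ! i) (xs ! j) < j - i" using path_dist_le[OF p, of i j] by auto
      have L: "j < length xs" using ij p pathD(1) by (auto simp: len_def)
      define us ws vs where "us = take i xs" and "ws = take (Suc (j - i)) (drop i xs)" and "vs = drop (Suc j) xs"
      have "Suc (j - i) + i = Suc j" using ij by simp
      then have "vs = drop (Suc (j - i)) (drop i xs)" by (simp only: vs_def drop_drop)
      then have xs: "xs = us @ ws @ vs" by (simp only: us_def ws_def append_take_drop_id)
      have ws: "ws \<noteq> []" "hd ws = xs ! i" "last ws = xs ! j" "length ws = Suc (j - i)"
        using ij L unfolding ws_def by (auto simp: hd_drop_conv_nth last_conv_nth hd_take)
      obtain \<gamma> where g: "path \<gamma>" "hd \<gamma> = xs ! i" "last \<gamma> = xs ! j" "len \<gamma> = d (xs ! i) (xs ! j)"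
        using ex_geodesic path_nth(1)[OF p] ij by (meson less_imp_le le_trans)
      note rep = path_replace[of us ws vs \<gamma>, OF p[unfolded xs] g(1) ws(1)]
      have glen: "length \<gamma> = Suc (len \<gamma>)" using pathD(1)[OF g(1)] by (cases \<gamma>) (auto simp: len_def)
      have len': "len (us @ \<gamma> @ vs) < len xs"
        using glen ws(4) short g(4) unfolding len_def xs by auto
      have hl: "hd \<gamma> = hd ws" "last \<gamma> = last ws" using g ws by auto
      note rep = rep[OF hl]
      have "\<bar>area (us @ \<gamma> @ vs)\<bar> \<le> A * len (us @ \<gamma> @ vs)"
        by (rule less(1)[OF len' rep(2)]) (use rep(3,4) less(3) in \<open>simp flip: xs\<close>)
      also have "\<dots> \<le> A * (len xs - 1)" using len' A by (intro mult_left_mono) auto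
      finally have 1: "\<bar>area (us @ \<gamma> @ vs)\<bar> \<le> A * (len xs - 1)" .
      \<comment> \<open>Closing \<open>ws\<close> up with the reversed geodesic turns the difference
        of the two areas into the area of a short loop.\<close>
      note J = path_join[OF rep(1) path_rev[OF g(1)]]
      have hr: "last ws = hd (rev \<gamma>)" using hl pathD(1)[OF g(1)] by (simp add: hd_rev)
      note J = J[OF hr]
      have lastr: "last (rev \<gamma>) = hd ws" using hl pathD(1)[OF g(1)] by (simp add: last_rev)
      have "area (ws @ tl (rev \<gamma>)) = area ws - area \<gamma>"
        using J(5) area_rev[OF g(1)] lastr f_degenerate pathD(3,4)[OF rep(1)] hr by auto
      moreover have l4: "len (ws @ tl (rev \<gamma>)) \<le> 4 * h"
        using J(4) ws(4) g(4) short ij by (auto simp: len_def)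
      ultimately have "\<bar>area ws - area \<gamma>\<bar> \<le> M' * len (ws @ tl (rev \<gamma>))"
        using small[OF J(1)] by auto
      also have "\<dots> \<le> M' * (4 * h)" using l4 by (intro mult_left_mono) (auto simp: M'_def simp flip: of_nat_mult)
      finally have 2: "\<bar>area ws - area \<gamma>\<bar> \<le> A" using A by linarith
      have "area xs = area (us @ \<gamma> @ vs) + (area ws - area \<gamma>)" using rep(5) xs by simp
      then have "\<bar>area xs\<bar> \<le> A * (len xs - 1) + A" using 1 2 by linarith
      also have "\<dots> = A * len xs" using len' by (simp add: algebra_simps of_nat_diff)
      finally show ?thesis .
    qed
  qed
  then show ?thesis using A(1) by (intro exI[of _ A]) simp
qed

section \<open>Quasigeodesics pass near the points with small Gromov product\<close>

lemma gp_ge: "\<lbrakk>w \<in> X; x \<in> X; y \<in> X\<rbrakk> \<Longrightarrow> gp w x y \<ge> real (d w x) - real (d x y)"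
  using d_triangle[of w y x] d_sym[of x y] unfolding gromov_product_def by simp

lemma gp_sym: "\<lbrakk>x \<in> X; y \<in> X\<rbrakk> \<Longrightarrow> gp w x y = gp w y x"
  using d_sym[of x y] unfolding gromov_product_def by simp

text \<open>Combining the four-point condition along a chain costs \<open>\<delta>\<close> per step; sampling the chain every
  \<open>L \<ge> 12 \<delta>\<close> vertices, the linear growth of the distance to \<open>o\<close> pays for it.\<close>

lemma gp_chain:
  fixes z :: "nat \<Rightarrow> 'a" and c :: real
  assumes w: "w \<in> X" and z: "\<And>i. i \<le> k \<Longrightarrow> z i \<in> X"
    and step: "\<And>i j. \<lbrakk>i \<le> j; j \<le> k\<rbrakk> \<Longrightarrow> d (z i) (z j) \<le> j - i"
    and far: "\<And>i. i \<le> k \<Longrightarrow> real (d w (z i)) \<ge> c + i / 12"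
    and L: "real L \<ge> 12 * \<delta> + 1"
    and i: "i \<le> k"
  shows "gp w (z i) (z k) \<ge> c + i / 12 - L - \<delta>"
  using i
proof (induction "k - i" arbitrary: i rule: less_induct)
  case less
  have d0: "\<delta> \<ge> 0" using delta_nonneg w by blast
  then have L1: "L \<ge> 1" using L by (cases L) auto
  show ?case
  proof (cases "k - i \<le> L")
    case True
    have "gp w (z i) (z k) \<ge> real (d w (z i)) - real (d (z i) (z k))" using gp_ge w z less by auto
    moreover have "real (d (z i) (z k)) \<le> L" using step[of i k] less True by simp
    ultimately show ?thesis using far[of i] less d0 by simp
  next
    case False
    have "gp w (z (i + L)) (z k) \<ge> c + (i + L) / 12 - L - \<delta>"
      using less(1)[of "i + L"] False L1 by auto
    then have 1: "gp w (z (i + L)) (z k) \<ge> c + i / 12 - L" using L by (simp add: field_simps)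
    have "gp w (z i) (z (i + L)) \<ge> real (d w (z i)) - real (d (z i) (z (i + L)))"
      using gp_ge w z less False by auto
    moreover have "real (d (z i) (z (i + L))) \<le> L" using step[of i "i + L"] less False by simp
    ultimately have 2: "gp w (z i) (z (i + L)) \<ge> c + i / 12 - L" using far[of i] less by simp
    have "gp w (z i) (z k) \<ge> min (gp w (z i) (z (i + L))) (gp w (z (i + L)) (z k)) - \<delta>"
      using four_point[of w "z i" "z (i + L)" "z k"] w z less False by auto
    then show ?thesis using 1 2 by linarith
  qed
qed

text \<open>Let \<open>D\<close> be the distance from \<open>w\<close> to a nearest point of the
  path. The path escapes linearly from \<open>w\<close> in both directions, so the Gromov products
  of that point with both ends are at least \<open>D / 2\<close> up to a constant; the four-point
  condition then bounds \<open>D / 2\<close> by the Gromov product of the ends.\<close>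

lemma quasigeodesic_near:
  assumes p: "path p" and w: "w \<in> X"
    and qg: "\<And>i j. \<lbrakk>i \<le> j; j \<le> len p\<rbrakk> \<Longrightarrow> j - i \<le> 3 * d (p ! i) (p ! j) + 1"
    and L: "real L \<ge> 12 * \<delta> + 1"
    and gp: "gp w (hd p) (last p) \<le> C"
  shows "\<exists>i\<le>len p. real (d w (p ! i)) \<le> 2 * (C + L + 2 * \<delta> + 1)"
proof -
  define D where "D = Min ((\<lambda>i. d w (p ! i)) ` {..len p})"
  have "D \<in> (\<lambda>i. d w (p ! i)) ` {..len p}" unfolding D_def by (intro Min_in) auto
  then obtain i0 where i0: "i0 \<le> len p" "d w (p ! i0) = D" by auto
  have D: "D \<le> d w (p ! i)" if "i \<le> len p" for i unfolding D_def using that by auto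
  note inX = path_nth(1)[OF p]
  have far: "real (d w (p ! i)) \<ge> (D / 2 - 1 / 12) + m / 12"
    if m: "i \<le> len p" "i = i0 + m \<or> i0 = i + m" for i m
  proof -
    have "d (p ! i0) (p ! i) = d (p ! i) (p ! i0)" using d_sym inX i0 m by auto
    then have "m \<le> 3 * d (p ! i0) (p ! i) + 1" using qg[of i0 i] qg[of i i0] m i0 by auto
    moreover have "d (p ! i0) (p ! i) \<le> d (p ! i0) w + d w (p ! i)" using d_triangle inX i0 m w by auto
    moreover have "d (p ! i0) w = D" using i0 d_sym w inX by auto
    ultimately have "m \<le> 3 * D + 3 * d w (p ! i) + 1" by linarith
    \<comment> \<open>One quarter of the bound \<open>(m - 1) / 3 - D\<close> plus three quarters of
      the bound \<open>D\<close> gives \<open>D / 2\<close> and the slope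
      \<open>1 / 12\<close>.\<close>
    then show ?thesis using D[OF m(1)] by linarith
  qed
  have "gp w (p ! (i0 + 0)) (p ! (i0 + (len p - i0))) \<ge> (D / 2 - 1 / 12) + real 0 / 12 - L - \<delta>"
  proof (rule gp_chain[OF w _ _ _ L])
    show "p ! (i0 + i) \<in> X" if "i \<le> len p - i0" for i using inX i0 that by simp
    show "d (p ! (i0 + i)) (p ! (i0 + j)) \<le> j - i" if "i \<le> j" "j \<le> len p - i0" for i j
      using path_dist_le[OF p, of "i0 + i" "i0 + j"] i0 that by simp
    show "D / 2 - 1 / 12 + i / 12 \<le> d w (p ! (i0 + i))" if "i \<le> len p - i0" for i
      using far[of "i0 + i" i] i0 that by simp
  qed simp
  then have 1: "gp w (p ! i0) (p ! len p) \<ge> (D / 2 - 1 / 12) - L - \<delta>" using i0 by simp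
  \<comment> \<open>The same chain argument, run from \<open>i0\<close> back to the start of the
    path.\<close>
  have "gp w (p ! (i0 - 0)) (p ! (i0 - i0)) \<ge> (D / 2 - 1 / 12) + real 0 / 12 - L - \<delta>"
  proof (rule gp_chain[OF w _ _ _ L])
    show "p ! (i0 - i) \<in> X" if "i \<le> i0" for i using inX i0 that by simp
    show "d (p ! (i0 - i)) (p ! (i0 - j)) \<le> j - i" if "i \<le> j" "j \<le> i0" for i j
      using path_dist_le[OF p, of "i0 - j" "i0 - i"] i0 that d_sym[OF inX inX, of "i0 - i" "i0 - j"] by simp
    show "D / 2 - 1 / 12 + i / 12 \<le> d w (p ! (i0 - i))" if "i \<le> i0" for i
      using far[of "i0 - i" i] i0 that by simp
  qed simp
  then have 2: "gp w (p ! i0) (p ! 0) \<ge> (D / 2 - 1 / 12) - L - \<delta>" by simp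
  have "min (gp w (p ! 0) (p ! i0)) (gp w (p ! i0) (p ! len p)) - \<delta> \<le> C"
    using four_point[of w "p ! 0" "p ! i0" "p ! len p"] gp w inX i0 path_nth[OF p] by auto
  then have "D / 2 - 1 / 12 - L - 2 * \<delta> \<le> C" using 1 2 gp_sym[of "p ! i0" "p ! 0" w] inX i0 by auto
  then show ?thesis using i0 by (intro exI[of _ i0]) auto
qed

section \<open>The penalized area\<close>

definition paths :: "'a \<Rightarrow> 'a \<Rightarrow> 'a list set" where
  "paths x y = {p. path p \<and> hd p = x \<and> last p = y}"

text \<open>For \<open>K\<close> above the isoperimetric constant long detours do not pay, so the supremum is finite.\<close>

definition P :: "real \<Rightarrow> 'a \<Rightarrow> 'a \<Rightarrow> real" where
  "P K x y = (SUP p\<in>paths x y. area p - K * len p)"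

lemma paths_nonempty: "\<lbrakk>x \<in> X; y \<in> X\<rbrakk> \<Longrightarrow> paths x y \<noteq> {}"
  using ex_geodesic[of x y] unfolding paths_def by blast

text \<open>A symmetry permutes the competing paths and preserves their areas and lengths. For left
  translations of a group this makes the correction of the cocycle an inhomogeneous cochain.\<close>

lemma P_invariant:
  assumes g: "\<And>x. x \<in> X \<Longrightarrow> g x \<in> X" and g': "\<And>x. x \<in> X \<Longrightarrow> g' x \<in> X"
    and inv: "\<And>x. x \<in> X \<Longrightarrow> g' (g x) = x" "\<And>x. x \<in> X \<Longrightarrow> g (g' x) = x"
    and d: "\<And>x y. \<lbrakk>x \<in> X; y \<in> X\<rbrakk> \<Longrightarrow> d (g x) (g y) = d x y"
    and f: "\<And>x y z. \<lbrakk>x \<in> X; y \<in> X; z \<in> X\<rbrakk> \<Longrightarrow> f (g x) (g y) (g z) = f x y z"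
    and xy: "x \<in> X" "y \<in> X"
  shows "P K (g x) (g y) = P K x y"
proof -
  have d': "d (g' x) (g' y) = d x y" if "x \<in> X" "y \<in> X" for x y
    using d[of "g' x" "g' y"] that g' inv by auto
  have path_map: "path (map h xs)"
    if "path xs" "\<And>x. x \<in> X \<Longrightarrow> h x \<in> X" "\<And>x y. \<lbrakk>x \<in> X; y \<in> X\<rbrakk> \<Longrightarrow> d (h x) (h y) = d x y" for xs h
    using that unfolding path_def
    by (auto simp: successively_map elim!: successively_mono) (metis subsetD)
  have fan_map: "fan (g b) (map g xs) = fan b xs" if "b \<in> X" "set xs \<subseteq> X" for b xs
    using that(2) by (induction xs rule: induct_list012) (use f that(1) in auto)
  have "paths (g x) (g y) = map g ` paths x y"
  proof (intro equalityI subsetI)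
    fix p assume "p \<in> paths (g x) (g y)"
    then have p: "path p" "hd p = g x" "last p = g y" by (auto simp: paths_def)
    have "map g (map g' p) = p" using pathD(2)[OF p(1)] inv(2) by (induction p) auto
    moreover have "map g' p \<in> paths x y"
      using p path_map[OF p(1) g' d'] pathD(1)[OF p(1)] inv xy by (auto simp: paths_def hd_map last_map)
    ultimately show "p \<in> map g ` paths x y" by (metis image_eqI)
  next
    fix q assume "q \<in> map g ` paths x y"
    then show "q \<in> paths (g x) (g y)" using path_map[OF _ g d] pathD(1)
      by (auto simp: paths_def hd_map last_map)
  qed
  moreover have "area (map g p) - K * len (map g p) = area p - K * len p" if "p \<in> paths x y" for p
    using that pathD[of p] fan_map unfolding paths_def area_def len_def by (simp add: hd_map)
  ultimately show ?thesis unfolding P_def by (simp add: image_image cong: image_cong_simp)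
qed

end

section \<open>Efficient paths and the bounded correction\<close>

locale hyperbolic_cocycle_filling = hyperbolic_cocycle +
  fixes A :: real
  assumes A_ge_1: "A \<ge> 1"
    and filling: "\<And>xs. path xs \<Longrightarrow> hd xs = last xs \<Longrightarrow> \<bar>area xs\<bar> \<le> A * len xs"
begin

text \<open>A detour gains at most \<open>A\<close> of area per unit of length and costs
  \<open>2 * A\<close>, which leaves a net loss of \<open>A\<close> per unit.\<close>

abbreviation "K \<equiv> 2 * A"

lemma area_diff:
  assumes "p \<in> paths x y" "q \<in> paths x y"
  shows "\<bar>area p - area q\<bar> \<le> A * (len p + len q)"
proof -
  have p: "path p" "hd p = x" "last p = y" and q: "path q" "hd q = x" "last q = y"
    using assms by (auto simp: paths_def)
  note p' = pathD[OF p(1)] and q' = pathD[OF q(1)]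
  have e: "last p = hd (rev q)" "last (rev q) = x" using q q' p by (auto simp: hd_rev last_rev)
  note J = path_join[OF p(1) path_rev[OF q(1)] e(1)]
  have "\<bar>area (p @ tl (rev q))\<bar> \<le> A * (len p + len q)"
    using filling[OF J(1)] J e p q by (auto simp: len_def)
  moreover have "area (p @ tl (rev q)) = area p - area q"
    using J(5) area_rev[OF q(1)] e p f_degenerate p' by auto
  ultimately show ?thesis by simp
qed

lemma bdd:
  assumes "x \<in> X" "y \<in> X"
  shows "bdd_above ((\<lambda>p. area p - K * len p) ` paths x y)"
proof -
  obtain \<gamma> where g: "\<gamma> \<in> paths x y" using paths_nonempty assms by blast
  have "area p - K * len p \<le> area \<gamma> + A * len \<gamma>" if "p \<in> paths x y" for p
  proof -
    have "A * len p \<ge> 0" using A_ge_1 by simp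
    then show ?thesis using area_diff[OF that g] by (simp add: algebra_simps)
  qed
  then show ?thesis by (intro bdd_aboveI2)
qed

lemma P_upper: "p \<in> paths x y \<Longrightarrow> area p - K * len p \<le> P K x y"
  unfolding P_def using pathD[of p] by (intro cSUP_upper bdd) (auto simp: paths_def)

lemma P_least:
  assumes "x \<in> X" "y \<in> X" "\<And>p. p \<in> paths x y \<Longrightarrow> area p - K * len p \<le> c"
  shows "P K x y \<le> c"
  unfolding P_def by (rule cSUP_least[OF paths_nonempty[OF assms(1,2)] assms(3)])

text \<open>Paths from \<open>x\<close> to \<open>y\<close> and from \<open>y\<close> to
  \<open>z\<close> concatenate; the triangle is the correction term of
  \<open>path_join\<close>.\<close>

lemma P_superadd:
  assumes "x \<in> X" "y \<in> X" "z \<in> X"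
  shows "P K x y + P K y z + f x y z \<le> P K x z"
proof -
  have *: "area p - K * len p + (area q - K * len q) + f x y z \<le> P K x z"
    if "p \<in> paths x y" "q \<in> paths y z" for p q
  proof -
    have p: "path p" "hd p = x" "last p = y" and q: "path q" "hd q = y" "last q = z"
      using that by (auto simp: paths_def)
    have e: "last p = hd q" using p q by simp
    note J = path_join[OF p(1) q(1) e]
    have "p @ tl q \<in> paths x z" using J p q by (auto simp: paths_def)
    from P_upper[OF this] show ?thesis using J p q by (simp add: algebra_simps)
  qed
  have "P K x y \<le> P K x z - P K y z - f x y z"
  proof (rule P_least)
    fix p assume p: "p \<in> paths x y"
    have "P K y z \<le> P K x z - f x y z - (area p - K * len p)"
      by (rule P_least) (use *[OF p] assms in \<open>auto simp: algebra_simps\<close>)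
    then show "area p - K * len p \<le> P K x z - P K y z - f x y z" by simp
  qed (use assms in auto)
  then show ?thesis by simp
qed

text \<open>A geodesic and its reverse have opposite areas, so only the two length penalties remain.
  This is the price of moving the middle vertex in \<open>\<Delta>_bound\<close>.\<close>

lemma P_round_trip:
  assumes "x \<in> X" "y \<in> X"
  shows "P K x y + P K y x \<ge> - 2 * K * d x y"
proof -
  obtain \<gamma> where g: "path \<gamma>" "hd \<gamma> = x" "last \<gamma> = y" "len \<gamma> = d x y" using ex_geodesic assms by blast
  then have "\<gamma> \<in> paths x y" "rev \<gamma> \<in> paths y x"
    using path_rev pathD(1) by (auto simp: paths_def hd_rev last_rev)
  from this[THEN P_upper] show ?thesis using area_rev[OF g(1)] g by (simp add: len_def)
qed

text \<open>\<open>\<Delta>\<close> is never positive, and it is bounded below when \<open>y\<close> is close to a geodesic from \<open>x\<close> to \<open>z\<close>.\<close>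

definition \<Delta> :: "'a \<Rightarrow> 'a \<Rightarrow> 'a \<Rightarrow> real" where
  "\<Delta> x y z = P K x y + P K y z + f x y z - P K x z"

text \<open>Replacing the piece between \<open>i\<close> and \<open>j\<close> by a geodesic can gain
  at most 1. It saves at least \<open>K - A = A\<close> per unit of the old piece and costs at most
  \<open>K + A = 3 * A\<close> per unit of the geodesic; hence the factor 3.\<close>

lemma near_optimal_quasigeodesic:
  assumes p: "p \<in> paths x y" and opt: "P K x y \<le> area p - K * len p + 1"
    and ij: "i \<le> j" "j \<le> len p"
  shows "j - i \<le> 3 * d (p ! i) (p ! j) + 1"
proof -
  have pp: "path p" "hd p = x" "last p = y" using p by (auto simp: paths_def)
  have Lj: "j < length p" using ij pathD(1)[OF pp(1)] by (cases p) (auto simp: len_def)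
  define us ws vs where "us = take i p" and "ws = take (Suc (j - i)) (drop i p)" and "vs = drop (Suc j) p"
  have "Suc (j - i) + i = Suc j" using ij by simp
  then have "vs = drop (Suc (j - i)) (drop i p)" by (simp only: vs_def drop_drop)
  then have xs: "p = us @ ws @ vs" by (simp only: us_def ws_def append_take_drop_id)
  have ws: "ws \<noteq> []" "hd ws = p ! i" "last ws = p ! j" "length ws = Suc (j - i)"
    using ij Lj unfolding ws_def by (auto simp: hd_drop_conv_nth last_conv_nth hd_take)
  obtain \<gamma> where g: "path \<gamma>" "hd \<gamma> = p ! i" "last \<gamma> = p ! j" "len \<gamma> = d (p ! i) (p ! j)"
    using ex_geodesic path_nth(1)[OF pp(1)] ij by (meson le_trans)
  have hl: "hd \<gamma> = hd ws" "last \<gamma> = last ws" using g ws by auto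
  note rep = path_replace[of us ws vs \<gamma>, OF pp(1)[unfolded xs] g(1) ws(1) hl]
  have lg: "length \<gamma> = Suc (len \<gamma>)" using pathD(1)[OF g(1)] by (cases \<gamma>) (auto simp: len_def)
  have lw: "len ws = j - i" using ws by (simp add: len_def)
  have l: "real (len (us @ \<gamma> @ vs)) = len p - (j - i) + len \<gamma>"
    using lg ws(4) unfolding len_def xs by simp
  have "us @ \<gamma> @ vs \<in> paths x y" using rep pp unfolding paths_def xs by simp
  from P_upper[OF this] have "area (us @ \<gamma> @ vs) - K * len (us @ \<gamma> @ vs) \<le> area p - K * len p + 1"
    using opt by simp
  moreover have "area p - area (us @ \<gamma> @ vs) = area ws - area \<gamma>" using rep(5) by (simp flip: xs)
  moreover have "\<bar>area ws - area \<gamma>\<bar> \<le> A * (len ws + len \<gamma>)"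
    by (rule area_diff[of _ "p ! i" "p ! j"]) (use ws g rep in \<open>auto simp: paths_def\<close>)
  ultimately have "A * real (j - i) \<le> A * (3 * len \<gamma>) + 1"
    unfolding l lw using ij by (simp add: algebra_simps of_nat_diff)
  also have "\<dots> \<le> A * (3 * len \<gamma> + 1)" using A_ge_1 by (simp add: algebra_simps)
  finally have "real (j - i) \<le> 3 * len \<gamma> + 1" using A_ge_1 by simp
  then show ?thesis using g by linarith
qed

text \<open>A nearly optimal path from \<open>x\<close> to \<open>y\<close> has a vertex
  \<open>v\<close> near \<open>w\<close>. Cutting the path at \<open>v\<close> gives
  \<open>\<Delta> x v y \<ge> - 1\<close>, and the cocycle identity allows \<open>v\<close> to be
  moved to \<open>w\<close> for the price of a round trip.\<close>

lemma \<Delta>_bound: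
  assumes L: "real L \<ge> 12 * \<delta> + 1" and xyo: "x \<in> X" "y \<in> X" "w \<in> X" and gp: "gp w x y \<le> C"
  shows "\<Delta> x w y \<le> 0" "\<Delta> x w y \<ge> - 1 - 2 * K * (2 * (C + L + 2 * \<delta> + 1))"
proof -
  show "\<Delta> x w y \<le> 0" using P_superadd[of x w y] xyo by (simp add: \<Delta>_def)
  have "\<exists>p\<in>paths x y. P K x y - 1 < area p - K * len p"
    using P_least[OF xyo(1,2), of "P K x y - 1"] by (meson not_le_imp_less less_add_one not_le diff_less_eq)
  then obtain p where p: "p \<in> paths x y" "P K x y \<le> area p - K * len p + 1" by force
  have pp: "path p" "hd p = x" "last p = y" using p by (auto simp: paths_def)
  obtain i where i: "i \<le> len p" "real (d w (p ! i)) \<le> 2 * (C + L + 2 * \<delta> + 1)"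
    using quasigeodesic_near[OF pp(1) xyo(3) near_optimal_quasigeodesic[OF p] L] gp pp by blast
  define v where "v = p ! i"
  have v: "v \<in> X" using path_nth(1)[OF pp(1)] i by (simp add: v_def)
  \<comment> \<open>Both pieces contain the vertex \<open>v\<close>, as \<open>path_join\<close>
    expects.\<close>
  define us vs where "us = take (Suc i) p" and "vs = drop i p"
  have li: "i < length p" using i pathD(1)[OF pp(1)] by (cases p) (auto simp: len_def)
  have "tl vs = drop (Suc i) p" by (simp add: vs_def tl_drop drop_Suc)
  then have xs: "p = us @ tl vs" by (simp only: us_def append_take_drop_id)
  have us: "path us" "path vs" "last us = hd vs" "hd vs = v" "hd us = x" "last vs = y"
  proof -
    show "path us" using pp(1) li pathD(1)[OF pp(1)] unfolding path_def us_def
      by (metis append_take_drop_id set_take_subset subset_trans successively_append_iff take_eq_Nil2 nat.distinct(1))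
    show "path vs" using pp(1) li unfolding path_def vs_def
      by (metis append_take_drop_id set_drop_subset subset_trans successively_append_iff drop_eq_Nil2 not_le)
    show "hd vs = v" using li by (simp add: vs_def v_def hd_drop_conv_nth)
    moreover have "last us = v" using li by (simp add: us_def v_def take_Suc_conv_app_nth)
    ultimately show "last us = hd vs" by simp
    show "hd us = x" using pp pathD(1)[OF pp(1)] by (simp add: us_def hd_take)
    show "last vs = y" using pp li by (simp add: vs_def)
  qed
  note J = path_join[OF us(1,2,3), folded xs]
  have "area us - K * len us \<le> P K x v" "area vs - K * len vs \<le> P K v y"
    using us by (auto intro!: P_upper simp: paths_def)
  then have 1: "\<Delta> x v y \<ge> - 1" using p(2) J(4,5) us unfolding \<Delta>_def by (simp add: algebra_simps)
  \<comment> \<open>Both sides of \<open>w\<close> are reached by way of \<open>v\<close>; the two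
    triangles that this creates add up with \<open>f x w y\<close> to
    \<open>f x v y\<close>.\<close>
  have "P K x v + P K v w + f x v w \<le> P K x w" "P K w v + P K v y + f w v y \<le> P K w y"
    using P_superadd v xyo by auto
  moreover have "f v w y - f x w y + f x v y - f x v w = 0" "f w v y = - f v w y"
    using cocycle[of x v w y] swap12[of v w y] v xyo by auto
  ultimately have "\<Delta> x w y \<ge> \<Delta> x v y + (P K v w + P K w v)" unfolding \<Delta>_def by linarith
  moreover have "P K v w + P K w v \<ge> - 2 * K * d w v"
    using P_round_trip[of w v] v xyo by simp
  moreover have "2 * K * d w v \<le> 2 * K * (2 * (C + L + 2 * \<delta> + 1))"
    using i(2) A_ge_1 by (intro mult_left_mono) (auto simp: v_def)
  ultimately show "\<Delta> x w y \<ge> - 1 - 2 * K * (2 * (C + L + 2 * \<delta> + 1))" using 1 by linarith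
qed

text \<open>Adding the coboundary of \<open>P K\<close> itself would turn \<open>f\<close> into
  \<open>\<Delta>\<close>, which is controlled only if the middle vertex is near a geodesic between
  the outer two. The antisymmetric part keeps the corrected cocycle alternating, so that any vertex
  of a triangle may play the middle one.\<close>

definition \<rho> :: "'a \<Rightarrow> 'a \<Rightarrow> real" where
  "\<rho> x y = (P K x y - P K y x) / 2"

text \<open>The centre is put on a geodesic from \<open>x\<close> to \<open>y\<close>, at distance
  from \<open>x\<close> equal to the Gromov product of \<open>y\<close> and \<open>z\<close>. There
  the Gromov products of \<open>z\<close> with \<open>x\<close> and with \<open>y\<close> agree up
  to the rounding of that distance, and the four-point condition bounds the smaller one.\<close>

lemma ex_center:
  assumes "x \<in> X" "y \<in> X" "z \<in> X"
  shows "\<exists>w\<in>X. gp w x y \<le> \<delta> + 2 \<and> gp w y z \<le> \<delta> + 2 \<and> gp w x z \<le> \<delta> + 2"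
proof -
  define m where "m = (d x y + d x z - d y z) div 2"
  have t: "d y z \<le> d x y + d x z" "d x z \<le> d x y + d y z" "d x y \<le> d x z + d y z"
    using d_triangle[of y x z] d_triangle[of x z y] d_triangle[of x y z]
      d_sym[of y x] d_sym[of z y] d_sym[of z x] assms by auto
  have "m \<le> d x y" unfolding m_def using t by linarith
  then obtain w where w: "w \<in> X" "d x w = m" "d w y = d x y - m" using d_split[of x y m "d x y - m"] assms by auto
  have s: "d w x = m" "d y x = d x y" "d z x = d x z" "d z y = d y z" "d z w = d w z" "d y w = d w y"
    using w d_sym assms by auto
  have m: "2 * real m \<ge> real (d x y) + d x z - d y z - 2" "2 * real m \<le> real (d x y) + d x z - d y z"
    using t unfolding m_def by linarith+
  have "min (gp w x z) (gp w z y) - \<delta> \<le> gp w x y"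
    using four_point[of w x z y] w assms by auto
  moreover have wy: "real (d w y) = real (d x y) - m" using w \<open>m \<le> d x y\<close> by simp
  moreover have "gp w x y = 0" using wy s by (simp add: gromov_product_def)
  ultimately have "min (gp w x z) (gp w z y) \<le> \<delta>" by simp
  moreover have "\<bar>gp w x z - gp w z y\<bar> \<le> 1"
    using m wy s by (simp add: gromov_product_def abs_le_iff field_simps)
  moreover have "gp w y z = gp w z y" using s by (simp add: gromov_product_def)
  moreover have "\<delta> \<ge> 0" using delta_nonneg w by blast
  ultimately show ?thesis using w \<open>gp w x y = 0\<close> by (intro bexI[of _ w]) auto
qed

text \<open>Since the corrected cocycle is alternating, its value on a triangle is a signed sum over
  three triangles with the centre as middle vertex, and each of those values is half the difference
  of two bounded values of \<open>\<Delta>\<close>.\<close>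

theorem bounded_representative:
  "\<exists>C. \<forall>x\<in>X. \<forall>y\<in>X. \<forall>z\<in>X. \<bar>f x y z + \<rho> x y + \<rho> y z + \<rho> z x\<bar> \<le> C"
proof -
  obtain L :: nat where L: "real L \<ge> 12 * \<delta> + 1" using real_arch_simple by blast
  define C where "C = 1 + 2 * K * (2 * (\<delta> + 2 + L + 2 * \<delta> + 1))"
  define F where "F x y z = f x y z + \<rho> x y + \<rho> y z + \<rho> z x" for x y z
  have mid: "\<bar>F x w y\<bar> \<le> C / 2" if "x \<in> X" "y \<in> X" "w \<in> X" "gp w x y \<le> \<delta> + 2" for x y w
  proof -
    have "f y w x = - f x w y" using swap12[of w y x] swap23[of w x y] swap12[of x w y] that by simp
    then have "F x w y = (\<Delta> x w y - \<Delta> y w x) / 2"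
      unfolding F_def \<Delta>_def \<rho>_def by (simp add: field_simps)
    moreover have "gp w y x \<le> \<delta> + 2" using gp_sym that by metis
    moreover have "\<Delta> x w y \<le> 0" "- C \<le> \<Delta> x w y"
      using \<Delta>_bound[OF L that] by (simp_all add: C_def)
    moreover have "\<Delta> y w x \<le> 0" "- C \<le> \<Delta> y w x"
      using \<Delta>_bound[OF L that(2,1,3) \<open>gp w y x \<le> \<delta> + 2\<close>] by (simp_all add: C_def)
    ultimately show ?thesis by (simp add: abs_le_iff)
  qed
  have "\<bar>F x y z\<bar> \<le> 3 * C / 2" if xyz: "x \<in> X" "y \<in> X" "z \<in> X" for x y z
  proof -
    obtain w where w: "w \<in> X" "gp w x y \<le> \<delta> + 2" "gp w y z \<le> \<delta> + 2" "gp w x z \<le> \<delta> + 2"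
      using ex_center xyz by blast
    have "f y z w - f x z w + f x y w - f x y z = 0" using cocycle w xyz by blast
    moreover have "f y z w = - f y w z" "f x z w = - f x w z" "f x y w = - f x w y"
      using swap23[of y w z] swap23[of x w z] swap23[of x w y] w xyz by auto
    moreover have anti: "\<rho> b a = - \<rho> a b" for a b
      unfolding \<rho>_def minus_divide_left by simp
    ultimately have "F x y z = - F y w z + F x w z - F x w y"
      unfolding F_def using anti[of y z] anti[of y w] anti[of w z] anti[of x w] anti[of w y] anti[of x z] anti[of x y] by linarith
    moreover have "\<bar>F y w z\<bar> \<le> C / 2" "\<bar>F x w z\<bar> \<le> C / 2" "\<bar>F x w y\<bar> \<le> C / 2"
      using mid[OF xyz(2,3) w(1,3)] mid[OF xyz(1,3) w(1,4)] mid[OF xyz(1,2) w(1,2)] by simp_all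
    ultimately show ?thesis by linarith
  qed
  then show ?thesis unfolding F_def by blast
qed

end

section \<open>The trace of the logarithm in a Banach algebra\<close>

lemma geometric_series_inverse:
  fixes x :: "'a::{real_normed_algebra_1,banach}"
  assumes "norm x < 1"
  shows "summable (\<lambda>k. (- x) ^ k)" "(\<Sum>k. (- x) ^ k) * (1 + x) = 1" "(1 + x) * (\<Sum>k. (- x) ^ k) = 1"
proof -
  have n: "norm (- x) < 1" using assms by simp
  show s: "summable (\<lambda>k. (- x) ^ k)" using complete_algebra_summable_geometric[OF n] .
  have z: "(\<lambda>n. (- x) ^ n) \<longlonglongrightarrow> 0"
    using summable_LIMSEQ_zero[OF s] .
  have "(\<lambda>n. (- x) ^ n - (- x) ^ Suc n) sums ((- x) ^ 0 - 0)"
    using telescope_sums'[OF z] by simp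
  then have t: "(\<lambda>n. (- x) ^ n - (- x) ^ Suc n) sums 1" by simp
  have "(\<lambda>k. (- x) ^ k * (1 + x)) sums ((\<Sum>k. (- x) ^ k) * (1 + x))"
    using sums_mult2[OF summable_sums[OF s]] .
  moreover have "(\<lambda>k. (- x) ^ k * (1 + x)) = (\<lambda>n. (- x) ^ n - (- x) ^ Suc n)"
    using power_commuting_commutes[of "- x" x] by (simp add: algebra_simps)
  ultimately show "(\<Sum>k. (- x) ^ k) * (1 + x) = 1" using t sums_unique2 by metis
  have "(\<lambda>k. (1 + x) * (- x) ^ k) sums ((1 + x) * (\<Sum>k. (- x) ^ k))"
    using sums_mult[OF summable_sums[OF s]] .
  moreover have "(\<lambda>k. (1 + x) * (- x) ^ k) = (\<lambda>n. (- x) ^ n - (- x) ^ Suc n)"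
    by (simp add: algebra_simps)
  ultimately show "(1 + x) * (\<Sum>k. (- x) ^ k) = 1" using t sums_unique2 by metis
qed

text \<open>The trace identity is demanded on a closed subalgebra: the vector functional to which
  this is applied is defined on all operators but is tracial only there.\<close>

locale tracial_functional =
  fixes B :: "'a::{real_normed_algebra_1,banach} set" and T :: "'a \<Rightarrow> real"
  assumes bounded_linear_T: "bounded_linear T" and closed_B: "closed B"
    and one_B: "1 \<in> B" and add_B: "\<lbrakk>x \<in> B; y \<in> B\<rbrakk> \<Longrightarrow> x + y \<in> B"
    and mult_B: "\<lbrakk>x \<in> B; y \<in> B\<rbrakk> \<Longrightarrow> x * y \<in> B"
    and scaleR_B: "x \<in> B \<Longrightarrow> c *\<^sub>R x \<in> B"
    and trace: "\<lbrakk>x \<in> B; y \<in> B\<rbrakk> \<Longrightarrow> T (x * y) = T (y * x)"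
begin

interpretation T: bounded_linear T by (rule bounded_linear_T)

text \<open>The trace of \<open>log (1 + x)\<close>, by the power series.\<close>

definition lg :: "'a \<Rightarrow> real" where
  "lg x = (\<Sum>k. (- 1) ^ k * T (x ^ Suc k) / real (Suc k))"

text \<open>The inverse of \<open>1 + x\<close>, by the Neumann series.\<close>

definition R :: "'a \<Rightarrow> 'a" where
  "R x = (\<Sum>k. (- x) ^ k)"

lemma zero_B: "0 \<in> B" using scaleR_B[OF one_B, of 0] by simp
lemma minus_B: "x \<in> B \<Longrightarrow> - x \<in> B" using scaleR_B[of x "- 1"] by simp
lemma diff_B: "\<lbrakk>x \<in> B; y \<in> B\<rbrakk> \<Longrightarrow> x - y \<in> B" using add_B[of x "- y"] minus_B[of y] by simp
lemma power_B: "x \<in> B \<Longrightarrow> x ^ n \<in> B" by (induction n) (auto intro: one_B mult_B)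

lemmas B_closure = zero_B one_B add_B mult_B scaleR_B minus_B diff_B power_B

lemma R_B: "x \<in> B \<Longrightarrow> norm x < 1 \<Longrightarrow> R x \<in> B"
proof -
  assume x: "x \<in> B" "norm x < 1"
  have "(\<Sum>k<n. (- x) ^ k) \<in> B" for n by (induction n) (use x in \<open>auto intro!: B_closure\<close>)
  then show "R x \<in> B" unfolding R_def
    by (rule closed_sequentially[OF closed_B _ summable_LIMSEQ[OF geometric_series_inverse(1)[OF x(2)]]])
qed

text \<open>The derivative of a power is a sum of products with one factor \<open>v'\<close> among
  powers of \<open>v t\<close>; cyclic rotation under the trace makes all of them equal, as if
  \<open>v t\<close> and \<open>v'\<close> commuted.\<close>

lemma T_power_derivative:
  assumes v: "(v has_vector_derivative v') (at t within S)" "v t \<in> B" "v' \<in> B"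
  shows "((\<lambda>s. T (v s ^ Suc n)) has_real_derivative real (Suc n) * T (v t ^ n * v')) (at t within S)"
proof -
  define D where "D = rec_nat (0::'a) (\<lambda>n d. v t * d + v' * v t ^ n)"
  have D: "D 0 = 0" "D (Suc n) = v t * D n + v' * v t ^ n" for n by (simp_all add: D_def)
  have DB: "D n \<in> B" for n by (induction n) (use v in \<open>auto simp: D intro!: B_closure\<close>)
  have der: "((\<lambda>s. v s ^ n) has_vector_derivative D n) (at t within S)" for n
  proof (induction n)
    case (Suc n)
    show ?case using has_vector_derivative_mult[OF v(1) Suc] by (simp add: D)
  qed (simp add: D)
  \<comment> \<open>The recursion for \<open>D\<close> puts a factor \<open>v t\<close> on the left,
    so the induction needs an arbitrary power in front.\<close>
  have TD: "T (v t ^ m * D (Suc n)) = real (Suc n) * T (v t ^ (m + n) * v')" for m n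
  proof (induction n arbitrary: m)
    case 0
    then show ?case by (simp add: D)
  next
    case (Suc n)
    have "v t ^ m * D (Suc (Suc n)) = v t ^ Suc m * D (Suc n) + (v t ^ m * v') * v t ^ Suc n"
      by (simp only: D(2)[of "Suc n"] distrib_left power_Suc2[of _ m] mult.assoc)
    then have "T (v t ^ m * D (Suc (Suc n))) = T (v t ^ Suc m * D (Suc n)) + T ((v t ^ m * v') * v t ^ Suc n)"
      by (simp only: T.add)
    also have "T ((v t ^ m * v') * v t ^ Suc n) = T (v t ^ Suc n * (v t ^ m * v'))"
      by (intro trace B_closure v)
    also have "v t ^ Suc n * (v t ^ m * v') = v t ^ (m + Suc n) * v'"
      by (simp only: mult.assoc[symmetric] power_add[symmetric] add.commute)
    finally show ?case using Suc[of "Suc m"] by (simp add: algebra_simps)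
  qed
  have "((\<lambda>s. T (v s ^ Suc n)) has_vector_derivative T (D (Suc n))) (at t within S)"
    by (rule T.has_vector_derivative[OF der])
  then show ?thesis using TD[of 0 n] by (simp add: has_real_derivative_iff_has_vector_derivative)
qed

lemma T_norm_bound: "\<exists>C\<ge>0. \<forall>x. \<bar>T x\<bar> \<le> C * norm x"
  using T.nonneg_bounded by (auto simp: mult.commute)

lemma lg_summable:
  assumes "norm x < 1"
  shows "summable (\<lambda>k. (- 1) ^ k * T (x ^ Suc k) / real (Suc k))"
proof -
  obtain C where C: "C \<ge> 0" "\<And>x. \<bar>T x\<bar> \<le> C * norm x" using T_norm_bound by blast
  show ?thesis
  proof (rule summable_comparison_test)
    show "summable (\<lambda>k. C * norm x ^ k)" using assms by (intro summable_mult summable_geometric) simp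
    have "\<bar>T (x ^ Suc k)\<bar> / real (Suc k) \<le> C * norm x ^ k" for k
    proof -
      have "\<bar>T (x ^ Suc k)\<bar> / real (Suc k) \<le> \<bar>T (x ^ Suc k)\<bar> / 1" by (intro divide_left_mono) auto
      also have "\<dots> \<le> C * norm (x ^ Suc k)" using C by simp
      also have "\<dots> \<le> C * norm x ^ Suc k" using C by (intro mult_left_mono norm_power_ineq) auto
      also have "\<dots> \<le> C * norm x ^ k" using C assms by (intro mult_left_mono power_decreasing) auto
      finally show ?thesis .
    qed
    then show "\<exists>N. \<forall>n\<ge>N. norm ((- 1) ^ n * T (x ^ Suc n) / real (Suc n)) \<le> C * norm x ^ n"
      by (auto simp: abs_mult)
  qed
qed

text \<open>The series is differentiated term by term, with a geometric majorant. The derivatives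
  sum to the trace of the logarithmic derivative, \<open>R (v t)\<close> being the inverse of
  \<open>1 + v t\<close>.\<close>

lemma lg_derivative:
  fixes v :: "real \<Rightarrow> 'a"
  assumes S: "convex S" "t \<in> S" and r: "r < 1"
    and v: "\<And>s. s \<in> S \<Longrightarrow> (v has_vector_derivative v' s) (at s within S)"
    and B: "\<And>s. s \<in> S \<Longrightarrow> v s \<in> B" "\<And>s. s \<in> S \<Longrightarrow> v' s \<in> B"
    and bd: "\<And>s. s \<in> S \<Longrightarrow> norm (v s) \<le> r" "\<And>s. s \<in> S \<Longrightarrow> norm (v' s) \<le> M"
  shows "((\<lambda>s. lg (v s)) has_real_derivative T (R (v t) * v' t)) (at t within S)"
proof -
  obtain C where C: "C \<ge> 0" "\<And>x. \<bar>T x\<bar> \<le> C * norm x" using T_norm_bound by blast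
  define f where "f k s = (- 1) ^ k * T (v s ^ Suc k) / real (Suc k)" for k s
  define f' where "f' k s = (- 1) ^ k * T (v s ^ k * v' s)" for k s
  have r0: "0 \<le> r" using bd(1)[OF S(2)] norm_ge_zero order_trans by blast
  have nv: "norm (v s) < 1" if "s \<in> S" for s using bd(1)[OF that] r by linarith
  have der: "(f k has_real_derivative f' k s) (at s within S)" if "s \<in> S" for k s
  proof -
    have "((\<lambda>s. (- 1) ^ k / real (Suc k) * T (v s ^ Suc k)) has_real_derivative
        (- 1) ^ k / real (Suc k) * (real (Suc k) * T (v s ^ k * v' s))) (at s within S)"
      by (intro DERIV_cmult T_power_derivative v B that)
    moreover have "(- 1) ^ k / real (Suc k) * (real (Suc k) * T (v s ^ k * v' s)) = f' k s"
      by (simp add: f'_def)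
    moreover have "(\<lambda>s. (- 1) ^ k / real (Suc k) * T (v s ^ Suc k)) = f k" by (auto simp: f_def fun_eq_iff)
    ultimately show ?thesis by metis
  qed
  have bound: "norm (f' k s) \<le> (C * M) * r ^ k" if "s \<in> S" for k s
  proof -
    have "norm (v s ^ k * v' s) \<le> norm (v s) ^ k * norm (v' s)"
      by (meson mult_right_mono norm_ge_zero norm_mult_ineq norm_power_ineq order_trans)
    also have "\<dots> \<le> r ^ k * M" by (intro mult_mono power_mono bd that) (use r0 in auto)
    finally have "C * norm (v s ^ k * v' s) \<le> C * (r ^ k * M)" using C(1) by (rule mult_left_mono)
    then show ?thesis using C(2)[of "v s ^ k * v' s"] by (simp add: f'_def abs_mult mult_ac)
  qed
  have ul: "uniform_limit S (\<lambda>n s. \<Sum>i<n. f' i s) (\<lambda>s. \<Sum>i. f' i s) sequentially"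
    by (rule Weierstrass_m_test[OF bound]) (use r r0 in \<open>auto intro!: summable_mult summable_geometric\<close>)
  have "summable (\<lambda>n. f n t)" unfolding f_def by (rule lg_summable[OF nv[OF S(2)]])
  from has_field_derivative_series[OF S(1) der ul S(2) this]
  obtain g where g: "\<And>s. s \<in> S \<Longrightarrow> (\<lambda>n. f n s) sums g s"
    "\<And>s. s \<in> S \<Longrightarrow> (g has_real_derivative (\<Sum>i. f' i s)) (at s within S)" by blast
  have "g s = lg (v s)" if "s \<in> S" for s
    using sums_unique[OF g(1)[OF that]] by (simp add: lg_def f_def)
  then have "((\<lambda>s. lg (v s)) has_real_derivative (\<Sum>i. f' i t)) (at t within S)"
    by (intro has_field_derivative_transform_within[OF g(2)[OF S(2)] zero_less_one S(2)])
  moreover have "(\<lambda>i. f' i t) sums T (R (v t) * v' t)"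
  proof -
    have "(\<lambda>k. (- v t) ^ k) sums R (v t)"
      unfolding R_def by (rule summable_sums[OF geometric_series_inverse(1)[OF nv[OF S(2)]]])
    from T.sums[OF sums_mult2[OF this, of "v' t"]]
    have "(\<lambda>k. T ((- v t) ^ k * v' t)) sums T (R (v t) * v' t)" .
    moreover have "T ((- v t) ^ k * v' t) = f' k t" for k
      unfolding f'_def by (cases "even k") (auto simp: linear_neg[OF T.linear])
    ultimately show ?thesis by simp
  qed
  ultimately show ?thesis using sums_unique by metis
qed

lemma lg_zero: "lg 0 = 0"
  unfolding lg_def by (simp add: T.zero)

text \<open>Both sides are compared along the path \<open>(1 + t x) (1 + t y)\<close>: they vanish
  at \<open>t = 0\<close>, and their derivatives agree because the factors that fail to cancel in
  the logarithmic derivative do cancel after a cyclic rotation. The bound \<open>1 / 8\<close> keeps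
  the path inside the unit ball, where the series converges.\<close>

lemma lg_mult:
  assumes x: "x \<in> B" "norm x \<le> 1 / 8" and y: "y \<in> B" "norm y \<le> 1 / 8"
  shows "lg ((1 + x) * (1 + y) - 1) = lg x + lg y"
proof -
  define S where "S = {0..1::real}"
  define v where "v t = t *\<^sub>R (x + y) + (t * t) *\<^sub>R (x * y)" for t
  define v' where "v' t = (x + y) + (2 * t) *\<^sub>R (x * y)" for t
  have v_alt: "1 + v t = (1 + t *\<^sub>R x) * (1 + t *\<^sub>R y)" for t
    by (simp add: v_def algebra_simps)
  have v'_alt: "v' t = x * (1 + t *\<^sub>R y) + (1 + t *\<^sub>R x) * y" for t
    by (simp add: v'_def algebra_simps flip: scaleR_add_left)
  have xy: "norm (x * y) \<le> 1 / 8"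
    using norm_mult_ineq[of x y] mult_mono[of "norm x" "1/8" "norm y" "1/8"] x y by simp
  have lg_scaled: "((\<lambda>s. lg (s *\<^sub>R z)) has_real_derivative T (R (t *\<^sub>R z) * z)) (at t within S)"
    if z: "z \<in> B" "norm z \<le> 1 / 8" and t: "t \<in> S" for z t
  proof (rule lg_derivative[where r = "1 / 8" and M = "1 / 8"])
    show "((\<lambda>s. s *\<^sub>R z) has_vector_derivative z) (at s within S)" for s
      by (auto intro!: derivative_eq_intros)
    show "norm (s *\<^sub>R z) \<le> 1 / 8" if "s \<in> S" for s
      using that z mult_mono[of "\<bar>s\<bar>" 1 "norm z" "1 / 8"] by (auto simp: S_def)
  qed (use z t in \<open>auto simp: S_def intro: B_closure\<close>)
  have "((\<lambda>s. lg (v s)) has_real_derivative T (R (v t) * v' t)) (at t within S)" if t: "t \<in> S" for t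
  proof (rule lg_derivative[where r = "3 / 8" and M = "1 / 2"])
    show "(v has_vector_derivative v' s) (at s within S)" for s
      unfolding v_def v'_def by (auto intro!: derivative_eq_intros simp: scaleR_add_left)
    fix s assume "s \<in> S"
    then have s: "0 \<le> s" "s \<le> 1" by (auto simp: S_def)
    have "norm (v s) \<le> s * (norm x + norm y) + (s * s) * norm (x * y)"
      unfolding v_def using s norm_triangle_ineq[of x y]
      by (intro order_trans[OF norm_triangle_ineq] add_mono) (auto intro: mult_left_mono)
    also have "\<dots> \<le> 1 * (1 / 8 + 1 / 8) + 1 * (1 / 8)"
      using s x y xy by (intro add_mono mult_mono) (auto simp: mult_le_one)
    finally show "norm (v s) \<le> 3 / 8" by simp
    have "norm (v' s) \<le> (norm x + norm y) + (2 * s) * norm (x * y)"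
      unfolding v'_def using s norm_triangle_ineq[of x y]
      by (intro order_trans[OF norm_triangle_ineq] add_mono) auto
    also have "\<dots> \<le> (1 / 8 + 1 / 8) + 2 * (1 / 8)"
      using s x y xy by (intro add_mono mult_mono) auto
    finally show "norm (v' s) \<le> 1 / 2" by simp
    show "v s \<in> B" "v' s \<in> B" unfolding v_def v'_def using x y by (auto intro!: B_closure)
  qed (use t in \<open>auto simp: S_def\<close>)
  moreover have "T (R (v t) * v' t) = T (R (t *\<^sub>R x) * x) + T (R (t *\<^sub>R y) * y)" if t: "t \<in> S" for t
  proof -
    have small: "norm (t *\<^sub>R z) < 1" if "norm z \<le> 1 / 8" for z
      using that t mult_mono[of "\<bar>t\<bar>" 1 "norm z" "1 / 8"] by (auto simp: S_def)
    define X where "X = R (t *\<^sub>R x)"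
    define Y where "Y = R (t *\<^sub>R y)"
    define x1 where "x1 = 1 + t *\<^sub>R x"
    define y1 where "y1 = 1 + t *\<^sub>R y"
    have inv: "X * x1 = 1" "x1 * X = 1" "Y * y1 = 1" "y1 * Y = 1"
      unfolding X_def Y_def R_def x1_def y1_def using geometric_series_inverse small x y by blast+
    have B: "X \<in> B" "Y \<in> B" "x1 \<in> B" "y1 \<in> B" unfolding X_def Y_def x1_def y1_def
      using x y small by (auto intro!: R_B B_closure)
    have "v t \<in> B" unfolding v_def using x y by (auto intro!: B_closure)
    have "norm (v t) \<le> norm (t *\<^sub>R (x + y)) + norm ((t * t) *\<^sub>R (x * y))"
      unfolding v_def by (rule norm_triangle_ineq)
    also have "\<dots> \<le> 1 * (1 / 8 + 1 / 8) + 1 * (1 / 8)"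
      unfolding norm_scaleR using t x y xy norm_triangle_ineq[of x y]
      by (intro add_mono mult_mono) (auto simp: S_def mult_le_one abs_mult)
    finally have "norm (v t) < 1" by simp
    then have "R (v t) * (x1 * y1) = 1"
      unfolding R_def x1_def y1_def v_alt[symmetric] by (rule geometric_series_inverse)
    then have "R (v t) * (x1 * y1) * (Y * X) = Y * X" by simp
    then have Rv: "R (v t) = Y * X" using inv by (metis mult.assoc mult.right_neutral)
    have "T (R (v t) * v' t) = T ((Y * X * x) * y1) + T (Y * (X * x1) * y)"
      unfolding Rv v'_alt x1_def[symmetric] y1_def[symmetric] by (simp add: distrib_left T.add mult.assoc)
    \<comment> \<open>Cyclic rotation brings \<open>y1\<close> next to its inverse \<open>Y\<close>,
      where otherwise \<open>X * x\<close> would separate them.\<close>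
    also have "T ((Y * X * x) * y1) = T (y1 * (Y * X * x))" by (intro trace mult_B B x)
    also have "y1 * (Y * X * x) = X * x" using inv by (metis mult.assoc mult.left_neutral)
    finally have "T (R (v t) * v' t) = T (X * x) + T (Y * (X * x1) * y)" .
    then show ?thesis using inv(1) by (simp flip: X_def Y_def)
  qed
  ultimately have "((\<lambda>s. lg (v s) - (lg (s *\<^sub>R x) + lg (s *\<^sub>R y))) has_real_derivative 0) (at t within S)"
    if t: "t \<in> S" for t
    using DERIV_diff[OF _ DERIV_add[OF lg_scaled[OF x t] lg_scaled[OF y t]]] t by fastforce
  then have "\<exists>c. \<forall>s\<in>S. lg (v s) - (lg (s *\<^sub>R x) + lg (s *\<^sub>R y)) = c"
    by (intro has_field_derivative_zero_constant) (auto simp: S_def)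
  then obtain c where c: "\<And>s. s \<in> S \<Longrightarrow> lg (v s) - (lg (s *\<^sub>R x) + lg (s *\<^sub>R y)) = c" by blast
  have "lg (v 1) - (lg (1 *\<^sub>R x) + lg (1 *\<^sub>R y)) = lg (v 0) - (lg (0 *\<^sub>R x) + lg (0 *\<^sub>R y))"
    using c[of 0] c[of 1] by (simp only: S_def) simp
  moreover have "v 0 = 0" by (simp add: v_def)
  moreover have "v 1 = (1 + x) * (1 + y) - 1" using v_alt[of 1] by (simp add: algebra_simps)
  ultimately show ?thesis using lg_zero by simp
qed

text \<open>Conjugation passes through every power, so the trace of each term of the series is
  unchanged.\<close>

lemma lg_conj:
  assumes "x \<in> B" "u \<in> B" "w \<in> B" "w * u = 1"
  shows "lg (u * x * w) = lg x"
proof -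
  have pow: "(u * x * w) ^ Suc k = u * x ^ Suc k * w" for k
  proof (induction k)
    case (Suc k)
    have "(u * x * w) ^ Suc (Suc k) = (u * x * w) * (u * x ^ Suc k * w)"
      using Suc power_Suc[of "u * x * w" "Suc k"] by metis
    also have "\<dots> = u * x * (w * u) * x ^ Suc k * w" by (simp only: mult.assoc)
    finally show ?case using assms(4) by (simp add: mult.assoc)
  qed simp
  have "T (u * x ^ Suc k * w) = T (w * (u * x ^ Suc k))" for k
    by (intro trace B_closure assms)
  moreover have "w * (u * z) = z" for z using assms(4) by (metis mult.assoc mult.left_neutral)
  ultimately show ?thesis unfolding lg_def pow by simp
qed

text \<open>As \<open>J * J = - 1\<close>, the element \<open>cos \<theta> + sin \<theta> J\<close>
  is the exponential of \<open>\<theta> J\<close>, and along the angles \<open>t \<theta>\<close>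
  the logarithmic derivative is the constant \<open>\<theta> J\<close>. The bound on the angle keeps
  this path within distance \<open>1 / 2\<close> of the identity.\<close>

lemma lg_rotation:
  assumes J: "J \<in> B" "J * J = - 1" "norm J \<le> 1" and \<theta>: "\<bar>\<theta>\<bar> \<le> 1 / 4"
  shows "lg ((cos \<theta> - 1) *\<^sub>R 1 + sin \<theta> *\<^sub>R J) = \<theta> * T J"
proof -
  define S where "S = {0..1::real}"
  define v where "v t = (cos (t * \<theta>) - 1) *\<^sub>R 1 + sin (t * \<theta>) *\<^sub>R J" for t
  define v' where "v' t = (- \<theta> * sin (t * \<theta>)) *\<^sub>R 1 + (\<theta> * cos (t * \<theta>)) *\<^sub>R J" for t
  have v': "v' t = (1 + v t) * (\<theta> *\<^sub>R J)" for t
    by (simp add: v_def v'_def algebra_simps J)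
  have vB: "v t \<in> B" "v' t \<in> B" for t unfolding v_def v'_def using J by (auto intro!: B_closure)
  have nv: "norm (v t) \<le> 1 / 2" if "t \<in> S" for t
  proof -
    have a: "\<bar>t * \<theta>\<bar> \<le> 1 / 4" using that \<theta> mult_mono[of "\<bar>t\<bar>" 1 "\<bar>\<theta>\<bar>" "1/4"] by (auto simp: S_def abs_mult)
    have "norm (v t) \<le> \<bar>cos (t * \<theta>) - 1\<bar> * norm (1::'a) + \<bar>sin (t * \<theta>)\<bar> * norm J"
      unfolding v_def by (rule order_trans[OF norm_triangle_ineq]) simp
    also have "\<dots> \<le> \<bar>cos (t * \<theta>) - 1\<bar> + \<bar>sin (t * \<theta>)\<bar>"
      using J(3) by (simp add: mult_left_le)
    also have "\<bar>cos (t * \<theta>) - 1\<bar> \<le> \<bar>t * \<theta>\<bar>"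
    proof -
      have "1 - cos (t * \<theta>) = 2 * (sin (t * \<theta> / 2))\<^sup>2"
        using cos_double_sin[of "t * \<theta> / 2"] by simp
      moreover have "\<bar>sin (t * \<theta> / 2)\<bar> * \<bar>sin (t * \<theta> / 2)\<bar> \<le> \<bar>t * \<theta> / 2\<bar> * 1"
        by (rule mult_mono[OF abs_sin_x_le_abs_x abs_sin_le_one]) auto
      ultimately show ?thesis by (simp add: power2_eq_square)
    qed
    finally show ?thesis using a abs_sin_x_le_abs_x[of "t * \<theta>"] by linarith
  qed
  have "((\<lambda>s. lg (v s)) has_real_derivative T (R (v t) * v' t)) (at t within S)" if t: "t \<in> S" for t
  proof (rule lg_derivative[where r = "1 / 2" and M = "\<bar>\<theta>\<bar> + \<bar>\<theta>\<bar>"])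
    show "(v has_vector_derivative v' s) (at s within S)" for s
      unfolding v_def v'_def by (auto intro!: derivative_eq_intros simp: scaleR_add_left mult.commute)
    show "norm (v' s) \<le> \<bar>\<theta>\<bar> + \<bar>\<theta>\<bar>" for s
    proof -
      have "norm (v' s) \<le> \<bar>\<theta>\<bar> * \<bar>sin (s * \<theta>)\<bar> * norm (1::'a) + \<bar>\<theta>\<bar> * \<bar>cos (s * \<theta>)\<bar> * norm J"
        unfolding v'_def by (rule order_trans[OF norm_triangle_ineq]) (simp add: abs_mult)
      also have "\<dots> \<le> \<bar>\<theta>\<bar> * 1 * 1 + \<bar>\<theta>\<bar> * 1 * 1" using J(3) by (intro add_mono mult_mono) auto
      finally show ?thesis by simp
    qed
  qed (use t nv vB in \<open>auto simp: S_def\<close>)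
  moreover have "T (R (v t) * v' t) = \<theta> * T J" if t: "t \<in> S" for t
  proof -
    have "R (v t) * (1 + v t) = 1" unfolding R_def using nv[OF t] by (intro geometric_series_inverse) simp
    then have "R (v t) * v' t = \<theta> *\<^sub>R J" unfolding v' by (metis mult.assoc mult.left_neutral)
    then show ?thesis by (simp add: T.scaleR)
  qed
  ultimately have "((\<lambda>s. lg (v s) - s * (\<theta> * T J)) has_real_derivative 0) (at t within S)"
    if t: "t \<in> S" for t
    using DERIV_diff[OF _ DERIV_cmult_right[OF DERIV_ident, of "\<theta> * T J"]] t by fastforce
  then have "\<exists>c. \<forall>s\<in>S. lg (v s) - s * (\<theta> * T J) = c"
    by (intro has_field_derivative_zero_constant) (auto simp: S_def)
  then obtain c where c: "\<And>s. s \<in> S \<Longrightarrow> lg (v s) - s * (\<theta> * T J) = c" by blast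
  have "lg (v 1) - 1 * (\<theta> * T J) = lg (v 0) - 0 * (\<theta> * T J)"
    using c[of 0] c[of 1] by (simp only: S_def) simp
  moreover have "v 0 = 0" by (simp add: v_def)
  ultimately show ?thesis using lg_zero by (simp add: v_def)
qed

end

section \<open>Adjointable operators on \<open>\<ell>\<^sup>2\<close>\<close>

lemma summable_on_nonneg_comparison:
  fixes f g :: "'i \<Rightarrow> real"
  assumes "g summable_on A" "\<And>i. i \<in> A \<Longrightarrow> 0 \<le> f i" "\<And>i. i \<in> A \<Longrightarrow> f i \<le> g i"
  shows "f summable_on A"
proof -
  have "0 \<le> g i" if "i \<in> A" for i using assms(2,3)[OF that] by linarith
  then have "(\<lambda>i. norm (g i)) summable_on A"
    using assms(1) summable_on_cong[of A "\<lambda>i. norm (g i)" g] by simp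
  then have "(\<lambda>i. norm (f i)) summable_on A"
    using assms(2,3) by (rule_tac Infinite_Sum.abs_summable_on_comparison_test[of g]) force+
  then show ?thesis by (rule abs_summable_summable)
qed

typedef 'i ell2 = "{f :: 'i \<Rightarrow> complex. (\<lambda>i. (cmod (f i))\<^sup>2) summable_on UNIV}"
  morphisms coord Abs_ell2
  by (rule exI[of _ "\<lambda>_. 0"]) simp

setup_lifting type_definition_ell2

lemma square_summable: "(\<lambda>i. (cmod (coord f i))\<^sup>2) summable_on UNIV"
  using coord[of f] by simp

lemma ell2_eqI: "(\<And>i. coord f i = coord g i) \<Longrightarrow> f = g"
  by (simp add: coord_inject[symmetric] fun_eq_iff)

lemma square_add_le: "(cmod (a + b))\<^sup>2 \<le> 2 * (cmod a)\<^sup>2 + 2 * (cmod b)\<^sup>2"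
proof -
  have "(cmod (a + b))\<^sup>2 \<le> (cmod a + cmod b)\<^sup>2" by (simp add: norm_triangle_ineq power_mono)
  also have "\<dots> \<le> 2 * (cmod a)\<^sup>2 + 2 * (cmod b)\<^sup>2"
    using sum_squares_bound[of "cmod a" "cmod b"] by (simp add: power2_sum)
  finally show ?thesis .
qed

lemma square_summable_add:
  assumes "(\<lambda>i. (cmod (f i))\<^sup>2) summable_on A" "(\<lambda>i. (cmod (g i))\<^sup>2) summable_on A"
  shows "(\<lambda>i. (cmod (f i + g i))\<^sup>2) summable_on A"
  by (rule summable_on_nonneg_comparison[where g = "\<lambda>i. 2 * (cmod (f i))\<^sup>2 + 2 * (cmod (g i))\<^sup>2"])
    (use assms square_add_le in \<open>auto intro!: summable_on_add summable_on_cmult_right\<close>)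

instantiation ell2 :: (type) real_vector
begin

lift_definition zero_ell2 :: "'a ell2" is "\<lambda>_. 0" by simp
lift_definition plus_ell2 :: "'a ell2 \<Rightarrow> 'a ell2 \<Rightarrow> 'a ell2" is "\<lambda>f g i. f i + g i"
  by (rule square_summable_add)
lift_definition uminus_ell2 :: "'a ell2 \<Rightarrow> 'a ell2" is "\<lambda>f i. - f i" by simp
lift_definition minus_ell2 :: "'a ell2 \<Rightarrow> 'a ell2 \<Rightarrow> 'a ell2" is "\<lambda>f g i. f i - g i"
  using square_summable_add[of _ UNIV "\<lambda>i. - _ i"] by fastforce
lift_definition scaleR_ell2 :: "real \<Rightarrow> 'a ell2 \<Rightarrow> 'a ell2" is "\<lambda>c f i. c *\<^sub>R f i"
  by (auto simp: power_mult_distrib intro: summable_on_cmult_right)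

instance
  by standard (transfer; simp add: fun_eq_iff algebra_simps)+

end

lemma coord_simps [simp]:
  "coord 0 i = 0" "coord (f + g) i = coord f i + coord g i" "coord (- f) i = - coord f i"
  "coord (f - g) i = coord f i - coord g i" "coord (c *\<^sub>R f) i = c *\<^sub>R coord f i"
  by (transfer, simp)+

lemma inner_summable: "(\<lambda>i. coord f i \<bullet> coord g i) summable_on UNIV"
proof (rule abs_summable_summable, rule summable_on_nonneg_comparison)
  show "(\<lambda>i. (cmod (coord f i))\<^sup>2 + (cmod (coord g i))\<^sup>2) summable_on UNIV"
    by (intro summable_on_add square_summable)
  show "norm (coord f i \<bullet> coord g i) \<le> (cmod (coord f i))\<^sup>2 + (cmod (coord g i))\<^sup>2" for i
  proof -
    have "norm (coord f i \<bullet> coord g i) \<le> cmod (coord f i) * cmod (coord g i)"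
      by (simp add: Cauchy_Schwarz_ineq2)
    also have "\<dots> \<le> (cmod (coord f i))\<^sup>2 + (cmod (coord g i))\<^sup>2"
      using sum_squares_bound[of "cmod (coord f i)" "cmod (coord g i)"]
        mult_nonneg_nonneg[OF norm_ge_zero[of "coord f i"] norm_ge_zero[of "coord g i"]] by linarith
    finally show ?thesis .
  qed
qed simp

instantiation ell2 :: (type) real_inner
begin

text \<open>On \<open>complex\<close> the inner product is the real part of
  \<open>z * cnj w\<close>, so this is the real part of the usual complex inner product and induces
  the same norm.\<close>

definition inner_ell2 :: "'a ell2 \<Rightarrow> 'a ell2 \<Rightarrow> real" where
  "inner_ell2 f g = (\<Sum>\<^sub>\<infinity>i. coord f i \<bullet> coord g i)"
definition norm_ell2 :: "'a ell2 \<Rightarrow> real" where "norm_ell2 f = sqrt (inner f f)"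
definition dist_ell2 :: "'a ell2 \<Rightarrow> 'a ell2 \<Rightarrow> real" where "dist_ell2 f g = norm (f - g)"
definition sgn_ell2 :: "'a ell2 \<Rightarrow> 'a ell2" where "sgn_ell2 f = f /\<^sub>R norm f"
definition uniformity_ell2 :: "('a ell2 \<times> 'a ell2) filter" where
  "uniformity_ell2 = (INF e\<in>{0<..}. principal {(x, y). dist x y < e})"
definition open_ell2 :: "'a ell2 set \<Rightarrow> bool" where
  "open_ell2 U \<longleftrightarrow> (\<forall>x\<in>U. \<forall>\<^sub>F (x', y) in uniformity. x' = x \<longrightarrow> y \<in> U)"

instance
proof
  fix f g h :: "'a ell2" and c :: real
  show "dist f g = norm (f - g)" by (rule dist_ell2_def)
  show "sgn f = f /\<^sub>R norm f" by (rule sgn_ell2_def)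
  show "uniformity = (INF e\<in>{0<..}. principal {(x::'a ell2, y). dist x y < e})"
    by (rule uniformity_ell2_def)
  show "open U \<longleftrightarrow> (\<forall>x\<in>U. \<forall>\<^sub>F (x', y) in uniformity. x' = x \<longrightarrow> y \<in> U)" for U :: "'a ell2 set"
    by (rule open_ell2_def)
  show "inner f g = inner g f" by (simp add: inner_ell2_def inner_commute)
  show "inner (f + g) h = inner f h + inner g h"
    by (simp add: inner_ell2_def inner_add_left infsum_add inner_summable)
  show "inner (c *\<^sub>R f) g = c * inner f g"
    by (simp add: inner_ell2_def infsum_cmult_right')
  show "0 \<le> inner f f" by (simp add: inner_ell2_def infsum_nonneg)
  show "(inner f f = 0) = (f = 0)"
  proof
    assume "inner f f = 0"
    then have "coord f i \<bullet> coord f i = 0" for i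
      using nonneg_infsum_le_0D[of "\<lambda>i. coord f i \<bullet> coord f i" UNIV i] inner_summable[of f f]
      by (simp add: inner_ell2_def)
    then show "f = 0" by (intro ell2_eqI) simp
  qed (simp add: inner_ell2_def)
  show "norm f = sqrt (inner f f)" by (rule norm_ell2_def)
qed

end

lemma norm_ell2_square: "(norm f)\<^sup>2 = (\<Sum>\<^sub>\<infinity>i. (cmod (coord f i))\<^sup>2)"
  by (simp add: power2_norm_eq_inner inner_ell2_def)

lemma finite_sum_le_norm_ell2: "finite F \<Longrightarrow> (\<Sum>i\<in>F. (cmod (coord f i))\<^sup>2) \<le> (norm f)\<^sup>2"
  unfolding norm_ell2_square by (intro finite_sum_le_infsum square_summable) auto

lemma cmod_coord_le: "cmod (coord f i) \<le> norm f"
  using finite_sum_le_norm_ell2[of "{i}" f] by (simp add: power2_le_iff_abs_le)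

text \<open>Bounds on finite partial sums survive coordinatewise limits; this brings the limit in
  the completeness proof back into \<open>ell2\<close>.\<close>

lemma ell2_boundedI:
  assumes "\<And>F. finite F \<Longrightarrow> (\<Sum>i\<in>F. (cmod (f i))\<^sup>2) \<le> c\<^sup>2" "c \<ge> 0"
  shows "\<exists>g. coord g = f \<and> norm g \<le> c"
proof -
  have s: "(\<lambda>i. (cmod (f i))\<^sup>2) summable_on UNIV"
    using assms by (intro nonneg_bdd_above_summable_on bdd_aboveI2) auto
  then have c: "coord (Abs_ell2 f) = f" by (simp add: Abs_ell2_inverse)
  have "(norm (Abs_ell2 f))\<^sup>2 \<le> c\<^sup>2"
    unfolding norm_ell2_square c by (rule infsum_le_finite_sums[OF s]) (use assms in auto)
  then show ?thesis using c assms(2) by (intro exI[of _ "Abs_ell2 f"]) (auto simp: power2_le_iff_abs_le)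
qed

instance ell2 :: (type) complete_space
proof
  fix X :: "nat \<Rightarrow> 'a ell2"
  assume X: "Cauchy X"
  have "Cauchy (\<lambda>n. coord (X n) i)" for i
  proof (rule CauchyI)
    fix e :: real assume "e > 0"
    then obtain M where M: "\<And>m n. m \<ge> M \<Longrightarrow> n \<ge> M \<Longrightarrow> norm (X m - X n) < e"
      using X by (meson CauchyD)
    have "norm (coord (X m) i - coord (X n) i) < e" if "m \<ge> M" "n \<ge> M" for m n
      using cmod_coord_le[of "X m - X n" i] M[OF that] by simp
    then show "\<exists>M. \<forall>m\<ge>M. \<forall>n\<ge>M. norm (coord (X m) i - coord (X n) i) < e" by blast
  qed
  then have "convergent (\<lambda>n. coord (X n) i)" for i by (simp add: Cauchy_convergent)
  then obtain f where f: "\<And>i. (\<lambda>n. coord (X n) i) \<longlonglongrightarrow> f i" unfolding convergent_def by metis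
  \<comment> \<open>The differences between the coordinatewise limit and late members of the
    sequence are shown to lie in \<open>ell2\<close>; the limit itself is then one such difference
    plus \<open>X M\<close>.\<close>
  have tail: "\<exists>g. coord g = (\<lambda>i. f i - coord (X n) i) \<and> norm g \<le> e"
    if e: "e > 0" and n: "\<And>m. m \<ge> n \<Longrightarrow> norm (X m - X n) < e" for e n
  proof (rule ell2_boundedI)
    fix F :: "'a set" assume F: "finite F"
    have "(\<lambda>m. \<Sum>i\<in>F. (cmod (coord (X m) i - coord (X n) i))\<^sup>2) \<longlonglongrightarrow> (\<Sum>i\<in>F. (cmod (f i - coord (X n) i))\<^sup>2)"
      by (intro tendsto_intros f)
    moreover have "\<forall>\<^sub>F m in sequentially. (\<Sum>i\<in>F. (cmod (coord (X m) i - coord (X n) i))\<^sup>2) \<le> e\<^sup>2"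
    proof (rule eventually_sequentiallyI[of n])
      fix m assume "m \<ge> n"
      have "(\<Sum>i\<in>F. (cmod (coord (X m - X n) i))\<^sup>2) \<le> (norm (X m - X n))\<^sup>2"
        by (rule finite_sum_le_norm_ell2[OF F])
      also have "\<dots> \<le> e\<^sup>2" using n[OF \<open>m \<ge> n\<close>] by (intro power_mono) auto
      finally show "(\<Sum>i\<in>F. (cmod (coord (X m) i - coord (X n) i))\<^sup>2) \<le> e\<^sup>2" by simp
    qed
    ultimately show "(\<Sum>i\<in>F. (cmod (f i - coord (X n) i))\<^sup>2) \<le> e\<^sup>2"
      by (rule tendsto_upperbound) simp
  qed (use e in simp)
  obtain M where M: "\<And>m n. m \<ge> M \<Longrightarrow> n \<ge> M \<Longrightarrow> norm (X m - X n) < 1"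
    using X CauchyD[of X 1] by (meson zero_less_one)
  obtain g where g: "coord g = (\<lambda>i. f i - coord (X M) i)" using tail[of 1 M] M by auto
  define L where "L = g + X M"
  have L: "coord L = f" by (auto simp: L_def g fun_eq_iff)
  have "X \<longlonglongrightarrow> L"
  proof (rule LIMSEQ_I)
    fix e :: real assume e: "e > 0"
    then obtain N where N: "\<And>m n. m \<ge> N \<Longrightarrow> n \<ge> N \<Longrightarrow> norm (X m - X n) < e / 2"
      using X CauchyD[of X "e / 2"] by (metis half_gt_zero)
    have "norm (X n - L) < e" if "n \<ge> N" for n
    proof -
      have "norm (X m - X n) < e / 2" if "m \<ge> n" for m using N[of m n] that \<open>n \<ge> N\<close> by simp
      then obtain h where h: "coord h = (\<lambda>i. f i - coord (X n) i)" "norm h \<le> e / 2"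
        using tail[OF half_gt_zero[OF e], of n] by blast
      have "h = L - X n" by (rule ell2_eqI) (simp add: h L)
      then show ?thesis using h e by (simp add: norm_minus_commute)
    qed
    then show "\<exists>N. \<forall>n\<ge>N. norm (X n - L) < e" by blast
  qed
  then show "convergent X" by (rule convergentI)
qed

lift_definition basis :: "'i \<Rightarrow> 'i ell2" is "\<lambda>i j. if j = i then 1 else 0"
proof -
  fix i :: 'i
  have "(\<lambda>j. (cmod (if j = i then 1 else 0))\<^sup>2) summable_on {i}" by simp
  then show "(\<lambda>j. (cmod (if j = i then 1 else 0))\<^sup>2) summable_on UNIV"
    by (rule summable_on_cong_neutral[THEN iffD1, rotated -1]) auto
qed

lemma coord_basis [simp]: "coord (basis i) j = (if j = i then 1 else 0)"
  by transfer simp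

lemma inner_basis: "inner f (basis i) = Re (coord f i)"
proof -
  have "inner f (basis i) = (\<Sum>\<^sub>\<infinity>j\<in>{i}. coord f j \<bullet> coord (basis i) j)"
    unfolding inner_ell2_def by (rule infsum_cong_neutral) auto
  then show ?thesis by (simp add: inner_complex_def)
qed

lemma norm_basis [simp]: "norm (basis i) = 1"
  by (simp add: norm_eq_sqrt_inner inner_basis)

text \<open>\<open>\<ell>\<^sup>2\<close> is treated as a real Hilbert space; for complex-linear operators the adjoint for the real inner
  product agrees with the complex one.\<close>

definition adjoint_pair :: "('i ell2 \<Rightarrow>\<^sub>L 'i ell2) \<Rightarrow> ('i ell2 \<Rightarrow>\<^sub>L 'i ell2) \<Rightarrow> bool" where
  "adjoint_pair x y \<longleftrightarrow> (\<forall>v w. inner (blinfun_apply x v) w = inner v (blinfun_apply y w))"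

lemma adjoint_pair_sym: "adjoint_pair x y \<Longrightarrow> adjoint_pair y x"
  unfolding adjoint_pair_def by (metis inner_commute)

lemma adjoint_pair_add: "\<lbrakk>adjoint_pair x y; adjoint_pair x' y'\<rbrakk> \<Longrightarrow> adjoint_pair (x + x') (y + y')"
  and adjoint_pair_diff: "\<lbrakk>adjoint_pair x y; adjoint_pair x' y'\<rbrakk> \<Longrightarrow> adjoint_pair (x - x') (y - y')"
  and adjoint_pair_minus: "adjoint_pair x y \<Longrightarrow> adjoint_pair (- x) (- y)"
  and adjoint_pair_scaleR: "adjoint_pair x y \<Longrightarrow> adjoint_pair (c *\<^sub>R x) (c *\<^sub>R y)"
  and adjoint_pair_compose: "\<lbrakk>adjoint_pair x y; adjoint_pair x' y'\<rbrakk> \<Longrightarrow> adjoint_pair (x o\<^sub>L x') (y' o\<^sub>L y)"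
  and adjoint_pair_id: "adjoint_pair id_blinfun id_blinfun"
  and adjoint_pair_zero: "adjoint_pair 0 0"
  unfolding adjoint_pair_def
  by (auto simp: blinfun.bilinear_simps inner_add_left inner_add_right inner_diff_left inner_diff_right)

lemma adjoint_pair_unique: "\<lbrakk>adjoint_pair x y; adjoint_pair x z\<rbrakk> \<Longrightarrow> y = z"
  by (rule blinfun_eqI) (metis adjoint_pair_def vector_eq_rdot inner_commute)

text \<open>Cauchy-Schwarz gives \<open>(norm x)\<^sup>2 \<le> norm (y o\<^sub>L x)\<close>.
  Cancelling \<open>norm x\<close> yields \<open>norm x \<le> norm y\<close>, and symmetry of the
  pair then gives equality of the norms and the converse bound.\<close>

lemma adjoint_pair_cstar:
  assumes "adjoint_pair x y"
  shows "norm (y o\<^sub>L x) = (norm x)\<^sup>2"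
proof (rule antisym)
  have le: "(norm x)\<^sup>2 \<le> norm (y o\<^sub>L x)" if "adjoint_pair x y" for x y :: "'i ell2 \<Rightarrow>\<^sub>L 'i ell2"
  proof -
    have "norm (x v) \<le> sqrt (norm (y o\<^sub>L x)) * norm v" for v
    proof -
      have "(norm (x v))\<^sup>2 = inner v ((y o\<^sub>L x) v)"
        using that by (simp add: power2_norm_eq_inner adjoint_pair_def)
      also have "\<dots> \<le> norm v * norm ((y o\<^sub>L x) v)" by (rule norm_cauchy_schwarz)
      also have "\<dots> \<le> norm v * (norm (y o\<^sub>L x) * norm v)" by (intro mult_left_mono norm_blinfun) auto
      also have "\<dots> = (sqrt (norm (y o\<^sub>L x)) * norm v)\<^sup>2" by (simp add: power_mult_distrib power2_eq_square)
      finally show ?thesis by (simp add: power2_le_iff_abs_le)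
    qed
    then have "norm x \<le> sqrt (norm (y o\<^sub>L x))" by (intro norm_blinfun_bound) auto
    then have "(norm x)\<^sup>2 \<le> (sqrt (norm (y o\<^sub>L x)))\<^sup>2" by (intro power_mono) auto
    then show ?thesis by simp
  qed
  have norm_le: "norm x \<le> norm y" if "adjoint_pair x y" for x y :: "'i ell2 \<Rightarrow>\<^sub>L 'i ell2"
  proof (cases "norm x = 0")
    case False
    have "norm x * norm x \<le> norm y * norm x"
      using le[OF that] norm_blinfun_compose[of y x] by (simp add: power2_eq_square)
    then show ?thesis using False by simp
  qed simp
  show "(norm x)\<^sup>2 \<le> norm (y o\<^sub>L x)" by (rule le[OF assms])
  have "norm y = norm x" using norm_le assms adjoint_pair_sym antisym by metis
  then show "norm (y o\<^sub>L x) \<le> (norm x)\<^sup>2"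
    using norm_blinfun_compose[of y x] by (simp add: power2_eq_square)
qed

lemma adjoint_pair_norm:
  assumes "adjoint_pair x y"
  shows "norm y = norm x"
proof -
  have "norm x \<le> norm y" if "adjoint_pair x y" for x y :: "'i ell2 \<Rightarrow>\<^sub>L 'i ell2"
  proof (cases "norm x = 0")
    case False
    have "norm x * norm x \<le> norm y * norm x"
      using adjoint_pair_cstar[OF that] norm_blinfun_compose[of y x] by (simp add: power2_eq_square)
    then show ?thesis using False by simp
  qed simp
  then show ?thesis using assms adjoint_pair_sym antisym by metis
qed

lifting_forget ell2.lifting

instance ell2 :: (type) banach ..

section \<open>The real Banach algebra of adjointable operators\<close>

text \<open>Membership carries the existence of an adjoint, so the involution is available without
  an appeal to Riesz representation.\<close>

typedef 'i op = "{x :: 'i ell2 \<Rightarrow>\<^sub>L 'i ell2. \<exists>y. adjoint_pair x y}"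
  using adjoint_pair_zero by blast

setup_lifting type_definition_op

lift_definition act :: "'i op \<Rightarrow> 'i ell2 \<Rightarrow> 'i ell2" is blinfun_apply .

lemma op_eqI: "(\<And>v. act x v = act y v) \<Longrightarrow> x = y"
  by transfer (rule blinfun_eqI)

lemma act_right_simps [simp]:
  "act x 0 = 0" "act x (v + w) = act x v + act x w" "act x (v - w) = act x v - act x w"
  "act x (c *\<^sub>R v) = c *\<^sub>R act x v"
  by (simp_all add: act.rep_eq blinfun.bilinear_simps)

instantiation op :: (type) real_vector
begin

lift_definition zero_op :: "'a op" is 0 by (rule exI, rule adjoint_pair_zero)
lift_definition plus_op :: "'a op \<Rightarrow> 'a op \<Rightarrow> 'a op" is "(+)" by (elim exE) (rule exI, erule (1) adjoint_pair_add)
lift_definition minus_op :: "'a op \<Rightarrow> 'a op \<Rightarrow> 'a op" is "(-)" by (elim exE) (rule exI, erule (1) adjoint_pair_diff)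
lift_definition uminus_op :: "'a op \<Rightarrow> 'a op" is uminus by (elim exE) (rule exI, erule adjoint_pair_minus)
lift_definition scaleR_op :: "real \<Rightarrow> 'a op \<Rightarrow> 'a op" is scaleR by (elim exE) (rule exI, erule adjoint_pair_scaleR)

lemma act_left_simps [simp]:
  "act 0 v = 0" "act (x + y) v = act x v + act y v" "act (x - y) v = act x v - act y v"
  "act (- x) v = - act x v" "act (c *\<^sub>R x) v = c *\<^sub>R act x v"
  by (simp_all add: act.rep_eq zero_op.rep_eq plus_op.rep_eq minus_op.rep_eq uminus_op.rep_eq scaleR_op.rep_eq
      blinfun.bilinear_simps)

instance
  by standard (rule op_eqI; simp add: algebra_simps)+

end

instantiation op :: (type) real_normed_vector
begin

lift_definition norm_op :: "'a op \<Rightarrow> real" is norm .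
definition dist_op :: "'a op \<Rightarrow> 'a op \<Rightarrow> real" where "dist_op f g = norm (f - g)"
definition sgn_op :: "'a op \<Rightarrow> 'a op" where "sgn_op f = f /\<^sub>R norm f"
definition uniformity_op :: "('a op \<times> 'a op) filter" where
  "uniformity_op = (INF e\<in>{0<..}. principal {(x, y). dist x y < e})"
definition open_op :: "'a op set \<Rightarrow> bool" where
  "open_op U \<longleftrightarrow> (\<forall>x\<in>U. \<forall>\<^sub>F (x', y) in uniformity. x' = x \<longrightarrow> y \<in> U)"

instance
proof
  fix x y :: "'a op" and a :: real
  show "dist x y = norm (x - y)" by (rule dist_op_def)
  show "sgn x = x /\<^sub>R norm x" by (rule sgn_op_def)
  show "uniformity = (INF e\<in>{0<..}. principal {(x::'a op, y). dist x y < e})"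
    by (rule uniformity_op_def)
  show "open U \<longleftrightarrow> (\<forall>x\<in>U. \<forall>\<^sub>F (x', y) in uniformity. x' = x \<longrightarrow> y \<in> U)" for U :: "'a op set"
    by (rule open_op_def)
  show "(norm x = 0) = (x = 0)" by transfer simp
  show "norm (x + y) \<le> norm x + norm y" by transfer (rule norm_triangle_ineq)
  show "norm (a *\<^sub>R x) = \<bar>a\<bar> * norm x" by transfer simp
qed

end

instantiation op :: (type) real_normed_algebra_1
begin

lift_definition one_op :: "'a op" is id_blinfun by (rule exI, rule adjoint_pair_id)
lift_definition times_op :: "'a op \<Rightarrow> 'a op \<Rightarrow> 'a op" is "(o\<^sub>L)" by (elim exE) (rule exI, erule (1) adjoint_pair_compose)

lemma act_one [simp]: "act 1 v = v"
  by (simp add: act.rep_eq one_op.rep_eq)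

lemma act_times [simp]: "act (x * y) v = act x (act y v)"
  by (simp add: act.rep_eq times_op.rep_eq)

instance
proof
  fix x y z :: "'a op" and a :: real
  show "x * y * z = x * (y * z)" "(x + y) * z = x * z + y * z" "x * (y + z) = x * y + x * z"
    "a *\<^sub>R x * y = a *\<^sub>R (x * y)" "x * a *\<^sub>R y = a *\<^sub>R (x * y)" "1 * x = x" "x * 1 = x"
    by (rule op_eqI, simp)+
  show "norm (x * y) \<le> norm x * norm y" by transfer (rule norm_blinfun_compose)
  show n1: "norm (1::'a op) = 1"
  proof (transfer, rule antisym)
    show "norm (id_blinfun :: 'a ell2 \<Rightarrow>\<^sub>L 'a ell2) \<le> 1" by (rule norm_blinfun_bound) auto
    show "1 \<le> norm (id_blinfun :: 'a ell2 \<Rightarrow>\<^sub>L 'a ell2)"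
      using norm_blinfun[of id_blinfun "basis undefined :: 'a ell2"] by simp
  qed
  show "(0::'a op) \<noteq> 1" using n1 by (metis norm_zero zero_neq_one)
qed

end

lemma adjoint_pair_the: "\<exists>y. adjoint_pair x y \<Longrightarrow> adjoint_pair x (THE y. adjoint_pair x y)"
  by (rule theI') (blast intro: adjoint_pair_unique)

lift_definition op_adj :: "'i op \<Rightarrow> 'i op" is "\<lambda>x. THE y. adjoint_pair x y"
  by (rule exI, rule adjoint_pair_sym, rule adjoint_pair_the)

lemma norm_act: "norm (act x v) \<le> norm x * norm v"
  by transfer (rule norm_blinfun)

lemma adjoint_pair_adj: "adjoint_pair (Rep_op x) (Rep_op (op_adj x))"
  unfolding op_adj.rep_eq by (rule adjoint_pair_the) (use Rep_op in blast)

lemma inner_act: "inner (act x v) w = inner v (act (op_adj x) w)"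
  using adjoint_pair_adj[of x] unfolding adjoint_pair_def act.rep_eq by blast

lemma adj_eqI: "(\<And>v w. inner (act x v) w = inner v (act y w)) \<Longrightarrow> op_adj x = y"
  by (rule op_eqI) (metis inner_act vector_eq_rdot inner_commute)

lemma adj_adj [simp]: "op_adj (op_adj x) = x"
  by (rule adj_eqI) (metis inner_act inner_commute)

lemma adj_add [simp]: "op_adj (x + y) = op_adj x + op_adj y"
  by (rule adj_eqI) (simp only: act_left_simps inner_add_left inner_add_right inner_act)

lemma adj_scaleR [simp]: "op_adj (c *\<^sub>R x) = c *\<^sub>R op_adj x"
  by (rule adj_eqI) (simp only: act_left_simps inner_scaleR_left inner_scaleR_right inner_act)

lemma adj_mult [simp]: "op_adj (x * y) = op_adj y * op_adj x"
  by (rule adj_eqI) (simp only: act_times inner_act)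

lemma adj_one [simp]: "op_adj 1 = 1"
  by (rule adj_eqI) (simp only: act_one)

lemma adj_minus [simp]: "op_adj (- x) = - op_adj x"
  using adj_scaleR[of "- 1" x] by simp

lemma adj_diff [simp]: "op_adj (x - y) = op_adj x - op_adj y"
  using adj_add[of x "- y"] by simp

lemma cstar_norm: "norm (op_adj x * x) = (norm x)\<^sup>2"
  by (simp add: norm_op.rep_eq times_op.rep_eq adjoint_pair_cstar adjoint_pair_adj)

lemma norm_adj [simp]: "norm (op_adj x) = norm x"
  by (simp add: norm_op.rep_eq adjoint_pair_norm adjoint_pair_adj)

lemma bounded_linear_adj: "bounded_linear op_adj"
  by (rule bounded_linear_intro[where K = 1]) auto

lemma bounded_linear_act: "bounded_linear (\<lambda>x. act x v)"
  by (rule bounded_linear_intro[where K = "norm v"]) (auto simp: norm_act)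

text \<open>Taking adjoints is isometric, so the adjoints form a Cauchy sequence too, and their
  limit is an adjoint of the limit.\<close>

instance op :: (type) banach
proof
  fix X :: "nat \<Rightarrow> 'a op"
  assume X: "Cauchy X"
  define x where "x n = Rep_op (X n)" for n
  define y where "y n = Rep_op (op_adj (X n))" for n
  have norm_x: "norm (x m - x n) = norm (X m - X n)" for m n
    by (simp add: x_def norm_op.rep_eq minus_op.rep_eq)
  have "Cauchy x"
    by (rule CauchyI) (use CauchyD[OF X] norm_x in simp)
  then obtain a where a: "x \<longlonglongrightarrow> a" using convergentD[OF Cauchy_convergent] by blast
  have norm_y: "norm (y m - y n) = norm (X m - X n)" for m n
  proof -
    have "y m - y n = Rep_op (op_adj (X m - X n))" by (simp only: y_def adj_diff minus_op.rep_eq)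
    then have "norm (y m - y n) = norm (op_adj (X m - X n))" by (simp only: norm_op.rep_eq)
    then show ?thesis by (simp only: norm_adj)
  qed
  have "Cauchy y"
    by (rule CauchyI) (use CauchyD[OF X] norm_y in simp)
  then obtain b where b: "y \<longlonglongrightarrow> b" using convergentD[OF Cauchy_convergent] by blast
  have "adjoint_pair (x n) (y n)" for n
    unfolding x_def y_def by (rule adjoint_pair_adj)
  then have "adjoint_pair a b" unfolding adjoint_pair_def
  proof (intro allI)
    fix v w
    assume *: "\<And>n. \<forall>v w. inner (x n v) w = inner v (y n w)"
    have "(\<lambda>n. inner (x n v) w) \<longlonglongrightarrow> inner (a v) w" by (intro tendsto_intros a)
    moreover have "(\<lambda>n. inner v (y n w)) \<longlonglongrightarrow> inner v (b w)" by (intro tendsto_intros b)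
    ultimately show "inner (a v) w = inner v (b w)" using * LIMSEQ_unique by simp
  qed
  then have "Rep_op (Abs_op a) = a" by (subst Abs_op_inverse) auto
  then have "norm (X n - Abs_op a) = norm (x n - a)" for n
    by (simp add: norm_op.rep_eq minus_op.rep_eq x_def)
  then have "X \<longlonglongrightarrow> Abs_op a" using a by (simp add: LIMSEQ_iff)
  then show "convergent X" by (rule convergentI)
qed

text \<open>The description below determines an operator only if \<open>w\<close> is unimodular and \<open>p\<close> is a bijection.\<close>

definition weighted_perm :: "('i \<Rightarrow> complex) \<Rightarrow> ('i \<Rightarrow> 'i) \<Rightarrow> 'i op" where
  "weighted_perm w p = (THE x. \<forall>f i. coord (act x f) i = w i * coord f (p i))"

text \<open>The formula defines an element of \<open>op\<close> only once it has an adjoint, so both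
  claims come out of one construction. The auxiliary facts are stated for all weights and bijections
  because the adjoint is of the same kind, with the inverse bijection.\<close>

lemma coord_weighted_perm:
  fixes w :: "'i \<Rightarrow> complex" and p :: "'i \<Rightarrow> 'i"
  assumes w: "\<And>i. cmod (w i) = 1" and p: "bij p"
  shows "coord (act (weighted_perm w p) f) i = w i * coord f (p i)"
    and "op_adj (weighted_perm w p) = weighted_perm (\<lambda>i. cnj (w (inv_into UNIV p i))) (inv_into UNIV p)"
proof -
  have ex: "\<exists>g. \<forall>i. coord g i = w i * coord f (p i)" if w: "\<And>i. cmod (w i) = 1" and p: "bij p"
    for w :: "'i \<Rightarrow> complex" and p :: "'i \<Rightarrow> 'i" and f
  proof -
    have "(\<lambda>i. (cmod (coord f (p i)))\<^sup>2) summable_on UNIV"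
      using summable_on_reindex_bij_betw[OF p, of "\<lambda>i. (cmod (coord f i))\<^sup>2"] square_summable by simp
    then have "coord (Abs_ell2 (\<lambda>i. w i * coord f (p i))) = (\<lambda>i. w i * coord f (p i))"
      by (intro Abs_ell2_inverse) (simp add: norm_mult w)
    then show ?thesis by metis
  qed
  define S where "S w p f = (SOME g. \<forall>i. coord g i = w i * coord f (p i))"
    for w :: "'i \<Rightarrow> complex" and p :: "'i \<Rightarrow> 'i" and f
  have S: "coord (S w p f) i = w i * coord f (p i)" if "\<And>i. cmod (w i) = 1" "bij p" for w p f i
    using someI_ex[OF ex[of w p f, OF that]] unfolding S_def by blast
  have adjS: "inner (S w p f) g = inner f (S (\<lambda>i. cnj (w (inv_into UNIV p i))) (inv_into UNIV p) g)"
    if w: "\<And>i. cmod (w i) = 1" and p: "bij p" for w p f g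
  proof -
    have "inner (S w p f) g = (\<Sum>\<^sub>\<infinity>i. (\<lambda>j. coord f j \<bullet> (cnj (w (inv_into UNIV p j)) * coord g (inv_into UNIV p j))) (p i))"
      unfolding inner_ell2_def using p
      by (simp add: S w inner_complex_def algebra_simps inv_f_f bij_is_inj)
    also have "\<dots> = (\<Sum>\<^sub>\<infinity>j. coord f j \<bullet> (cnj (w (inv_into UNIV p j)) * coord g (inv_into UNIV p j)))"
      by (rule infsum_reindex_bij_betw[OF p])
    also have "\<dots> = inner f (S (\<lambda>i. cnj (w (inv_into UNIV p i))) (inv_into UNIV p) g)"
      unfolding inner_ell2_def using p by (simp add: S w bij_imp_bij_inv)
    finally show ?thesis .
  qed
  have bl: "bounded_linear (S w p)" if w: "\<And>i. cmod (w i) = 1" and p: "bij p" for w p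
  proof (rule bounded_linear_intro[where K = 1])
    show "S w p (f + g) = S w p f + S w p g" for f g
      by (rule ell2_eqI) (simp add: S w p algebra_simps)
    show "S w p (c *\<^sub>R f) = c *\<^sub>R S w p f" for c f
      by (rule ell2_eqI) (simp add: S w p)
    show "norm (S w p f) \<le> norm f * 1" for f
    proof -
      have "(norm (S w p f))\<^sup>2 = (\<Sum>\<^sub>\<infinity>i. (cmod (coord f (p i)))\<^sup>2)"
        unfolding norm_ell2_square by (simp add: S w p norm_mult)
      also have "\<dots> = (norm f)\<^sup>2" unfolding norm_ell2_square by (rule infsum_reindex_bij_betw[OF p])
      finally show ?thesis by simp
    qed
  qed
  define x where "x w p = Abs_op (Blinfun (S w p))" for w p
  have actx: "act (x w p) f = S w p f" if w: "\<And>i. cmod (w i) = 1" and p: "bij p" for w p f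
  proof -
    have "adjoint_pair (Blinfun (S w p)) (Blinfun (S (\<lambda>i. cnj (w (inv_into UNIV p i))) (inv_into UNIV p)))"
      unfolding adjoint_pair_def using bl[OF w p] bl[of "\<lambda>i. cnj (w (inv_into UNIV p i))" "inv_into UNIV p"] w p adjS[OF w p]
      by (simp add: bounded_linear_Blinfun_apply bij_imp_bij_inv)
    then show ?thesis unfolding x_def act.rep_eq
      using bl[OF w p] by (subst Abs_op_inverse) (auto simp: bounded_linear_Blinfun_apply)
  qed
  have wp: "weighted_perm w p = x w p" if w: "\<And>i. cmod (w i) = 1" and p: "bij p" for w p
    unfolding weighted_perm_def
    by (rule the_equality) (auto simp: actx w p S intro!: op_eqI ell2_eqI)
  show "coord (act (weighted_perm w p) f) i = w i * coord f (p i)"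
    unfolding wp[OF w p] actx[OF w p] by (rule S[OF w p])
  have p': "bij (inv_into UNIV p)" and w': "\<And>i. cmod (cnj (w (inv_into UNIV p i))) = 1" using p w by (auto simp: bij_imp_bij_inv)
  show "op_adj (weighted_perm w p) = weighted_perm (\<lambda>i. cnj (w (inv_into UNIV p i))) (inv_into UNIV p)"
    unfolding wp[OF w p] wp[OF w' p'] by (rule adj_eqI) (simp only: actx[OF w p] actx[OF w' p'] adjS[OF w p])
qed

section \<open>Concrete tracial C*-algebras\<close>

text \<open>\<open>op\<close> is a real algebra of real-linear operators. Complex scalars enter as
  multiplication operators, and complex linearity becomes commutation with
  \<open>cscalar \<i>\<close>.\<close>

definition cscalar :: "complex \<Rightarrow> 'i op" where
  "cscalar z = Re z *\<^sub>R 1 + Im z *\<^sub>R weighted_perm (\<lambda>_. \<i>) id"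

lemma coord_cscalar [simp]: "coord (act (cscalar z) f) i = z * coord f i"
  by (simp add: cscalar_def coord_weighted_perm(1) complex_eq_iff)

lemma op_coord_eqI: "(\<And>f i. coord (act x f) i = coord (act y f) i) \<Longrightarrow> x = y"
  by (intro op_eqI ell2_eqI)

lemma cscalar_simps [simp]: "cscalar 0 = 0" "cscalar 1 = 1"
  by (rule op_coord_eqI, simp)+

lemma cscalar_add: "cscalar (a + b) = cscalar a + cscalar b"
  and cscalar_diff: "cscalar (a - b) = cscalar a - cscalar b"
  and cscalar_mult: "cscalar (a * b) = cscalar a * cscalar b"
  by (rule op_coord_eqI, simp add: algebra_simps)+

lemma cscalar_of_real: "cscalar (of_real c) = c *\<^sub>R 1"
  by (simp add: cscalar_def)

lemma cscalar_expand: "cscalar z = Re z *\<^sub>R 1 + Im z *\<^sub>R cscalar \<i>"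
  by (simp add: cscalar_def)

lemma adj_cscalar [simp]: "op_adj (cscalar z) = cscalar (cnj z)"
proof -
  have "op_adj (weighted_perm (\<lambda>_::'a. \<i>) id) = - weighted_perm (\<lambda>_. \<i>) id"
    by (rule op_coord_eqI) (simp add: coord_weighted_perm)
  then show ?thesis by (simp add: cscalar_def)
qed

text \<open>In the C*-identity the two scalars stand next to each other and multiply to the real
  number \<open>(cmod z)\<^sup>2\<close>, whether or not \<open>x\<close> is complex-linear.\<close>

lemma norm_cscalar_mult: "norm (cscalar z * x) = cmod z * norm x"
proof -
  have c: "cscalar (cnj z) * (cscalar z * x) = (cmod z)\<^sup>2 *\<^sub>R x"
    by (simp add: cscalar_of_real mult.assoc[symmetric] cscalar_mult[symmetric] complex_norm_square[symmetric]
        mult.commute[of "cnj z"] flip: of_real_power)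
  have "(norm (cscalar z * x))\<^sup>2 = norm (op_adj (cscalar z * x) * (cscalar z * x))"
    by (simp only: cstar_norm)
  also have "\<dots> = norm (op_adj x * (cscalar (cnj z) * (cscalar z * x)))"
    by (simp add: mult.assoc)
  also have "\<dots> = (cmod z)\<^sup>2 * (norm x)\<^sup>2" unfolding c by (simp add: cstar_norm)
  finally show ?thesis by (simp flip: power_mult_distrib)
qed

definition complex_linear :: "'i op set" where
  "complex_linear = {x. cscalar \<i> * x = x * cscalar \<i>}"

lemma complex_linearD: "x \<in> complex_linear \<Longrightarrow> cscalar z * x = x * cscalar z"
proof -
  assume x: "x \<in> complex_linear"
  have "cscalar \<i> * x = x * cscalar \<i>" using x by (simp add: complex_linear_def)
  then show ?thesis by (subst (1 2) cscalar_expand) (simp add: distrib_left distrib_right)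
qed

lemma closed_complex_linear: "closed complex_linear"
  unfolding complex_linear_def by (intro closed_Collect_eq continuous_intros)

lemma subspace_complex_linear: "subspace complex_linear"
  unfolding complex_linear_def by (auto simp: subspace_def algebra_simps)

lemma hull_subset:
  assumes "closed C" "subspace C" "U \<subseteq> C"
  shows "closure (span U) \<subseteq> C"
  using assms by (intro closure_minimal span_minimal)

lemma subspace_vimage_linear: "linear f \<Longrightarrow> subspace C \<Longrightarrow> subspace {x. f x \<in> C}"
  by (auto simp: subspace_def linear_0 linear_add linear_scale)

text \<open>Containing \<open>cscalar \<i>\<close> makes the real subspace \<open>A\<close> a
  complex one. Likewise \<open>trace_A\<close> speaks of the real part of the vector state, and
  multiplication by \<open>cscalar \<i>\<close> inside \<open>A\<close> yields the imaginary
  part.\<close>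

locale concrete_algebra =
  fixes A :: "'i op set" and \<xi> :: "'i ell2"
  assumes closed_A: "closed A" and subspace_A: "subspace A" and one_A: "1 \<in> A"
    and i_A: "cscalar \<i> \<in> A"
    and mult_A: "\<lbrakk>x \<in> A; y \<in> A\<rbrakk> \<Longrightarrow> x * y \<in> A" and adj_A: "x \<in> A \<Longrightarrow> op_adj x \<in> A"
    and complex_linear_A: "A \<subseteq> complex_linear" and norm_\<xi>: "norm \<xi> = 1"
    and trace_A: "\<lbrakk>x \<in> A; y \<in> A\<rbrakk> \<Longrightarrow> inner (act (x * y) \<xi>) \<xi> = inner (act (y * x) \<xi>) \<xi>"
begin

lemma cscalar_A: "cscalar z \<in> A"
  by (subst cscalar_expand) (intro subspace_add subspace_scale subspace_A one_A i_A)

lemma cscalar_comm: "x \<in> A \<Longrightarrow> cscalar z * x = x * cscalar z"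
  using complex_linearD complex_linear_A by blast

lemma A_closure: "0 \<in> A" "\<lbrakk>x \<in> A; y \<in> A\<rbrakk> \<Longrightarrow> x + y \<in> A" "x \<in> A \<Longrightarrow> - x \<in> A" "\<lbrakk>x \<in> A; y \<in> A\<rbrakk> \<Longrightarrow> x - y \<in> A"
  using subspace_A by (auto simp: subspace_0 subspace_add subspace_neg subspace_diff)

text \<open>Up to sign the imaginary part of the trace: it is real-valued and does not vanish at \<open>\<i>\<close>.\<close>

definition T :: "'i op \<Rightarrow> real" where
  "T x = inner (act (cscalar \<i> * x) \<xi>) \<xi>"

lemma tracial_T: "tracial_functional A T"
proof (rule tracial_functional.intro)
  show "bounded_linear T"
  proof -
    have "bounded_linear (\<lambda>x. inner (act (cscalar \<i> * x) \<xi>) \<xi>)"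
      by (intro bounded_linear_compose[OF bounded_linear_inner_left]
          bounded_linear_compose[OF bounded_linear_act] bounded_linear_mult_right)
    then show ?thesis by (simp add: T_def[abs_def])
  qed
  show "T (x * y) = T (y * x)" if "x \<in> A" "y \<in> A" for x y
  proof -
    have "T (x * y) = inner (act (y * (cscalar \<i> * x)) \<xi>) \<xi>"
      using trace_A[OF mult_A[OF i_A that(1)] that(2)] by (simp only: T_def mult.assoc)
    also have "y * (cscalar \<i> * x) = cscalar \<i> * (y * x)"
      using cscalar_comm[OF that(2)] by (metis mult.assoc)
    finally show ?thesis unfolding T_def .
  qed
qed (use closed_A one_A mult_A A_closure subspace_A in \<open>auto simp: subspace_scale\<close>)

lemma T_i: "T (cscalar \<i>) = - 1"
proof -
  have "cscalar \<i> * cscalar \<i> = (- 1 :: 'i op)"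
    by (rule op_coord_eqI) (simp flip: mult.assoc)
  then show ?thesis using norm_\<xi> by (simp add: T_def dot_square_norm)
qed

end

section \<open>Transport to another carrier type\<close>

text \<open>Stability quantifies over algebras whose elements have one fixed type \<open>'b\<close>,
  so the concrete algebra is carried there along an injection \<open>j\<close>.\<close>

definition enc_algebra :: "'i op set \<Rightarrow> ('i op \<Rightarrow> 'b) \<Rightarrow> 'b cstar_algebra" where
  "enc_algebra A j = (let k = inv_into A j in
    \<lparr>carrier = j ` A, mult = (\<lambda>x y. j (k x * k y)), one = j 1, zero = j 0, add = (\<lambda>x y. j (k x + k y)),
     smult = (\<lambda>z x. j (cscalar z * k x)), adj = (\<lambda>x. j (op_adj (k x))), nrm = (\<lambda>x. norm (k x))\<rparr>)"

locale encoded_algebra = concrete_algebra A \<xi> for A :: "'i op set" and \<xi> +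
  fixes j :: "'i op \<Rightarrow> 'b"
  assumes inj_j: "inj_on j A"
begin

abbreviation "B \<equiv> enc_algebra A j"

lemma dec [simp]: "x \<in> A \<Longrightarrow> inv_into A j (j x) = x"
  by (rule inv_into_f_f[OF inj_j])

lemma enc_simps [simp]:
  "carrier B = j ` A" "one B = j 1" "zero B = j 0"
  "\<lbrakk>x \<in> A; y \<in> A\<rbrakk> \<Longrightarrow> mult B (j x) (j y) = j (x * y)"
  "\<lbrakk>x \<in> A; y \<in> A\<rbrakk> \<Longrightarrow> add B (j x) (j y) = j (x + y)"
  "x \<in> A \<Longrightarrow> smult B z (j x) = j (cscalar z * x)"
  "x \<in> A \<Longrightarrow> adj B (j x) = j (op_adj x)" "x \<in> A \<Longrightarrow> nrm B (j x) = norm x"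
  unfolding enc_algebra_def by (simp_all add: Let_def)

lemma enc_eq_iff: "\<lbrakk>x \<in> A; y \<in> A\<rbrakk> \<Longrightarrow> j x = j y \<longleftrightarrow> x = y"
  using inj_j by (auto dest: inj_onD)

lemmas A_intros = mult_A adj_A cscalar_A A_closure one_A

lemma ring_B: "ring B"
proof (rule ringI)
  show "abelian_group B"
  proof (rule abelian_groupI)
    show "\<exists>y\<in>carrier B. y \<oplus>\<^bsub>B\<^esub> x = \<zero>\<^bsub>B\<^esub>" if x: "x \<in> carrier B" for x
    proof -
      obtain a where "x = j a" "a \<in> A" using x by auto
      then show ?thesis by (intro bexI[of _ "j (- a)"]) (auto intro: A_intros simp: A_closure)
    qed
  qed (auto intro: A_intros simp: A_closure add_ac)
  show "monoid B"
    by (rule monoidI) (auto intro: A_intros simp: A_intros mult.assoc)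
qed (auto simp: A_intros algebra_simps)

lemma minus_B: "\<lbrakk>x \<in> A; y \<in> A\<rbrakk> \<Longrightarrow> j x \<ominus>\<^bsub>B\<^esub> j y = j (x - y)"
proof -
  assume xy: "x \<in> A" "y \<in> A"
  interpret ring B by (rule ring_B)
  have "j (- y) \<oplus>\<^bsub>B\<^esub> j y = \<zero>\<^bsub>B\<^esub>" using xy by (simp add: A_closure)
  then have "\<ominus>\<^bsub>B\<^esub> j y = j (- y)"
    using xy by (intro minus_equality) (auto simp: A_closure)
  then show ?thesis using xy by (simp add: a_minus_def A_closure)
qed

lemma module_B: "Module.module complex_ring B"
proof (rule module.intro)
  show "cring complex_ring"
  proof (rule cringI)
    show "abelian_group complex_ring"
      by (rule abelian_groupI) (auto simp: complex_ring_def add_ac intro: exI[of _ "- _"])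
    show "comm_monoid complex_ring"
      by (rule comm_monoidI) (auto simp: complex_ring_def mult_ac)
  qed (auto simp: complex_ring_def algebra_simps)
  show "abelian_group B" using ring_B by (rule ring.is_abelian_group)
  show "module_axioms complex_ring B"
    by (rule module_axioms.intro)
      (auto simp: complex_ring_def A_intros cscalar_add cscalar_mult algebra_simps)
qed

lemma cstar_B: "unital_cstar_algebra B"
proof (intro unital_cstar_algebra.intro ring_B module_B unital_cstar_algebra_axioms.intro)
  show "x \<otimes>\<^bsub>B\<^esub> (a \<odot>\<^bsub>B\<^esub> y) = a \<odot>\<^bsub>B\<^esub> (x \<otimes>\<^bsub>B\<^esub> y)" if xy: "x \<in> carrier B" "y \<in> carrier B" for a x y
  proof -
    obtain x' y' where "x = j x'" "y = j y'" "x' \<in> A" "y' \<in> A" using xy by auto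
    then show ?thesis using cscalar_comm[of x' a] by (simp add: A_intros) (metis mult.assoc)
  qed
  show "adj B (a \<odot>\<^bsub>B\<^esub> x) = cnj a \<odot>\<^bsub>B\<^esub> adj B x" if "x \<in> carrier B" for a x
    using that by (auto simp: A_intros cscalar_comm)
  show "\<exists>x\<in>carrier B. (\<lambda>n. nrm B (\<sigma> n \<ominus>\<^bsub>B\<^esub> x)) \<longlonglongrightarrow> 0"
    if \<sigma>: "\<And>n. \<sigma> n \<in> carrier B"
      and Cauchy: "\<And>\<epsilon>. \<epsilon> > 0 \<Longrightarrow> \<exists>N. \<forall>m\<ge>N. \<forall>n\<ge>N. nrm B (\<sigma> m \<ominus>\<^bsub>B\<^esub> \<sigma> n) < \<epsilon>" for \<sigma>
  proof -
    have "\<exists>a. \<sigma> n = j a \<and> a \<in> A" for n using \<sigma>[of n] by auto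
    then obtain X where X: "\<And>n. \<sigma> n = j (X n)" "\<And>n. X n \<in> A" by metis
    have "Cauchy X"
      by (rule CauchyI) (use Cauchy in \<open>simp add: X minus_B A_closure\<close>)
    then obtain L where L: "X \<longlonglongrightarrow> L" using convergentD[OF Cauchy_convergent] by blast
    have "L \<in> A" by (rule closed_sequentially[OF closed_A X(2) L])
    moreover have "(\<lambda>n. norm (X n - L)) \<longlonglongrightarrow> 0" using L by (simp add: LIM_zero_iff tendsto_norm_zero_iff)
    ultimately show ?thesis
      by (intro bexI[of _ "j L"]) (auto simp: X minus_B A_closure)
  qed
qed (auto simp: A_intros mult.assoc enc_eq_iff norm_cscalar_mult norm_triangle_ineq norm_mult_ineq cstar_norm)

text \<open>\<open>t\<close> is the real part of the vector state, and a complex-linear functional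
  is recovered from its real part as \<open>t x - \<i> t (\<i> x)\<close>.\<close>

lemma tracial_B: "\<exists>\<tau>. tracial_state B \<tau>"
proof -
  define t where "t x = inner (act x \<xi>) \<xi>" for x
  have t_add: "t (x + y) = t x + t y" and t_scaleR: "t (c *\<^sub>R x) = c * t x" for x y c
    by (simp_all add: t_def inner_add_left)
  have t_mult: "t (x * y) = t (y * x)" if "x \<in> A" "y \<in> A" for x y
    using trace_A[OF that] by (simp only: t_def)
  have t_ii: "t (cscalar \<i> * (cscalar \<i> * x)) = - t x" for x
  proof -
    have "cscalar \<i> * (cscalar \<i> * x) = - x" by (rule op_coord_eqI) (simp flip: mult.assoc)
    then show ?thesis by (simp add: t_def)
  qed
  have c: "cscalar z * x = Re z *\<^sub>R x + Im z *\<^sub>R (cscalar \<i> * x)" for z x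
    by (rule op_coord_eqI) (simp add: complex_eq_iff algebra_simps)
  have c2: "cscalar \<i> * (cscalar z * x) = Re z *\<^sub>R (cscalar \<i> * x) + Im z *\<^sub>R (cscalar \<i> * (cscalar \<i> * x))" for z x
    by (subst c) (simp add: algebra_simps)
  have t_pos: "t (op_adj x * x) \<ge> 0" for x
  proof -
    have "t (op_adj x * x) = inner (act x \<xi>) (act x \<xi>)"
      unfolding t_def act_times inner_act[of "op_adj x"] by simp
    then show ?thesis by simp
  qed
  \<comment> \<open>\<open>cscalar \<i> * (op_adj x * x)\<close> is skew-adjoint, and the real part
    of a vector state vanishes on such elements.\<close>
  have t_im: "t (cscalar \<i> * (op_adj x * x)) = 0" if "x \<in> A" for x
  proof -
    have "op_adj (cscalar \<i> * (op_adj x * x)) = - (cscalar \<i> * (op_adj x * x))"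
      using cscalar_comm[of "op_adj x * x" "- \<i>"] that
      by (simp add: A_intros mult.assoc) (metis add.inverse_inverse cscalar_simps(1) cscalar_diff diff_0 minus_mult_left)
    then have "t (cscalar \<i> * (op_adj x * x)) = - t (cscalar \<i> * (op_adj x * x))"
      unfolding t_def by (metis inner_act inner_commute act_left_simps(4) inner_minus_right)
    then show ?thesis by simp
  qed
  have comm: "t (cscalar \<i> * (x * y)) = t (cscalar \<i> * (y * x))" if "x \<in> A" "y \<in> A" for x y
  proof -
    have "t (cscalar \<i> * (x * y)) = t (y * (cscalar \<i> * x))"
      using t_mult[OF mult_A[OF i_A that(1)] that(2)] by (simp only: mult.assoc)
    also have "y * (cscalar \<i> * x) = cscalar \<i> * (y * x)"
      using cscalar_comm[OF that(2)] by (metis mult.assoc)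
    finally show ?thesis .
  qed
  define \<tau> where "\<tau> b = (let x = inv_into A j b in Complex (t x) (- t (cscalar \<i> * x)))" for b
  have \<tau>: "\<tau> (j x) = Complex (t x) (- t (cscalar \<i> * x))" if "x \<in> A" for x
    using that by (simp add: \<tau>_def)
  have "tracial_state B \<tau>"
    unfolding tracial_state_def
  proof (intro conjI ballI allI)
    fix x assume "x \<in> carrier B"
    then obtain x' where x: "x = j x'" "x' \<in> A" by auto
    show "\<tau> (a \<odot>\<^bsub>B\<^esub> x) = a * \<tau> x" for a
    proof -
      have "t (cscalar a * x') = Re a * t x' + Im a * t (cscalar \<i> * x')"
        by (simp only: c[of a x'] t_add t_scaleR)
      moreover have "t (cscalar \<i> * (cscalar a * x')) = Re a * t (cscalar \<i> * x') + Im a * - t x'"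
        by (simp only: c2[of a x'] t_add t_scaleR t_ii)
      ultimately show ?thesis using x by (simp add: \<tau> A_intros complex_eq_iff)
    qed
    show "\<tau> (adj B x \<otimes>\<^bsub>B\<^esub> x) \<in> \<real>"
      using x by (simp add: \<tau> A_intros t_im complex_is_Real_iff)
    show "0 \<le> Re (\<tau> (adj B x \<otimes>\<^bsub>B\<^esub> x))"
      using x by (simp add: \<tau> A_intros t_pos)
    fix y assume "y \<in> carrier B"
    then obtain y' where y: "y = j y'" "y' \<in> A" by auto
    show "\<tau> (x \<oplus>\<^bsub>B\<^esub> y) = \<tau> x + \<tau> y"
      using x y by (simp add: \<tau> A_intros complex_eq_iff t_add distrib_left)
    show "\<tau> (x \<otimes>\<^bsub>B\<^esub> y) = \<tau> (y \<otimes>\<^bsub>B\<^esub> x)"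
      using x y t_mult[of x' y'] comm[of x' y'] by (simp add: \<tau> A_intros)
  next
    have "t 1 = 1" using norm_\<xi> by (simp add: t_def dot_square_norm)
    moreover have "t (cscalar \<i> * 1) = 0" using t_im[OF one_A] by simp
    ultimately show "\<tau> \<one>\<^bsub>B\<^esub> = 1" by (simp add: \<tau> A_intros complex_eq_iff)
  qed
  then show ?thesis by blast
qed

lemma B_tracial: "B \<in> tracial_cstar_algebras"
  unfolding tracial_cstar_algebras_def using cstar_B tracial_B by blast

lemma unitary_iff: "x \<in> A \<Longrightarrow> j x \<in> carrier (unitary_group B) \<longleftrightarrow> op_adj x * x = 1 \<and> x * op_adj x = 1"
  unfolding unitary_group_def by (auto simp: A_intros enc_eq_iff)

end

text \<open>A complex-linear operator is determined by the columns of its adjoint, hence by countably many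
  rational cuts.\<close>

lemma ex_encoding:
  assumes "(UNIV :: real set) \<lesssim> (UNIV :: 'b set)"
  shows "\<exists>j :: nat op \<Rightarrow> 'b. inj_on j complex_linear"
proof -
  define S :: "nat op \<Rightarrow> (nat \<times> nat \<times> rat) set \<times> (nat \<times> nat \<times> rat) set" where
    "S x = ({(i, k, q). of_rat q < Re (coord (act (op_adj x) (basis i)) k)},
            {(i, k, q). of_rat q < Im (coord (act (op_adj x) (basis i)) k)})" for x
  have real_eqI: "a = b" if "\<And>q. real_of_rat q < a \<longleftrightarrow> real_of_rat q < b" for a b :: real
  proof (rule ccontr)
    assume "a \<noteq> b"
    then consider "a < b" | "b < a" by linarith
    then obtain q where "a < real_of_rat q \<and> real_of_rat q < b \<or> b < real_of_rat q \<and> real_of_rat q < a"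
      by cases (use of_rat_dense in blast)+
    then show False using that[of q] by auto
  qed
  have "inj_on S complex_linear"
  proof (rule inj_onI)
    fix x y assume x: "x \<in> complex_linear" and y: "y \<in> complex_linear" and S: "S x = S y"
    have "coord (act (op_adj x) (basis i)) k = coord (act (op_adj y) (basis i)) k" for i k
    proof (rule complex_eqI; rule real_eqI)
      fix q
      have "(i, k, q) \<in> fst (S x) \<longleftrightarrow> (i, k, q) \<in> fst (S y)" "(i, k, q) \<in> snd (S x) \<longleftrightarrow> (i, k, q) \<in> snd (S y)"
        using S by auto
      then show "real_of_rat q < Re (coord (act (op_adj x) (basis i)) k) \<longleftrightarrow> real_of_rat q < Re (coord (act (op_adj y) (basis i)) k)"
        "real_of_rat q < Im (coord (act (op_adj x) (basis i)) k) \<longleftrightarrow> real_of_rat q < Im (coord (act (op_adj y) (basis i)) k)"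
        by (auto simp: S_def)
    qed
    then have col: "act (op_adj x) (basis i) = act (op_adj y) (basis i)" for i by (intro ell2_eqI)
    \<comment> \<open>The real inner product with a basis vector sees only real parts. Imaginary
      parts are read off after multiplying the argument by \<i>, which is where complex linearity
      enters.\<close>
    have Re: "Re (coord (act x f) i) = Re (coord (act y f) i)" for f i
      using inner_act[of x f "basis i"] inner_act[of y f "basis i"] col[of i] by (simp add: inner_basis)
    have im: "Im (coord (act z f) i) = - Re (coord (act z (act (cscalar \<i>) f)) i)" if "z \<in> complex_linear" for z :: "nat op" and f i
    proof -
      have "act z (act (cscalar \<i>) f) = act (cscalar \<i>) (act z f)"
        using complex_linearD[OF that, of \<i>] by (metis act_times)
      then show ?thesis by simp
    qed
    show "x = y" by (rule op_coord_eqI, rule complex_eqI) (simp_all add: Re im x y)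
  qed
  \<comment> \<open>Pairs of subsets of a countable set are coded as sets of naturals, and these
    inject into the reals.\<close>
  moreover have "inj (\<lambda>(a :: (nat \<times> nat \<times> rat) set, b :: (nat \<times> nat \<times> rat) set). to_nat ` (Inl ` a \<union> Inr ` b))"
  proof (rule injI, clarify)
    fix a b c d :: "(nat \<times> nat \<times> rat) set"
    assume "to_nat ` (Inl ` a \<union> Inr ` b) = to_nat ` (Inl ` c \<union> Inr ` d)"
    then have "Inl ` a \<union> Inr ` b = Inl ` c \<union> Inr ` d"
      by (rule inj_image_eq_iff[OF inj_to_nat, THEN iffD1])
    then show "a = c \<and> b = d" by blast
  qed
  moreover obtain h :: "nat set \<Rightarrow> real" where "inj h"
    using nat_sets_eqpoll_reals eqpoll_imp_lepoll unfolding lepoll_def by blast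
  moreover obtain h' :: "real \<Rightarrow> 'b" where "inj h'" using assms unfolding lepoll_def by blast
  ultimately have "inj_on (h' \<circ> h \<circ> (\<lambda>(a, b). to_nat ` (Inl ` a \<union> Inr ` b)) \<circ> S) complex_linear"
    by (intro comp_inj_on) (auto intro: inj_on_subset)
  then show ?thesis by blast
qed

section \<open>Bounded cocycles on hyperbolic groups\<close>

context group
begin

definition word_of :: "'a set \<Rightarrow> 'a list \<Rightarrow> 'a \<Rightarrow> bool" where
  "word_of S ws g \<longleftrightarrow> set ws \<subseteq> S \<union> (\<lambda>s. inv s) ` S \<and> foldr (\<otimes>) ws \<one> = g"

lemma foldr_closed: "set ws \<subseteq> carrier G \<Longrightarrow> foldr (\<otimes>) ws \<one> \<in> carrier G"
  by (induction ws) auto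

lemma foldr_append_mult:
  "\<lbrakk>set ws \<subseteq> carrier G; set vs \<subseteq> carrier G\<rbrakk> \<Longrightarrow> foldr (\<otimes>) (ws @ vs) \<one> = foldr (\<otimes>) ws \<one> \<otimes> foldr (\<otimes>) vs \<one>"
proof (induction ws)
  case Nil
  then show ?case using foldr_closed[of vs] by simp
next
  case (Cons a ws)
  then show ?case using foldr_closed[of ws] foldr_closed[of vs] by (simp add: m_assoc del: foldr_append)
qed

end

locale marked_group = group G for G :: "('g, 'm) monoid_scheme" (structure) +
  fixes S :: "'g set"
  assumes finite_S: "finite S" and S_carrier: "S \<subseteq> carrier G" and generate_S: "generate G S = carrier G"
begin

abbreviation "wl \<equiv> word_length G S"

lemma letters_carrier: "S \<union> (\<lambda>s. inv s) ` S \<subseteq> carrier G"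
  using S_carrier by auto

lemma word_ofD: "word_of S ws g \<Longrightarrow> set ws \<subseteq> carrier G" "word_of S ws g \<Longrightarrow> g \<in> carrier G"
  using letters_carrier foldr_closed unfolding word_of_def by blast+

lemma word_of_append: "\<lbrakk>word_of S ws g; word_of S vs h\<rbrakk> \<Longrightarrow> word_of S (ws @ vs) (g \<otimes> h)"
  using foldr_append_mult[of ws vs] word_ofD unfolding word_of_def by (auto simp del: foldr_append)

lemma ex_word_of: "g \<in> carrier G \<Longrightarrow> \<exists>ws. word_of S ws g"
  unfolding generate_S[symmetric]
proof (induction rule: generate.induct)
  case one
  then show ?case by (intro exI[of _ "[]"]) (simp add: word_of_def)
next
  case (incl h)
  then show ?case using S_carrier by (intro exI[of _ "[h]"]) (auto simp: word_of_def)
next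
  case (inv h)
  then show ?case using S_carrier by (intro exI[of _ "[inv h]"]) (auto simp: word_of_def)
next
  case (eng h1 h2)
  then show ?case using word_of_append by blast
qed

lemma word_of_inv: "word_of S ws g \<Longrightarrow> \<exists>vs. length vs = length ws \<and> word_of S vs (inv g)"
proof (induction ws arbitrary: g)
  case Nil
  then show ?case by (intro exI[of _ "[]"]) (auto simp: word_of_def)
next
  case (Cons a ws)
  define h where "h = foldr (\<otimes>) ws \<one>"
  have h: "word_of S ws h" "g = a \<otimes> h" and a: "a \<in> S \<union> (\<lambda>s. inv s) ` S"
    using Cons.prems by (auto simp: word_of_def h_def)
  have aG: "a \<in> carrier G" using a letters_carrier by blast
  obtain vs where vs: "length vs = length ws" "word_of S vs (inv h)" using Cons.IH h by blast
  have "inv a \<in> S \<union> (\<lambda>s. inv s) ` S" using a S_carrier by auto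
  then have "word_of S [inv a] (inv a)" using aG by (auto simp: word_of_def)
  from word_of_append[OF vs(2) this] have "word_of S (vs @ [inv a]) (inv g)"
    using h word_ofD aG by (simp add: inv_mult_group)
  then show ?case using vs by (intro exI[of _ "vs @ [inv a]"]) simp
qed

lemma word_length_alt: "wl g = (LEAST n. \<exists>ws. length ws = n \<and> word_of S ws g)"
  unfolding word_length_def word_of_def ..

lemma word_length_le: "word_of S ws g \<Longrightarrow> wl g \<le> length ws"
  unfolding word_length_alt by (rule Least_le) blast

lemma ex_shortest_word: "g \<in> carrier G \<Longrightarrow> \<exists>ws. length ws = wl g \<and> word_of S ws g"
proof -
  assume "g \<in> carrier G"
  then have "\<exists>n ws. length ws = n \<and> word_of S ws g" using ex_word_of by simp
  then show ?thesis unfolding word_length_alt by (rule LeastI_ex)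
qed

lemma word_length_eq_0_iff: "g \<in> carrier G \<Longrightarrow> wl g = 0 \<longleftrightarrow> g = \<one>"
proof
  assume "g \<in> carrier G" "wl g = 0"
  then show "g = \<one>" using ex_shortest_word[of g] by (auto simp: word_of_def)
next
  assume "g = \<one>"
  then have "word_of S [] g" by (simp add: word_of_def)
  from word_length_le[OF this] show "wl g = 0" by simp
qed

lemma word_length_mult_le: "\<lbrakk>g \<in> carrier G; h \<in> carrier G\<rbrakk> \<Longrightarrow> wl (g \<otimes> h) \<le> wl g + wl h"
  using ex_shortest_word[of g] ex_shortest_word[of h] word_of_append word_length_le by (metis length_append)

lemma word_length_inv: "g \<in> carrier G \<Longrightarrow> wl (inv g) = wl g"
proof -
  have "wl (inv g) \<le> wl g" if "g \<in> carrier G" for g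
    using ex_shortest_word[OF that] word_of_inv word_length_le by metis
  then show "g \<in> carrier G \<Longrightarrow> wl (inv g) = wl g" by (metis antisym inv_closed inv_inv)
qed

text \<open>The pieces of a shortest word are shortest, since otherwise the whole could be
  shortened. This provides \<open>d_split\<close> for the word metric.\<close>

lemma word_length_split:
  assumes "g \<in> carrier G" "wl g = m + n"
  shows "\<exists>h\<in>carrier G. wl h = m \<and> wl (inv h \<otimes> g) = n"
proof -
  obtain ws where ws: "length ws = m + n" "word_of S ws g" using ex_shortest_word assms by metis
  define h where "h = foldr (\<otimes>) (take m ws) \<one>"
  define k where "k = foldr (\<otimes>) (drop m ws) \<one>"
  have w: "word_of S (take m ws) h" "word_of S (drop m ws) k"
    using ws(2) set_take_subset[of m ws] set_drop_subset[of m ws] by (auto simp: word_of_def h_def k_def)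
  have hk: "h \<in> carrier G" "k \<in> carrier G" using w word_ofD by auto
  have "word_of S (take m ws @ drop m ws) (h \<otimes> k)" by (rule word_of_append[OF w])
  then have g: "g = h \<otimes> k" using ws(2) by (simp add: word_of_def)
  have "wl h \<le> m" "wl k \<le> n" using word_length_le[OF w(1)] word_length_le[OF w(2)] ws(1) by auto
  moreover have "m + n \<le> wl h + wl k" using word_length_mult_le[OF hk] assms g by simp
  moreover have "inv h \<otimes> g = k" using g hk by (simp add: m_assoc[symmetric])
  ultimately show ?thesis using hk by (intro bexI[of _ h]) auto
qed

lemma finite_word_ball: "finite {g \<in> carrier G. wl g \<le> N}"
proof (rule finite_subset)
  show "{g \<in> carrier G. wl g \<le> N} \<subseteq>
      (\<lambda>ws. foldr (\<otimes>) ws \<one>) ` {ws. set ws \<subseteq> S \<union> (\<lambda>s. inv s) ` S \<and> length ws \<le> N}"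
    using ex_shortest_word unfolding word_of_def by force
  show "finite ((\<lambda>ws. foldr (\<otimes>) ws \<one>) ` {ws. set ws \<subseteq> S \<union> (\<lambda>s. inv s) ` S \<and> length ws \<le> N})"
    using finite_S by (intro finite_imageI finite_lists_length_le) auto
qed

lemma countable_carrier: "countable (carrier G)"
proof -
  have "carrier G \<subseteq> (\<Union>N. {g \<in> carrier G. wl g \<le> N})" by auto
  moreover have "countable (\<Union>N. {g \<in> carrier G. wl g \<le> N})"
    by (rule countable_UN) (auto intro: countable_finite finite_word_ball)
  ultimately show ?thesis by (rule countable_subset)
qed

definition wd :: "'g \<Rightarrow> 'g \<Rightarrow> nat" where
  "wd x y = wl (inv x \<otimes> y)"

lemma wd_sym: "\<lbrakk>x \<in> carrier G; y \<in> carrier G\<rbrakk> \<Longrightarrow> wd x y = wd y x"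
  using word_length_inv[of "inv x \<otimes> y"] by (simp add: wd_def inv_mult_group)

lemma inv_mult_cancel: "\<lbrakk>x \<in> carrier G; y \<in> carrier G; z \<in> carrier G\<rbrakk> \<Longrightarrow> (inv x \<otimes> y) \<otimes> (inv y \<otimes> z) = inv x \<otimes> z"
proof -
  assume xyz: "x \<in> carrier G" "y \<in> carrier G" "z \<in> carrier G"
  have "y \<otimes> (inv y \<otimes> z) = z" using xyz by (simp add: m_assoc[symmetric])
  then show ?thesis using xyz by (simp add: m_assoc)
qed

lemma inv_translate: "\<lbrakk>g \<in> carrier G; x \<in> carrier G; y \<in> carrier G\<rbrakk> \<Longrightarrow> inv (g \<otimes> x) \<otimes> (g \<otimes> y) = inv x \<otimes> y"
proof -
  assume gxy: "g \<in> carrier G" "x \<in> carrier G" "y \<in> carrier G"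
  have "inv g \<otimes> (g \<otimes> y) = y" using gxy by (simp add: m_assoc[symmetric])
  then show ?thesis using gxy by (simp add: inv_mult_group m_assoc)
qed

text \<open>This passes from inhomogeneous to homogeneous cochains. The normalizations of
  \<open>c\<close> make the homogeneous cocycle vanish on triples with two equal entries; the
  cocycle identity with a repeated point then makes it alternating.\<close>

lemma hyperbolic_cocycle_word_metric:
  fixes c :: "'g \<Rightarrow> 'g \<Rightarrow> real"
  assumes hyp: "gromov_hyperbolic (carrier G) (word_dist G S)"
    and cocycle: "\<And>g h k. \<lbrakk>g \<in> carrier G; h \<in> carrier G; k \<in> carrier G\<rbrakk>
      \<Longrightarrow> c h k - c (g \<otimes> h) k + c g (h \<otimes> k) - c g h = 0"
    and one: "\<And>g. g \<in> carrier G \<Longrightarrow> c \<one> g = 0" "\<And>g. g \<in> carrier G \<Longrightarrow> c g \<one> = 0"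
    and inv: "\<And>g. g \<in> carrier G \<Longrightarrow> c g (inv g) = 0"
  shows "\<exists>\<delta>. hyperbolic_cocycle (carrier G) wd \<delta> (\<lambda>x y z. c (inv x \<otimes> y) (inv y \<otimes> z))"
proof -
  define f where "f x y z = c (inv x \<otimes> y) (inv y \<otimes> z)" for x y z
  have wd: "word_dist G S = (\<lambda>x y. real (wd x y))" by (simp add: fun_eq_iff word_dist_def wd_def)
  obtain \<delta> where \<delta>: "\<And>w x y z. \<lbrakk>w \<in> carrier G; x \<in> carrier G; y \<in> carrier G; z \<in> carrier G\<rbrakk> \<Longrightarrow>
      min (gromov_product (\<lambda>x y. real (wd x y)) w x y) (gromov_product (\<lambda>x y. real (wd x y)) w y z) - \<delta>
      \<le> gromov_product (\<lambda>x y. real (wd x y)) w x z"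
    using hyp unfolding gromov_hyperbolic_def wd by blast
  have fcocycle: "f y z w - f x z w + f x y w - f x y z = 0"
    if "x \<in> carrier G" "y \<in> carrier G" "z \<in> carrier G" "w \<in> carrier G" for x y z w
    using cocycle[of "inv x \<otimes> y" "inv y \<otimes> z" "inv z \<otimes> w"] that inv_mult_cancel by (simp add: f_def)
  have deg: "f x x y = 0" "f x y y = 0" "f x y x = 0" if "x \<in> carrier G" "y \<in> carrier G" for x y
    using one[of "inv x \<otimes> y"] inv[of "inv x \<otimes> y"] that by (simp_all add: f_def inv_mult_group)
  have "hyperbolic_cocycle (carrier G) wd \<delta> f"
  proof (rule hyperbolic_cocycle.intro)
    fix x y z :: 'g and m n :: nat
    assume x: "x \<in> carrier G" and y: "y \<in> carrier G"
    have "inv x \<otimes> y = \<one> \<longleftrightarrow> x = y"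
      using x y inv_equality[of "inv x" y] by (auto simp: l_inv)
    then show "wd x y = 0 \<longleftrightarrow> x = y" using word_length_eq_0_iff x y by (simp add: wd_def)
    show "wd x y = wd y x" by (rule wd_sym[OF x y])
    show "wd x z \<le> wd x y + wd y z" if "z \<in> carrier G"
      using word_length_mult_le[of "inv x \<otimes> y" "inv y \<otimes> z"] x y that by (simp add: wd_def inv_mult_cancel)
    show "\<exists>z\<in>carrier G. wd x z = m \<and> wd z y = n" if d: "wd x y = m + n"
    proof -
      obtain h where h: "h \<in> carrier G" "wl h = m" "wl (inv h \<otimes> (inv x \<otimes> y)) = n"
        using word_length_split[of "inv x \<otimes> y" m n] d x y by (auto simp: wd_def)
      have "inv x \<otimes> (x \<otimes> h) = h" using x h by (simp add: m_assoc[symmetric])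
      moreover have "inv (x \<otimes> h) \<otimes> y = inv h \<otimes> (inv x \<otimes> y)" using x y h by (simp add: inv_mult_group m_assoc)
      ultimately show ?thesis using x h by (intro bexI[of _ "x \<otimes> h"]) (auto simp: wd_def)
    qed
    show "f y x z = - f x y z" if "z \<in> carrier G"
      using fcocycle[of x y x z] deg x y that by simp
    show "f x z y = - f x y z" if "z \<in> carrier G"
      using fcocycle[of x y z y] deg x y that by simp
  next
    fix N
    \<comment> \<open>A triple enters only through \<open>inv x \<otimes> y\<close> and
      \<open>inv y \<otimes> z\<close>, which lie in the ball of radius \<open>2 * N\<close>, so
      only finitely many values occur.\<close>
    define F where "F = {g \<in> carrier G. wl g \<le> 2 * N}"
    have F: "finite F" unfolding F_def by (rule finite_word_ball)
    show "\<exists>M. \<forall>x\<in>carrier G. \<forall>y\<in>carrier G. \<forall>z\<in>carrier G. wd x y \<le> N \<longrightarrow> wd x z \<le> N \<longrightarrow> \<bar>f x y z\<bar> \<le> M"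
    proof (intro exI ballI impI)
      fix x y z assume xyz: "x \<in> carrier G" "y \<in> carrier G" "z \<in> carrier G" and d: "wd x y \<le> N" "wd x z \<le> N"
      have "wl (inv y \<otimes> z) \<le> wl (inv y \<otimes> x) + wl (inv x \<otimes> z)"
        using word_length_mult_le[of "inv y \<otimes> x" "inv x \<otimes> z"] xyz by (simp add: inv_mult_cancel)
      also have "wl (inv y \<otimes> x) = wd x y" using wd_sym xyz by (simp add: wd_def)
      finally have "inv y \<otimes> z \<in> F" "inv x \<otimes> y \<in> F" using d xyz by (auto simp: F_def wd_def)
      then show "\<bar>f x y z\<bar> \<le> (\<Sum>p\<in>F \<times> F. \<bar>c (fst p) (snd p)\<bar>)"
        unfolding f_def using F member_le_sum[of "(inv x \<otimes> y, inv y \<otimes> z)" "F \<times> F" "\<lambda>p. \<bar>c (fst p) (snd p)\<bar>"] by auto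
    qed
  qed ((rule \<delta>; assumption) | (rule fcocycle; assumption))+
  then show ?thesis unfolding f_def by blast
qed

text \<open>Left translations preserve \<open>f\<close> and the word metric, hence also
  \<open>H.\<rho>\<close>, so the values \<open>H.\<rho> \<one> g\<close> form a 1-cochain whose
  coboundary is the correction. It is odd because \<open>H.\<rho>\<close> is antisymmetric.\<close>

lemma bounded_cocycle_normalized:
  fixes c :: "'g \<Rightarrow> 'g \<Rightarrow> real"
  assumes hyp: "gromov_hyperbolic (carrier G) (word_dist G S)"
    and cocycle: "\<And>g h k. \<lbrakk>g \<in> carrier G; h \<in> carrier G; k \<in> carrier G\<rbrakk>
      \<Longrightarrow> c h k - c (g \<otimes> h) k + c g (h \<otimes> k) - c g h = 0"
    and one: "\<And>g. g \<in> carrier G \<Longrightarrow> c \<one> g = 0" "\<And>g. g \<in> carrier G \<Longrightarrow> c g \<one> = 0"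
    and inv: "\<And>g. g \<in> carrier G \<Longrightarrow> c g (inv g) = 0"
  shows "\<exists>\<phi> C. \<phi> \<one> = 0 \<and> (\<forall>g\<in>carrier G. \<phi> (inv g) = - \<phi> g) \<and>
    (\<forall>g\<in>carrier G. \<forall>h\<in>carrier G. \<bar>c g h + (\<phi> h - \<phi> (g \<otimes> h) + \<phi> g)\<bar> \<le> C)"
proof -
  define f where "f x y z = c (inv x \<otimes> y) (inv y \<otimes> z)" for x y z
  obtain \<delta> where "hyperbolic_cocycle (carrier G) wd \<delta> f"
    using hyperbolic_cocycle_word_metric[OF hyp cocycle one inv] unfolding f_def by blast
  then interpret H: hyperbolic_cocycle "carrier G" wd \<delta> f .
  obtain A :: real where "A \<ge> 1" "\<And>xs. H.path xs \<Longrightarrow> hd xs = last xs \<Longrightarrow> \<bar>H.area xs\<bar> \<le> A * H.len xs"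
    using H.isoperimetric by blast
  then interpret H: hyperbolic_cocycle_filling "carrier G" wd \<delta> f A by unfold_locales
  obtain C where C: "\<And>x y z. \<lbrakk>x \<in> carrier G; y \<in> carrier G; z \<in> carrier G\<rbrakk> \<Longrightarrow>
      \<bar>f x y z + H.\<rho> x y + H.\<rho> y z + H.\<rho> z x\<bar> \<le> C"
    using H.bounded_representative by blast
  have P: "H.P K (g \<otimes> x) (g \<otimes> y) = H.P K x y" if "g \<in> carrier G" "x \<in> carrier G" "y \<in> carrier G" for K g x y
  proof (rule H.P_invariant[where g' = "\<lambda>x. inv g \<otimes> x"])
    show "inv g \<otimes> (g \<otimes> x) = x" "g \<otimes> (inv g \<otimes> x) = x" if "x \<in> carrier G" for x
      using that \<open>g \<in> carrier G\<close> by (simp_all add: m_assoc[symmetric])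
  qed (use that in \<open>simp_all add: wd_def f_def inv_translate\<close>)
  have inv\<rho>: "H.\<rho> (g \<otimes> x) (g \<otimes> y) = H.\<rho> x y" if "g \<in> carrier G" "x \<in> carrier G" "y \<in> carrier G" for g x y
    using P that by (simp add: H.\<rho>_def)
  have anti: "H.\<rho> y x = - H.\<rho> x y" for x y
    unfolding H.\<rho>_def minus_divide_left by simp
  define \<phi> where "\<phi> = H.\<rho> \<one>"
  have "\<phi> \<one> = 0" using anti[of \<one> \<one>] by (simp add: \<phi>_def)
  moreover have "\<phi> (inv g) = - \<phi> g" if "g \<in> carrier G" for g
    using inv\<rho>[of g \<one> "inv g"] that anti[of g \<one>] by (simp add: \<phi>_def)
  moreover have "\<bar>c g h + (\<phi> h - \<phi> (g \<otimes> h) + \<phi> g)\<bar> \<le> C" if "g \<in> carrier G" "h \<in> carrier G" for g h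
  proof -
    have "f \<one> g (g \<otimes> h) = c g h" using that by (simp add: f_def m_assoc[symmetric])
    moreover have "H.\<rho> g (g \<otimes> h) = \<phi> h" using inv\<rho>[of g \<one> h] that by (simp add: \<phi>_def)
    moreover have "H.\<rho> (g \<otimes> h) \<one> = - \<phi> (g \<otimes> h)" unfolding \<phi>_def by (rule anti)
    moreover have "H.\<rho> \<one> g = \<phi> g" by (simp add: \<phi>_def)
    ultimately have e: "f \<one> g (g \<otimes> h) + H.\<rho> \<one> g + H.\<rho> g (g \<otimes> h) + H.\<rho> (g \<otimes> h) \<one> = c g h + (\<phi> h - \<phi> (g \<otimes> h) + \<phi> g)"
      by simp
    show ?thesis using C[of \<one> g "g \<otimes> h"] that unfolding e by simp
  qed
  ultimately show ?thesis by blast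
qed

text \<open>A preliminary coboundary normalizes \<open>c\<close>, and the oddness of the bounded
  correction carries the normalization over to \<open>\<theta>\<close>. It later makes
  \<open>u \<one>\<close> the identity and \<open>u (inv s)\<close> the inverse of
  \<open>u s\<close>.\<close>

lemma bounded_cocycle:
  fixes c :: "'g \<Rightarrow> 'g \<Rightarrow> real"
  assumes hyp: "gromov_hyperbolic (carrier G) (word_dist G S)"
    and cocycle: "\<And>g h k. \<lbrakk>g \<in> carrier G; h \<in> carrier G; k \<in> carrier G\<rbrakk>
      \<Longrightarrow> c h k - c (g \<otimes> h) k + c g (h \<otimes> k) - c g h = 0"
  shows "\<exists>\<theta> \<phi> C. (\<forall>g\<in>carrier G. \<forall>h\<in>carrier G. \<theta> g h = c g h + (\<phi> h - \<phi> (g \<otimes> h) + \<phi> g) \<and> \<bar>\<theta> g h\<bar> \<le> C)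
    \<and> (\<forall>g\<in>carrier G. \<theta> \<one> g = 0 \<and> \<theta> g (inv g) = 0)"
proof -
  have c1: "c \<one> g = c \<one> \<one>" "c g \<one> = c \<one> \<one>" if "g \<in> carrier G" for g
    using cocycle[of \<one> \<one> g] cocycle[of g \<one> \<one>] that by auto
  \<comment> \<open>At \<open>\<one>\<close> the value is \<open>- c \<one> \<one>\<close>, which
    removes \<open>c \<one> g\<close>. The half fits because \<open>\<psi>\<close> agrees at
    \<open>g\<close> and \<open>inv g\<close>, so it counts twice against
    \<open>c g (inv g)\<close>.\<close>
  define \<psi> where "\<psi> g = - (c g (inv g) + c \<one> \<one>) / 2" for g
  define c' where "c' g h = c g h + (\<psi> h - \<psi> (g \<otimes> h) + \<psi> g)" for g h
  have ci: "c (inv g) g = c g (inv g)" if "g \<in> carrier G" for g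
    using cocycle[of g "inv g" g] c1[of g] that by simp
  have one': "c' \<one> g = 0" "c' g \<one> = 0" and inv': "c' g (inv g) = 0" if "g \<in> carrier G" for g
    using that c1[of g] ci[of g] by (simp_all add: c'_def \<psi>_def field_simps)
  have "\<exists>\<phi> C. \<phi> \<one> = 0 \<and> (\<forall>g\<in>carrier G. \<phi> (inv g) = - \<phi> g) \<and>
    (\<forall>g\<in>carrier G. \<forall>h\<in>carrier G. \<bar>c' g h + (\<phi> h - \<phi> (g \<otimes> h) + \<phi> g)\<bar> \<le> C)"
  proof (rule bounded_cocycle_normalized[OF hyp])
    fix g h k assume g: "g \<in> carrier G" "h \<in> carrier G" "k \<in> carrier G"
    show "c' h k - c' (g \<otimes> h) k + c' g (h \<otimes> k) - c' g h = 0"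
      using cocycle[OF g] g by (simp add: c'_def m_assoc)
  qed (use one' inv' in auto)
  then obtain \<phi> C where \<phi>: "\<phi> \<one> = 0" "\<And>g. g \<in> carrier G \<Longrightarrow> \<phi> (inv g) = - \<phi> g"
    "\<And>g h. \<lbrakk>g \<in> carrier G; h \<in> carrier G\<rbrakk> \<Longrightarrow> \<bar>c' g h + (\<phi> h - \<phi> (g \<otimes> h) + \<phi> g)\<bar> \<le> C" by blast
  show ?thesis
    by (rule exI[of _ "\<lambda>g h. c' g h + (\<phi> h - \<phi> (g \<otimes> h) + \<phi> g)"], rule exI[of _ "\<lambda>g. \<psi> g + \<phi> g"], rule exI[of _ C])
      (use \<phi> one' inv' in \<open>auto simp: c'_def algebra_simps\<close>)
qed

end

section \<open>Cocycles that are coboundaries on finite sets\<close>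

text \<open>The equations are solved on a basis chosen among the left-hand sides. Any other
  left-hand side is a finite combination of basis vectors, and solvability of the finite subsystem
  formed by it and them shows that its right-hand side is the same combination.\<close>

lemma linear_functional_compactness:
  fixes b :: "'p \<Rightarrow> 'v::real_vector" and c :: "'p \<Rightarrow> real"
  assumes fin: "\<And>F. \<lbrakk>finite F; F \<subseteq> I\<rbrakk> \<Longrightarrow> \<exists>f. linear f \<and> (\<forall>p\<in>F. f (b p) = c p)"
  shows "\<exists>f. linear f \<and> (\<forall>p\<in>I. f (b p) = c p)"
proof -
  obtain B where B: "B \<subseteq> b ` I" "independent B" "b ` I \<subseteq> span B"
    by (rule maximal_independent_subset)
  have "\<forall>v\<in>B. \<exists>p. p \<in> I \<and> b p = v" using B(1) by auto
  then obtain q where q: "\<And>v. v \<in> B \<Longrightarrow> q v \<in> I" "\<And>v. v \<in> B \<Longrightarrow> b (q v) = v" by metis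
  obtain f0 :: "'v \<Rightarrow> real" where f0: "linear f0" "\<And>v. v \<in> B \<Longrightarrow> f0 v = c (q v)"
    using linear_independent_extend[OF B(2), of "\<lambda>v. c (q v)"] by auto
  have "f0 (b p) = c p" if p: "p \<in> I" for p
  proof -
    have "b p \<in> span B" using p B(3) by auto
    then obtain t r where t: "finite t" "t \<subseteq> B" "b p = (\<Sum>a\<in>t. r a *\<^sub>R a)"
      unfolding span_explicit by auto
    have "finite (insert p (q ` t))" "insert p (q ` t) \<subseteq> I" using t p q by auto
    from fin[OF this] obtain f where f: "linear f" "\<And>x. x \<in> insert p (q ` t) \<Longrightarrow> f (b x) = c x" by blast
    have "c p = f (b p)" using f(2) by simp
    also have "\<dots> = (\<Sum>a\<in>t. r a * f a)" unfolding t(3) using f(1) by (simp add: linear_sum linear_scale)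
    also have "\<dots> = (\<Sum>a\<in>t. r a * f0 a)"
    proof (rule sum.cong[OF refl])
      fix a assume a: "a \<in> t"
      have "f a = c (q a)" using f(2)[of "q a"] q(2)[of a] a t(2) by auto
      then show "r a * f a = r a * f0 a" using f0(2)[of a] a t(2) by auto
    qed
    also have "\<dots> = f0 (b p)" unfolding t(3) using f0(1) by (simp add: linear_sum linear_scale)
    finally show ?thesis by simp
  qed
  then show ?thesis using f0(1) by blast
qed

text \<open>The unknown \<open>\<psi> g\<close> becomes the value of a functional at
  \<open>basis g\<close>, and each pair \<open>(g, h)\<close> one linear equation. The functional is
  merely algebraic, so \<open>\<psi>\<close> may be unbounded.\<close>

lemma (in group) coboundary_compactness:
  fixes c :: "'a \<Rightarrow> 'a \<Rightarrow> real"
  assumes fin: "\<And>F. \<lbrakk>finite F; F \<subseteq> carrier G\<rbrakk> \<Longrightarrow>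
    \<exists>\<psi>. \<forall>g\<in>F. \<forall>h\<in>F. c g h = \<psi> h - \<psi> (g \<otimes> h) + \<psi> g"
  shows "\<exists>\<psi>. \<forall>g\<in>carrier G. \<forall>h\<in>carrier G. c g h = \<psi> h - \<psi> (g \<otimes> h) + \<psi> g"
proof -
  define b :: "'a \<times> 'a \<Rightarrow> 'a ell2" where "b p = basis (snd p) - basis (fst p \<otimes> snd p) + basis (fst p)" for p
  have "\<exists>f. linear f \<and> (\<forall>p\<in>carrier G \<times> carrier G. f (b p) = c (fst p) (snd p))"
  proof (rule linear_functional_compactness)
    fix F assume F: "finite F" "F \<subseteq> carrier G \<times> carrier G"
    have "finite (fst ` F \<union> snd ` F)" "fst ` F \<union> snd ` F \<subseteq> carrier G" using F by auto
    from fin[OF this] obtain \<psi> where \<psi>: "\<And>g h. \<lbrakk>g \<in> fst ` F \<union> snd ` F; h \<in> fst ` F \<union> snd ` F\<rbrakk>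
        \<Longrightarrow> c g h = \<psi> h - \<psi> (g \<otimes> h) + \<psi> g" by blast
    define S where "S = fst ` F \<union> snd ` F \<union> (\<lambda>p. fst p \<otimes> snd p) ` F"
    have S: "finite S" using F by (simp add: S_def)
    \<comment> \<open>This extends \<open>\<psi>\<close> linearly from the finitely many basis
      vectors that occur in the equations of \<open>F\<close>.\<close>
    define f where "f v = (\<Sum>g\<in>S. \<psi> g * Re (coord v g))" for v
    have lin: "linear f"
      by (rule linearI) (simp_all add: f_def algebra_simps sum.distrib sum_distrib_left)
    have basis: "f (basis g) = \<psi> g" if "g \<in> S" for g
    proof -
      have "f (basis g) = (\<Sum>h\<in>S. if h = g then \<psi> h else 0)"
        unfolding f_def by (rule sum.cong) auto
      then show ?thesis using S that by simp
    qed
    have "f (b p) = c (fst p) (snd p)" if p: "p \<in> F" for p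
    proof -
      have "f (b p) = \<psi> (snd p) - \<psi> (fst p \<otimes> snd p) + \<psi> (fst p)"
        unfolding b_def linear_add[OF lin] linear_diff[OF lin] using p by (subst (1 2 3) basis) (auto simp: S_def)
      then show ?thesis using \<psi>[of "fst p" "snd p"] p by simp
    qed
    then show "\<exists>f. linear f \<and> (\<forall>p\<in>F. f (b p) = c (fst p) (snd p))" using lin by blast
  qed
  then obtain f where f: "linear f" "\<And>p. p \<in> carrier G \<times> carrier G \<Longrightarrow> f (b p) = c (fst p) (snd p)" by blast
  have "c g h = f (basis h) - f (basis (g \<otimes> h)) + f (basis g)" if "g \<in> carrier G" "h \<in> carrier G" for g h
    using f(2)[of "(g, h)"] that by (simp add: b_def linear_add[OF f(1)] linear_diff[OF f(1)])
  then show ?thesis by (intro exI[of _ "\<lambda>g. f (basis g)"]) blast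
qed

section \<open>The twisted regular representation\<close>

lemma subspace_closure:
  fixes S :: "'a::real_normed_vector set"
  assumes "subspace S"
  shows "subspace (closure S)"
proof (rule subspaceI)
  show "0 \<in> closure S" using closure_subset subspace_0[OF assms] by blast
next
  fix x y assume "x \<in> closure S" "y \<in> closure S"
  then obtain f g where fg: "\<And>n. f n \<in> S" "f \<longlonglongrightarrow> x" "\<And>n. g n \<in> S" "g \<longlonglongrightarrow> y"
    unfolding closure_sequential by blast
  have "(\<lambda>n. f n + g n) \<longlonglongrightarrow> x + y" using fg by (intro tendsto_add)
  moreover have "f n + g n \<in> S" for n using fg assms by (intro subspace_add)
  ultimately show "x + y \<in> closure S"
    unfolding closure_sequential by (intro exI[of _ "\<lambda>n. f n + g n"]) simp
next
  fix c x assume "x \<in> closure S"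
  then obtain f where f: "\<And>n. f n \<in> S" "f \<longlonglongrightarrow> x"
    unfolding closure_sequential by blast
  have "(\<lambda>n. c *\<^sub>R f n) \<longlonglongrightarrow> c *\<^sub>R x" using f by (intro tendsto_intros)
  moreover have "c *\<^sub>R f n \<in> S" for n using f assms by (intro subspace_scale)
  ultimately show "c *\<^sub>R x \<in> closure S"
    unfolding closure_sequential by (intro exI[of _ "\<lambda>n. c *\<^sub>R f n"]) simp
qed

lemma weighted_perm_isometry:
  fixes w :: "'i \<Rightarrow> complex"
  assumes w: "\<And>i. cmod (w i) = 1" and p: "bij p"
  shows "op_adj (weighted_perm w p) * weighted_perm w p = 1"
proof (rule op_coord_eqI)
  fix f :: "'i ell2" and i
  have p': "bij (inv_into UNIV p)" using p by (rule bij_imp_bij_inv)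
  have w': "\<And>i. cmod (cnj (w (inv_into UNIV p i))) = 1" using w by simp
  have "p (inv_into UNIV p i) = i" using p by (simp add: bij_is_surj surj_f_inv_f)
  then have "coord (act (op_adj (weighted_perm w p) * weighted_perm w p) f) i
      = cnj (w (inv_into UNIV p i)) * (w (inv_into UNIV p i) * coord f i)"
    by (simp add: coord_weighted_perm(2)[OF w p] coord_weighted_perm(1)[OF w' p'] coord_weighted_perm(1)[OF w p])
  also have "\<dots> = coord f i"
    using w[of "inv_into UNIV p i"] complex_norm_square[of "w (inv_into UNIV p i)"] by (simp add: mult.assoc[symmetric] mult.commute[of "cnj _"])
  finally show "coord (act (op_adj (weighted_perm w p) * weighted_perm w p) f) i = coord (act 1 f) i" by simp
qed

text \<open>The twisted left regular representation on \<open>\<ell>\<^sup>2(G \<times> \<nat>)\<close>; the factor \<open>\<nat>\<close> only serves to make the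
  index set countably infinite.\<close>

locale twisted_group = group G for G :: "('g, 'm) monoid_scheme" (structure) +
  fixes \<theta> :: "'g \<Rightarrow> 'g \<Rightarrow> real" and e :: "'g \<times> nat \<Rightarrow> nat"
  assumes bij_e: "bij_betw e (carrier G \<times> UNIV) UNIV"
    and cocycle: "\<lbrakk>g \<in> carrier G; h \<in> carrier G; k \<in> carrier G\<rbrakk>
      \<Longrightarrow> \<theta> h k - \<theta> (g \<otimes> h) k + \<theta> g (h \<otimes> k) - \<theta> g h = 0"
    and \<theta>_one: "g \<in> carrier G \<Longrightarrow> \<theta> \<one> g = 0"
    and \<theta>_inv: "g \<in> carrier G \<Longrightarrow> \<theta> g (inv g) = 0"
begin

definition d :: "nat \<Rightarrow> 'g \<times> nat" where "d = inv_into (carrier G \<times> UNIV) e"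

definition perm :: "'g \<Rightarrow> nat \<Rightarrow> nat" where
  "perm s i = e (inv s \<otimes> fst (d i), snd (d i))"

text \<open>Together with \<open>perm\<close> this encodes translation by \<open>s\<close> with
  phase: at a point \<open>t\<close> of the group the result is
  \<open>cis (\<theta> s (inv s \<otimes> t))\<close> times the old value at
  \<open>inv s \<otimes> t\<close>.\<close>

definition weight :: "'g \<Rightarrow> nat \<Rightarrow> complex" where
  "weight s i = cis (\<theta> s (inv s \<otimes> fst (d i)))"

definition u :: "'g \<Rightarrow> nat op" where
  "u s = weighted_perm (weight s) (perm s)"

lemma d_carrier: "fst (d i) \<in> carrier G"
  using bij_betw_apply[OF bij_betw_inv_into[OF bij_e], of i] by (auto simp: d_def mem_Times_iff)

lemma e_d: "e (d i) = i"
  unfolding d_def using bij_e by (simp add: bij_betw_def f_inv_into_f)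

lemma d_e: "t \<in> carrier G \<Longrightarrow> d (e (t, k)) = (t, k)"
  unfolding d_def using bij_e by (intro inv_into_f_f) (auto simp: bij_betw_def)

lemma d_perm: "s \<in> carrier G \<Longrightarrow> d (perm s i) = (inv s \<otimes> fst (d i), snd (d i))"
  unfolding perm_def using d_carrier by (intro d_e) auto

lemma perm_mult: "\<lbrakk>s \<in> carrier G; r \<in> carrier G\<rbrakk> \<Longrightarrow> perm r (perm s i) = perm (s \<otimes> r) i"
  using d_perm[of s i] d_carrier[of i] by (simp add: perm_def[of r] perm_def[of "s \<otimes> r"] inv_mult_group m_assoc)

lemma perm_one: "perm \<one> i = i"
  using d_carrier[of i] by (simp add: perm_def e_d)

lemma bij_perm: "s \<in> carrier G \<Longrightarrow> bij (perm s)"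
  by (rule bij_betw_byWitness[where f' = "perm (inv s)"]) (auto simp: perm_mult perm_one)

lemma norm_weight: "cmod (weight s i) = 1"
  by (simp add: weight_def)

lemma coord_u: "s \<in> carrier G \<Longrightarrow> coord (act (u s) f) i = weight s i * coord f (perm s i)"
  unfolding u_def by (intro coord_weighted_perm norm_weight bij_perm)

lemma u_mult:
  assumes s: "s \<in> carrier G" and r: "r \<in> carrier G"
  shows "u s * u r = cscalar (cis (\<theta> s r)) * u (s \<otimes> r)"
proof (rule op_coord_eqI)
  fix f i
  \<comment> \<open>For \<open>t = fst (d i)\<close>, this is the point from which
    \<open>s \<otimes> r\<close> moves to \<open>t\<close>; the cocycle identity at
    \<open>s\<close>, \<open>r\<close>, \<open>k\<close> collects the two phases.\<close>
  define k where "k = inv r \<otimes> (inv s \<otimes> fst (d i))"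
  have k: "k \<in> carrier G" "r \<otimes> k = inv s \<otimes> fst (d i)" "inv (s \<otimes> r) \<otimes> fst (d i) = k"
    unfolding k_def using s r d_carrier[of i] by (simp_all add: m_assoc[symmetric] inv_mult_group)
  have "weight s i * weight r (perm s i) = cis (\<theta> s (r \<otimes> k) + \<theta> r k)"
    using d_perm[OF s, of i] k(2) by (simp add: weight_def cis_mult k_def)
  also have "\<theta> s (r \<otimes> k) + \<theta> r k = \<theta> s r + \<theta> (s \<otimes> r) k"
    using cocycle[OF s r k(1)] by simp
  also have "cis \<dots> = cis (\<theta> s r) * weight (s \<otimes> r) i"
    using k(3) by (simp add: weight_def cis_mult)
  finally show "coord (act (u s * u r) f) i = coord (act (cscalar (cis (\<theta> s r)) * u (s \<otimes> r)) f) i"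
    using s r by (simp add: coord_u perm_mult flip: mult.assoc)
qed

lemma u_one: "u \<one> = 1"
  by (rule op_coord_eqI) (use d_carrier in \<open>simp add: coord_u perm_one weight_def \<theta>_one\<close>)

lemma u_inv: "s \<in> carrier G \<Longrightarrow> u s * u (inv s) = 1" "s \<in> carrier G \<Longrightarrow> u (inv s) * u s = 1"
  using u_mult[of s "inv s"] u_mult[of "inv s" s] \<theta>_inv[of s] \<theta>_inv[of "inv s"] u_one by auto

text \<open>\<open>u s\<close> is an isometry with a right inverse, and its adjoint must be that
  inverse.\<close>

lemma adj_u: "s \<in> carrier G \<Longrightarrow> op_adj (u s) = u (inv s)"
proof -
  assume s: "s \<in> carrier G"
  have "op_adj (u s) * u s = 1" unfolding u_def
    by (rule weighted_perm_isometry[OF norm_weight bij_perm[OF s]])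
  then have "op_adj (u s) * (u s * u (inv s)) = u (inv s)" by (simp add: mult.assoc[symmetric])
  then show ?thesis using u_inv(1)[OF s] by simp
qed

lemma norm_u: "s \<in> carrier G \<Longrightarrow> norm (u s) = 1"
  using cstar_norm[of "u s"] by (simp add: adj_u u_inv power2_eq_1_iff) (use norm_ge_zero[of "u s"] in linarith)

lemma u_complex_linear: "s \<in> carrier G \<Longrightarrow> cscalar z * u s = u s * cscalar z"
  by (rule op_coord_eqI) (simp add: coord_u mult_ac)

definition \<xi> :: "nat ell2" where "\<xi> = basis (e (\<one>, 0))"

text \<open>Thus the vector state of \<open>\<xi>\<close> reads off the coefficient at
  \<open>\<one>\<close>: it is the canonical trace.\<close>

lemma vector_state_u:
  assumes "s \<in> carrier G" "s \<noteq> \<one>"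
  shows "inner (act (cscalar z * u s) \<xi>) \<xi> = 0"
proof -
  have "d (perm s (e (\<one>, 0))) = (inv s, 0)" using assms d_e[of \<one> 0] by (simp add: d_perm)
  moreover have "inv s \<noteq> \<one>" using assms by (metis inv_inv inv_one)
  ultimately have "perm s (e (\<one>, 0)) \<noteq> e (\<one>, 0)" using d_e[of \<one> 0] by auto
  then show ?thesis using assms by (simp add: \<xi>_def inner_basis coord_u)
qed

text \<open>All complex multiples are included, so that the real span is a complex subspace.\<close>

definition U :: "nat op set" where "U = {cscalar z * u s | z s. s \<in> carrier G}"

text \<open>Up to the multiplicity from \<open>nat\<close>, the reduced twisted group
  C*-algebra.\<close>

definition A :: "nat op set" where "A = closure (span U)"

lemma U_mult: "\<lbrakk>x \<in> U; y \<in> U\<rbrakk> \<Longrightarrow> x * y \<in> U"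
proof -
  assume "x \<in> U" "y \<in> U"
  then obtain z s w r where xy: "x = cscalar z * u s" "y = cscalar w * u r" and sr: "s \<in> carrier G" "r \<in> carrier G"
    by (auto simp: U_def)
  have "x * y = cscalar z * (u s * cscalar w) * u r" by (simp add: xy mult.assoc)
  also have "\<dots> = cscalar z * cscalar w * (u s * u r)" by (simp add: u_complex_linear[OF sr(1), symmetric] mult.assoc)
  also have "\<dots> = cscalar (z * w * cis (\<theta> s r)) * u (s \<otimes> r)" by (simp add: u_mult sr cscalar_mult mult.assoc)
  finally show ?thesis using sr by (auto simp: U_def)
qed

lemma U_subset_A: "U \<subseteq> A"
  unfolding A_def using closure_subset span_superset by blast

lemma subspace_A: "subspace A"
  unfolding A_def by (intro subspace_closure subspace_span)

lemma closed_A: "closed A"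
  unfolding A_def by simp

text \<open>Conditions that cut out a closed subspace need checking only on generators; statements
  in two variables are extended one variable at a time.\<close>

lemma A_induct:
  assumes "x \<in> A" "closed C" "subspace C" "U \<subseteq> C"
  shows "x \<in> C"
  using hull_subset[OF assms(2-4)] assms(1) by (auto simp: A_def)

lemma u_U: "s \<in> carrier G \<Longrightarrow> u s \<in> U"
  unfolding U_def by (auto intro!: exI[of _ 1] exI[of _ s])

lemma cscalar_U: "cscalar z \<in> U"
  unfolding U_def by (auto intro!: exI[of _ z] exI[of _ \<one>] simp: u_one)

lemma concrete_algebra_A: "concrete_algebra A \<xi>"
proof (rule concrete_algebra.intro)
  show "1 \<in> A" using cscalar_U[of 1] U_subset_A by auto
  show "cscalar \<i> \<in> A" using cscalar_U U_subset_A by auto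
  show "x * y \<in> A" if x: "x \<in> A" and y: "y \<in> A" for x y
  proof -
    have 1: "x * y \<in> A" if "x \<in> A" "y \<in> U" for x y
    proof -
      have "closed {x. x * y \<in> A}"
        by (intro closed_vimage[OF closed_A, unfolded vimage_def] continuous_intros)
      moreover have "subspace {x. x * y \<in> A}"
        by (intro subspace_vimage_linear subspace_A bounded_linear.linear bounded_linear_mult_left)
      ultimately show ?thesis
        using A_induct[OF that(1), of "{x. x * y \<in> A}"] U_mult[OF _ that(2)] U_subset_A by auto
    qed
    have "closed {y. x * y \<in> A}"
      by (intro closed_vimage[OF closed_A, unfolded vimage_def] continuous_intros)
    moreover have "subspace {y. x * y \<in> A}"
      by (intro subspace_vimage_linear subspace_A bounded_linear.linear bounded_linear_mult_right)
    ultimately show ?thesis using A_induct[OF y, of "{y. x * y \<in> A}"] 1[OF x] by auto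
  qed
  show "op_adj x \<in> A" if x: "x \<in> A" for x
  proof -
    have "op_adj y \<in> A" if y: "y \<in> U" for y
    proof -
      obtain z s where "y = cscalar z * u s" "s \<in> carrier G" using y by (auto simp: U_def)
      then have "op_adj y = cscalar (cnj z) * u (inv s)" "inv s \<in> carrier G"
        by (simp_all add: adj_u u_complex_linear)
      then show ?thesis using U_subset_A by (auto simp: U_def)
    qed
    moreover have "closed {x. op_adj x \<in> A}"
      by (intro closed_vimage[OF closed_A, unfolded vimage_def] linear_continuous_on bounded_linear_adj)
    moreover have "subspace {x. op_adj x \<in> A}"
      by (intro subspace_vimage_linear subspace_A bounded_linear.linear bounded_linear_adj)
    ultimately show ?thesis using A_induct[OF x, of "{x. op_adj x \<in> A}"] by auto
  qed
  have "U \<subseteq> complex_linear"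
  proof
    fix x assume "x \<in> U"
    then obtain z s where "x = cscalar z * u s" "s \<in> carrier G" by (auto simp: U_def)
    then show "x \<in> complex_linear" unfolding complex_linear_def
      by (simp add: op_coord_eqI coord_u mult_ac)
  qed
  then show "A \<subseteq> complex_linear"
    unfolding A_def by (intro hull_subset closed_complex_linear subspace_complex_linear)
  show "norm \<xi> = 1" by (simp add: \<xi>_def)
  show "inner (act (x * y) \<xi>) \<xi> = inner (act (y * x) \<xi>) \<xi>" if x: "x \<in> A" and y: "y \<in> A" for x y
  proof -
    have 0: "inner (act (x * y) \<xi>) \<xi> = inner (act (y * x) \<xi>) \<xi>" if x: "x \<in> U" and y: "y \<in> U" for x y
    proof -
      obtain z s w r where xy: "x = cscalar z * u s" "y = cscalar w * u r" and sr: "s \<in> carrier G" "r \<in> carrier G"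
        using x y by (auto simp: U_def)
      have x_y: "x * y = cscalar z * cscalar w * (u s * u r)"
        using u_complex_linear[OF sr(1), of w] by (simp add: xy mult.assoc) (metis mult.assoc)
      have y_x: "y * x = cscalar w * cscalar z * (u r * u s)"
        using u_complex_linear[OF sr(2), of z] by (simp add: xy mult.assoc) (metis mult.assoc)
      show ?thesis
      \<comment> \<open>Each product is a scalar times a single \<open>u\<close>, on which the state
        vanishes unless its group element is \<open>\<one>\<close>; in that case the two unitaries
        are inverse to each other.\<close>
      proof (cases "s \<otimes> r = \<one>")
        case True
        then have "r = inv s" using sr by (metis inv_equality inv_inv inv_closed)
        then have "u s * u r = 1" "u r * u s = 1" using u_inv sr by auto
        then show ?thesis unfolding x_y y_x by (simp flip: cscalar_mult add: mult.commute)
      next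
        case False
        then have "r \<otimes> s \<noteq> \<one>" using sr inv_comm by blast
        then show ?thesis using False sr vector_state_u
          unfolding x_y y_x by (simp add: u_mult mult.assoc[symmetric] del: act_times flip: cscalar_mult)
      qed
    qed
    have closed: "closed {x. inner (act (x * y) \<xi>) \<xi> = inner (act (y * x) \<xi>) \<xi>}" for y
      by (intro closed_Collect_eq continuous_intros bounded_linear.continuous_on[OF bounded_linear_act])
    have subspace: "subspace {x. inner (act (x * y) \<xi>) \<xi> = inner (act (y * x) \<xi>) \<xi>}" for y
      by (auto simp: subspace_def algebra_simps inner_add_left)
    have 1: "inner (act (x * y) \<xi>) \<xi> = inner (act (y * x) \<xi>) \<xi>" if "x \<in> A" "y \<in> U" for x y
      using A_induct[OF that(1) closed subspace, of y] 0[OF _ that(2)] by auto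
    have "U \<subseteq> {z. inner (act (z * x) \<xi>) \<xi> = inner (act (x * z) \<xi>) \<xi>}"
      using 1[OF x] by (auto simp del: act_times)
    from A_induct[OF y closed subspace this] show ?thesis by (simp del: act_times)
  qed
qed (rule closed_A subspace_A)+

sublocale concrete_algebra A \<xi>
  by (rule concrete_algebra_A)

lemma u_A: "s \<in> carrier G \<Longrightarrow> u s \<in> A"
  using u_U U_subset_A by blast

lemma norm_cis_diff: "cmod (1 - cis t) \<le> \<bar>t\<bar>"
proof -
  have "cmod (1 - cis t) = 2 * \<bar>sin (t / 2)\<bar>"
    using dist_exp_i_1[of t] by (simp add: cis_conv_exp norm_minus_commute)
  then show ?thesis using abs_sin_x_le_abs_x[of "t / 2"] by simp
qed

lemma u_almost_mult:
  assumes "s \<in> carrier G" "r \<in> carrier G"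
  shows "norm (u (s \<otimes> r) - u s * u r) \<le> \<bar>\<theta> s r\<bar>"
proof -
  have "u (s \<otimes> r) - u s * u r = cscalar (1 - cis (\<theta> s r)) * u (s \<otimes> r)"
    using assms by (simp add: u_mult cscalar_diff left_diff_distrib)
  then have "norm (u (s \<otimes> r) - u s * u r) = cmod (1 - cis (\<theta> s r)) * norm (u (s \<otimes> r))"
    by (simp only: norm_cscalar_mult)
  then show ?thesis using norm_cis_diff assms by (simp add: norm_u)
qed

text \<open>If \<open>w\<^sub>s = \<pi>(s)\<^sup>* u\<^sub>s\<close> is close to 1, then \<open>\<pi>(h)\<^sup>* w\<^sub>g \<pi>(h) w\<^sub>h\<close> is the scalar
  \<open>exp (i \<theta>(g,h))\<close> times \<open>w\<^bsub>gh\<^esub>\<close>, so the trace of the logarithm exhibits \<open>\<theta>\<close> as a coboundary.\<close>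

lemma cocycle_eq_coboundary:
  fixes \<pi> :: "'g \<Rightarrow> nat op"
  assumes \<pi>_A: "\<And>s. s \<in> carrier G \<Longrightarrow> \<pi> s \<in> A"
    and unit: "\<And>s. s \<in> carrier G \<Longrightarrow> op_adj (\<pi> s) * \<pi> s = 1" "\<And>s. s \<in> carrier G \<Longrightarrow> \<pi> s * op_adj (\<pi> s) = 1"
    and hom: "\<And>s r. \<lbrakk>s \<in> carrier G; r \<in> carrier G\<rbrakk> \<Longrightarrow> \<pi> (s \<otimes> r) = \<pi> s * \<pi> r"
  shows "\<exists>\<psi>. \<forall>g\<in>carrier G. \<forall>h\<in>carrier G.
    norm (u g - \<pi> g) \<le> 1 / 8 \<longrightarrow> norm (u h - \<pi> h) \<le> 1 / 8 \<longrightarrow> norm (u (g \<otimes> h) - \<pi> (g \<otimes> h)) \<le> 1 / 8 \<longrightarrow>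
    \<bar>\<theta> g h\<bar> \<le> 1 / 8 \<longrightarrow> \<theta> g h = \<psi> h - \<psi> (g \<otimes> h) + \<psi> g"
proof -
  interpret L: tracial_functional A T by (rule tracial_T)
  define w where "w s = op_adj (\<pi> s) * u s" for s
  have w_A: "w s - 1 \<in> A" if "s \<in> carrier G" for s
    unfolding w_def using that by (intro L.diff_B mult_A adj_A one_A \<pi>_A u_A)
  have norm_w: "norm (w s - 1) \<le> norm (u s - \<pi> s)" if "s \<in> carrier G" for s
  proof -
    have "norm (\<pi> s) = 1"
      using cstar_norm[of "\<pi> s"] unit(1)[OF that] norm_ge_zero[of "\<pi> s"] by (auto simp: power2_eq_1_iff)
    moreover have "w s - 1 = op_adj (\<pi> s) * (u s - \<pi> s)"
      using unit(1)[OF that] by (simp add: w_def right_diff_distrib)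
    ultimately show ?thesis using norm_mult_ineq[of "op_adj (\<pi> s)" "u s - \<pi> s"] by simp
  qed
  have "\<theta> g h = - L.lg (w h - 1) - - L.lg (w (g \<otimes> h) - 1) + - L.lg (w g - 1)"
    if gh: "g \<in> carrier G" "h \<in> carrier G" and small: "norm (u g - \<pi> g) \<le> 1 / 8"
      "norm (u h - \<pi> h) \<le> 1 / 8" "norm (u (g \<otimes> h) - \<pi> (g \<otimes> h)) \<le> 1 / 8" "\<bar>\<theta> g h\<bar> \<le> 1 / 8" for g h
  proof -
    define x where "x = op_adj (\<pi> h) * (w g - 1) * \<pi> h"
    define y :: "nat op" where "y = cscalar (cis (\<theta> g h)) - 1"
    have ghG: "g \<otimes> h \<in> carrier G" using gh by simp
    have x_A: "x \<in> A" unfolding x_def using gh by (intro mult_A adj_A \<pi>_A w_A)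
    have y_A: "y \<in> A" unfolding y_def by (intro L.diff_B cscalar_A one_A)
    have norm_\<pi>: "norm (\<pi> h) = 1"
      using cstar_norm[of "\<pi> h"] unit(1)[OF gh(2)] norm_ge_zero[of "\<pi> h"] by (auto simp: power2_eq_1_iff)
    have "norm x \<le> norm (op_adj (\<pi> h)) * norm (w g - 1) * norm (\<pi> h)"
      unfolding x_def by (meson mult_right_mono norm_ge_zero norm_mult_ineq order_trans)
    then have norm_x: "norm x \<le> 1 / 8" using norm_\<pi> norm_w[OF gh(1)] small(1) by simp
    have "y = cscalar (cis (\<theta> g h) - 1) * 1" by (simp add: y_def cscalar_diff)
    then have "norm y = cmod (cis (\<theta> g h) - 1)" by (simp only: norm_cscalar_mult norm_one)
    then have norm_y: "norm y \<le> 1 / 8" using norm_cis_diff[of "\<theta> g h"] small(4) by (simp add: norm_minus_commute)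
    have "(1 + x) * w h = (1 + y) * w (g \<otimes> h)"
    proof -
      have "1 + x = op_adj (\<pi> h) * w g * \<pi> h"
        using unit(1)[OF gh(2)] by (simp add: x_def algebra_simps)
      then have "(1 + x) * w h = op_adj (\<pi> h) * w g * (\<pi> h * op_adj (\<pi> h)) * u h"
        by (simp add: w_def mult.assoc)
      also have "\<dots> = op_adj (\<pi> h) * op_adj (\<pi> g) * (u g * u h)"
        using unit(2)[OF gh(2)] by (simp add: w_def mult.assoc)
      also have "\<dots> = op_adj (\<pi> (g \<otimes> h)) * cscalar (cis (\<theta> g h)) * u (g \<otimes> h)"
        using gh by (simp add: hom u_mult mult.assoc)
      also have "\<dots> = (1 + y) * w (g \<otimes> h)"
        using cscalar_comm[OF adj_A[OF \<pi>_A[OF ghG]], of "cis (\<theta> g h)"] by (simp add: y_def w_def mult.assoc[symmetric])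
      finally show ?thesis .
    qed
    then have "L.lg ((1 + x) * (1 + (w h - 1)) - 1) = L.lg ((1 + y) * (1 + (w (g \<otimes> h) - 1)) - 1)" by simp
    moreover have "L.lg ((1 + x) * (1 + (w h - 1)) - 1) = L.lg x + L.lg (w h - 1)"
      using norm_w[OF gh(2)] small(2) by (intro L.lg_mult x_A norm_x w_A gh) simp
    moreover have "L.lg ((1 + y) * (1 + (w (g \<otimes> h) - 1)) - 1) = L.lg y + L.lg (w (g \<otimes> h) - 1)"
      using norm_w[OF ghG] small(3) by (intro L.lg_mult y_A norm_y w_A ghG) simp
    moreover have "L.lg x = L.lg (w g - 1)"
      unfolding x_def by (intro L.lg_conj w_A adj_A \<pi>_A gh unit)
    moreover have "L.lg y = \<theta> g h * T (cscalar \<i>)"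
    proof -
      have "y = (cos (\<theta> g h) - 1) *\<^sub>R 1 + sin (\<theta> g h) *\<^sub>R cscalar \<i>"
        unfolding y_def by (subst cscalar_expand) (simp add: algebra_simps)
      moreover have "cscalar \<i> * cscalar \<i> = (- 1 :: nat op)" by (simp flip: cscalar_mult) (simp add: cscalar_def)
      moreover have "norm (cscalar \<i> :: nat op) \<le> 1" using norm_cscalar_mult[of \<i> "1 :: nat op"] by simp
      ultimately show ?thesis using L.lg_rotation[of "cscalar \<i>" "\<theta> g h"] i_A small(4) by simp
    qed
    \<comment> \<open>As \<open>T (cscalar \<i>) = - 1\<close>, the scalar contributes
      \<open>- \<theta> g h\<close>; hence the minus sign in the primitive.\<close>
    ultimately show ?thesis using T_i by simp
  qed
  then show ?thesis by (intro exI[of _ "\<lambda>s. - L.lg (w s - 1)"]) blast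
qed

end

section \<open>Uniform defects and nearby homomorphisms\<close>

locale encoded_twisted_group = twisted_group G \<theta> e
  for G :: "('g, 'm) monoid_scheme" (structure) and \<theta> and e +
  fixes j :: "nat op \<Rightarrow> 'b"
  assumes inj_j: "inj_on j complex_linear"
begin

sublocale encoded_algebra A \<xi> j
  by unfold_locales (rule inj_on_subset[OF inj_j complex_linear_A])

lemma unitary_rep: "(\<lambda>s. j (u s)) \<in> carrier G \<rightarrow> carrier (unitary_group B)"
  using unitary_iff[OF u_A] by (auto simp: adj_u u_inv)

text \<open>A real supremum is informative only for nonempty bounded families; the pair
  \<open>(\<one>, \<one>)\<close> and the bound \<open>K\<close> supply both.\<close>

lemma defect_bound:
  assumes K: "\<And>s t. \<lbrakk>s \<in> carrier G; t \<in> carrier G\<rbrakk> \<Longrightarrow> \<bar>\<theta> s t\<bar> \<le> K"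
  defines "D \<equiv> (SUP (s, t)\<in>carrier G \<times> carrier G. nrm B (j (u (s \<otimes> t)) \<ominus>\<^bsub>B\<^esub> j (u s) \<otimes>\<^bsub>B\<^esub> j (u t)))"
  shows "0 \<le> D" "D \<le> K"
proof -
  define N where "N = (\<lambda>(s, t). nrm B (j (u (s \<otimes> t)) \<ominus>\<^bsub>B\<^esub> j (u s) \<otimes>\<^bsub>B\<^esub> j (u t)))"
  have N: "N p = norm (u (fst p \<otimes> snd p) - u (fst p) * u (snd p))" if "p \<in> carrier G \<times> carrier G" for p
    using that by (auto simp: N_def u_A mult_A minus_B A_closure)
  have bd: "0 \<le> N p \<and> N p \<le> K" if "p \<in> carrier G \<times> carrier G" for p
    using N[OF that] u_almost_mult[of "fst p" "snd p"] K[of "fst p" "snd p"] that by (auto intro: order_trans)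
  have D: "D = (SUP p\<in>carrier G \<times> carrier G. N p)" by (simp add: D_def N_def)
  have p1: "(\<one>, \<one>) \<in> carrier G \<times> carrier G" by simp
  show "D \<le> K" unfolding D by (rule cSUP_least) (use p1 bd in auto)
  have "N (\<one>, \<one>) \<le> D" unfolding D
    by (rule cSUP_upper[OF p1]) (use bd in \<open>auto intro: bdd_aboveI2[where M = K]\<close>)
  then show "0 \<le> D" using bd[OF p1] by simp
qed

lemma hom_near_rep:
  assumes \<pi>: "\<pi> \<in> hom G (unitary_group B)"
  shows "\<exists>\<psi>. \<forall>g\<in>carrier G. \<forall>h\<in>carrier G.
    nrm B (j (u g) \<ominus>\<^bsub>B\<^esub> \<pi> g) \<le> 1 / 8 \<longrightarrow> nrm B (j (u h) \<ominus>\<^bsub>B\<^esub> \<pi> h) \<le> 1 / 8 \<longrightarrow>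
    nrm B (j (u (g \<otimes> h)) \<ominus>\<^bsub>B\<^esub> \<pi> (g \<otimes> h)) \<le> 1 / 8 \<longrightarrow>
    \<bar>\<theta> g h\<bar> \<le> 1 / 8 \<longrightarrow> \<theta> g h = \<psi> h - \<psi> (g \<otimes> h) + \<psi> g"
proof -
  define \<pi>' where "\<pi>' s = inv_into A j (\<pi> s)" for s
  have unitary: "\<pi> s \<in> carrier (unitary_group B)" if "s \<in> carrier G" for s
    using \<pi> that by (auto simp: hom_def)
  have \<pi>': "\<pi>' s \<in> A \<and> \<pi> s = j (\<pi>' s)" if s: "s \<in> carrier G" for s
  proof -
    have "\<pi> s \<in> j ` A" using unitary[OF s] by (simp add: unitary_group_def)
    then show ?thesis unfolding \<pi>'_def by (simp add: inv_into_into f_inv_into_f)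
  qed
  have unit: "op_adj (\<pi>' s) * \<pi>' s = 1 \<and> \<pi>' s * op_adj (\<pi>' s) = 1" if s: "s \<in> carrier G" for s
    using unitary[OF s] \<pi>'[OF s] unitary_iff[of "\<pi>' s"] by simp
  have hom: "\<pi>' (s \<otimes> r) = \<pi>' s * \<pi>' r" if sr: "s \<in> carrier G" "r \<in> carrier G" for s r
  proof -
    have "\<pi> (s \<otimes> r) = \<pi> s \<otimes>\<^bsub>B\<^esub> \<pi> r" using hom_mult[OF \<pi> sr] by (simp add: unitary_group_def)
    then have "j (\<pi>' (s \<otimes> r)) = j (\<pi>' s * \<pi>' r)" using \<pi>' sr by simp
    then show ?thesis using \<pi>' sr enc_eq_iff mult_A by simp
  qed
  have nrm: "nrm B (j (u s) \<ominus>\<^bsub>B\<^esub> \<pi> s) = norm (u s - \<pi>' s)" if s: "s \<in> carrier G" for s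
    using \<pi>'[OF s] u_A[OF s] by (simp add: minus_B A_closure)
  obtain \<psi> where \<psi>: "\<forall>g\<in>carrier G. \<forall>h\<in>carrier G.
    norm (u g - \<pi>' g) \<le> 1 / 8 \<longrightarrow> norm (u h - \<pi>' h) \<le> 1 / 8 \<longrightarrow> norm (u (g \<otimes> h) - \<pi>' (g \<otimes> h)) \<le> 1 / 8 \<longrightarrow>
    \<bar>\<theta> g h\<bar> \<le> 1 / 8 \<longrightarrow> \<theta> g h = \<psi> h - \<psi> (g \<otimes> h) + \<psi> g"
    using cocycle_eq_coboundary[of \<pi>'] \<pi>' unit hom by blast
  show ?thesis using \<psi> by (intro exI[of _ \<psi>]) (simp add: nrm)
qed

end

section \<open>From nonzero cohomology to the failure of stability\<close>

text \<open>If all cocycles were coboundaries, every coset would be the group of coboundaries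
  itself, which translation by a coboundary permutes.\<close>

lemma (in group) ex_cocycle_not_coboundary:
  assumes "carrier (H2_real G) \<noteq> {\<one>\<^bsub>H2_real G\<^esub>}"
  shows "\<exists>c\<in>cocycles2 G. c \<notin> range (coboundary1 G)"
proof (rule ccontr)
  assume "\<not> ?thesis"
  then have sub: "cocycles2 G \<subseteq> range (coboundary1 G)" by blast
  define M where "M = (cochains2 G)\<lparr>carrier := cocycles2 G\<rparr>"
  define H where "H = range (coboundary1 G)"
  have add: "coboundary1 G \<phi> \<otimes>\<^bsub>M\<^esub> coboundary1 G \<psi> = coboundary1 G (\<lambda>g. \<phi> g + \<psi> g)" for \<phi> \<psi>
    by (auto simp: M_def cochains2_def coboundary1_def fun_eq_iff)
  have "H #>\<^bsub>M\<^esub> a = H" if "a \<in> cocycles2 G" for a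
  proof -
    obtain \<phi> where a: "a = coboundary1 G \<phi>" using sub \<open>a \<in> cocycles2 G\<close> by auto
    have "H #>\<^bsub>M\<^esub> a = range (\<lambda>\<psi>. coboundary1 G (\<lambda>g. \<psi> g + \<phi> g))"
      by (auto simp: r_coset_def H_def a add)
    also have "\<dots> = H"
    proof
      show "H \<subseteq> range (\<lambda>\<psi>. coboundary1 G (\<lambda>g. \<psi> g + \<phi> g))"
      proof
        fix x assume "x \<in> H"
        then obtain \<psi> where "x = coboundary1 G \<psi>" by (auto simp: H_def)
        then show "x \<in> range (\<lambda>\<psi>. coboundary1 G (\<lambda>g. \<psi> g + \<phi> g))"
          by (intro range_eqI[of _ _ "\<lambda>g. \<psi> g - \<phi> g"]) simp
      qed
    qed (auto simp: H_def)
    finally show ?thesis .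
  qed
  \<comment> \<open>The zero cocycle shows that there is at least one coset, so the quotient is
    exactly \<open>{H}\<close>.\<close>
  moreover have "restrict (\<lambda>_. 0) (carrier G \<times> carrier G) \<in> cocycles2 G"
    by (auto simp: cocycles2_def cochains2_def)
  ultimately have "carrier (M Mod H) = {H}"
    by (auto simp: FactGroup_def RCOSETS_def M_def)
  moreover have "\<one>\<^bsub>M Mod H\<^esub> = H" by (simp add: FactGroup_def)
  ultimately show False using assms by (simp add: H2_real_def M_def H_def)
qed

theorem corollary1p3:
  fixes \<Gamma> :: "('g, 'm) monoid_scheme"
  assumes universe: "(UNIV :: real set) \<lesssim> (UNIV :: 'b set)"
    and hyperbolic: "hyperbolic_group \<Gamma>"
    and H2_nonzero: "carrier (H2_real \<Gamma>) \<noteq> {\<one>\<^bsub>H2_real \<Gamma>\<^esub>}"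
  shows "\<not> uniform_to_local_stable (tracial_cstar_algebras :: 'b cstar_algebra set) \<Gamma>"
proof
  assume stable: "uniform_to_local_stable (tracial_cstar_algebras :: 'b cstar_algebra set) \<Gamma>"
  obtain S where "group \<Gamma>" and S: "finite S" "S \<subseteq> carrier \<Gamma>" "generate \<Gamma> S = carrier \<Gamma>"
    and hyp: "gromov_hyperbolic (carrier \<Gamma>) (word_dist \<Gamma> S)"
    using hyperbolic unfolding hyperbolic_group_def by blast
  then interpret marked_group \<Gamma> S
    by (intro marked_group.intro marked_group_axioms.intro)
  obtain c where c: "c \<in> cocycles2 \<Gamma>" "c \<notin> range (coboundary1 \<Gamma>)"
    using ex_cocycle_not_coboundary[OF H2_nonzero] by blast
  have c_cocycle: "c (h, k) - c (g \<otimes>\<^bsub>\<Gamma>\<^esub> h, k) + c (g, h \<otimes>\<^bsub>\<Gamma>\<^esub> k) - c (g, h) = 0"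
    if "g \<in> carrier \<Gamma>" "h \<in> carrier \<Gamma>" "k \<in> carrier \<Gamma>" for g h k
    using c(1) that by (simp add: cocycles2_def)
  obtain \<theta> \<phi> C where
    \<theta>: "\<And>g h. \<lbrakk>g \<in> carrier \<Gamma>; h \<in> carrier \<Gamma>\<rbrakk> \<Longrightarrow> \<theta> g h = c (g, h) + (\<phi> h - \<phi> (g \<otimes>\<^bsub>\<Gamma>\<^esub> h) + \<phi> g)"
    and \<theta>_bound: "\<And>g h. \<lbrakk>g \<in> carrier \<Gamma>; h \<in> carrier \<Gamma>\<rbrakk> \<Longrightarrow> \<bar>\<theta> g h\<bar> \<le> C"
    and \<theta>_norm: "\<And>g. g \<in> carrier \<Gamma> \<Longrightarrow> \<theta> \<one>\<^bsub>\<Gamma>\<^esub> g = 0" "\<And>g. g \<in> carrier \<Gamma> \<Longrightarrow> \<theta> g (inv\<^bsub>\<Gamma>\<^esub> g) = 0"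
    using bounded_cocycle[OF hyp c_cocycle] by blast
  have \<theta>_cocycle: "\<theta> h k - \<theta> (g \<otimes>\<^bsub>\<Gamma>\<^esub> h) k + \<theta> g (h \<otimes>\<^bsub>\<Gamma>\<^esub> k) - \<theta> g h = 0"
    if "g \<in> carrier \<Gamma>" "h \<in> carrier \<Gamma>" "k \<in> carrier \<Gamma>" for g h k
    using c_cocycle[OF that] that by (simp add: \<theta> m_assoc)
  define e where "e = to_nat_on (carrier \<Gamma> \<times> (UNIV :: nat set))"
  have "infinite (carrier \<Gamma> \<times> (UNIV :: nat set))"
    using one_closed by (auto simp: finite_cartesian_product_iff)
  then have e: "bij_betw e (carrier \<Gamma> \<times> UNIV) UNIV"
    unfolding e_def using countable_carrier by (intro to_nat_on_infinite) auto
  obtain j :: "nat op \<Rightarrow> 'b" where j: "inj_on j complex_linear"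
    using ex_encoding[OF universe] by blast
  \<comment> \<open>Scaling keeps the cocycle identity and the normalizations, and turns the common
    bound \<open>C\<close> into \<open>C / real (Suc n)\<close>.\<close>
  define \<theta>n where "\<theta>n n g h = \<theta> g h / real (Suc n)" for n g h
  have twisted: "encoded_twisted_group \<Gamma> (\<theta>n n) e j" for n
  proof (intro encoded_twisted_group.intro twisted_group.intro twisted_group_axioms.intro
      encoded_twisted_group_axioms.intro e j \<open>group \<Gamma>\<close>)
    fix g h k assume "g \<in> carrier \<Gamma>" "h \<in> carrier \<Gamma>" "k \<in> carrier \<Gamma>"
    from \<theta>_cocycle[OF this]
    show "\<theta>n n h k - \<theta>n n (g \<otimes>\<^bsub>\<Gamma>\<^esub> h) k + \<theta>n n g (h \<otimes>\<^bsub>\<Gamma>\<^esub> k) - \<theta>n n g h = 0"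
      by (simp add: \<theta>n_def flip: diff_divide_distrib add_divide_distrib)
  qed (simp_all add: \<theta>n_def \<theta>_norm)
  define B where "B n = enc_algebra (twisted_group.A \<Gamma> (\<theta>n n) e) j" for n
  define \<rho> where "\<rho> n s = j (twisted_group.u \<Gamma> (\<theta>n n) e s)" for n s
  have \<theta>n_bound: "\<bar>\<theta>n n g h\<bar> \<le> C / real (Suc n)" if "g \<in> carrier \<Gamma>" "h \<in> carrier \<Gamma>" for n g h
    using \<theta>_bound[OF that] by (simp add: \<theta>n_def divide_right_mono)
  have lim: "(\<lambda>n. C / real (Suc n)) \<longlonglongrightarrow> 0"
    using LIMSEQ_Suc[OF lim_const_over_n[of C]] by simp
  have defect: "(\<lambda>n. SUP (s, t)\<in>carrier \<Gamma> \<times> carrier \<Gamma>.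
      nrm (B n) (\<rho> n (s \<otimes>\<^bsub>\<Gamma>\<^esub> t) \<ominus>\<^bsub>B n\<^esub> \<rho> n s \<otimes>\<^bsub>B n\<^esub> \<rho> n t)) \<longlonglongrightarrow> 0" (is "?D \<longlonglongrightarrow> 0")
  proof (rule tendsto_sandwich[OF _ _ tendsto_const lim])
    show "\<forall>\<^sub>F n in sequentially. 0 \<le> ?D n"
    proof (intro always_eventually allI)
      fix n
      interpret encoded_twisted_group \<Gamma> "\<theta>n n" e j by (rule twisted)
      show "0 \<le> ?D n" unfolding B_def \<rho>_def by (rule defect_bound[OF \<theta>n_bound])
    qed
    show "\<forall>\<^sub>F n in sequentially. ?D n \<le> C / real (Suc n)"
    proof (intro always_eventually allI)
      fix n
      interpret encoded_twisted_group \<Gamma> "\<theta>n n" e j by (rule twisted)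
      show "?D n \<le> C / real (Suc n)" unfolding B_def \<rho>_def by (rule defect_bound[OF \<theta>n_bound])
    qed
  qed
  have B: "B n \<in> tracial_cstar_algebras \<and> \<rho> n \<in> carrier \<Gamma> \<rightarrow> carrier (unitary_group (B n))
      \<and> \<rho> n \<one>\<^bsub>\<Gamma>\<^esub> = \<one>\<^bsub>B n\<^esub>" for n
  proof -
    interpret encoded_twisted_group \<Gamma> "\<theta>n n" e j by (rule twisted)
    show ?thesis unfolding B_def \<rho>_def using B_tracial unitary_rep u_one by simp
  qed
  have "\<exists>\<pi> :: nat \<Rightarrow> 'g \<Rightarrow> 'b. (\<forall>n. \<pi> n \<in> hom \<Gamma> (unitary_group (B n))) \<and>
      (\<forall>s\<in>carrier \<Gamma>. (\<lambda>n. nrm (B n) (\<rho> n s \<ominus>\<^bsub>B n\<^esub> \<pi> n s)) \<longlonglongrightarrow> 0)"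
    using stable[unfolded uniform_to_local_stable_def, rule_format, of B \<rho>] B defect by blast
  then obtain \<pi> :: "nat \<Rightarrow> 'g \<Rightarrow> 'b" where \<pi>: "\<And>n. \<pi> n \<in> hom \<Gamma> (unitary_group (B n))"
    and near: "\<And>s. s \<in> carrier \<Gamma> \<Longrightarrow> (\<lambda>n. nrm (B n) (\<rho> n s \<ominus>\<^bsub>B n\<^esub> \<pi> n s)) \<longlonglongrightarrow> 0" by blast
  have "\<exists>\<psi>. \<forall>g\<in>carrier \<Gamma>. \<forall>h\<in>carrier \<Gamma>. \<theta> g h = \<psi> h - \<psi> (g \<otimes>\<^bsub>\<Gamma>\<^esub> h) + \<psi> g"
  proof (rule coboundary_compactness)
    fix F assume F: "finite F" "F \<subseteq> carrier \<Gamma>"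
    \<comment> \<open>The coboundary formula involves \<open>g\<close>, \<open>h\<close> and their
      product, so closeness is needed at the products as well.\<close>
    define F' where "F' = F \<union> (\<lambda>(g, h). g \<otimes>\<^bsub>\<Gamma>\<^esub> h) ` (F \<times> F)"
    have F': "finite F'" "F' \<subseteq> carrier \<Gamma>" using F by (auto simp: F'_def)
    have "\<forall>\<^sub>F n in sequentially. nrm (B n) (\<rho> n s \<ominus>\<^bsub>B n\<^esub> \<pi> n s) < 1 / 8" if "s \<in> F'" for s
      using order_tendstoD(2)[OF near, of s "1 / 8"] that F' by auto
    then have "\<forall>\<^sub>F n in sequentially. \<forall>s\<in>F'. nrm (B n) (\<rho> n s \<ominus>\<^bsub>B n\<^esub> \<pi> n s) < 1 / 8"
      by (intro eventually_ball_finite F') auto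
    moreover have "\<forall>\<^sub>F n in sequentially. C / real (Suc n) < 1 / 8"
      using order_tendstoD(2)[OF lim, of "1 / 8"] by simp
    ultimately have "\<forall>\<^sub>F n in sequentially. (\<forall>s\<in>F'. nrm (B n) (\<rho> n s \<ominus>\<^bsub>B n\<^esub> \<pi> n s) < 1 / 8) \<and> C / real (Suc n) < 1 / 8"
      by (rule eventually_conj)
    then obtain n where n: "\<And>s. s \<in> F' \<Longrightarrow> nrm (B n) (\<rho> n s \<ominus>\<^bsub>B n\<^esub> \<pi> n s) < 1 / 8" "C / real (Suc n) < 1 / 8"
      using eventually_happens[of _ sequentially] by force
    interpret encoded_twisted_group \<Gamma> "\<theta>n n" e j by (rule twisted)
    obtain \<psi> where \<psi>: "\<forall>g\<in>carrier \<Gamma>. \<forall>h\<in>carrier \<Gamma>.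
        nrm (B n) (\<rho> n g \<ominus>\<^bsub>B n\<^esub> \<pi> n g) \<le> 1 / 8 \<longrightarrow> nrm (B n) (\<rho> n h \<ominus>\<^bsub>B n\<^esub> \<pi> n h) \<le> 1 / 8 \<longrightarrow>
        nrm (B n) (\<rho> n (g \<otimes>\<^bsub>\<Gamma>\<^esub> h) \<ominus>\<^bsub>B n\<^esub> \<pi> n (g \<otimes>\<^bsub>\<Gamma>\<^esub> h)) \<le> 1 / 8 \<longrightarrow>
        \<bar>\<theta>n n g h\<bar> \<le> 1 / 8 \<longrightarrow> \<theta>n n g h = \<psi> h - \<psi> (g \<otimes>\<^bsub>\<Gamma>\<^esub> h) + \<psi> g"
      using hom_near_rep[OF \<pi>[of n, unfolded B_def]] unfolding B_def \<rho>_def by blast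
    \<comment> \<open>The scaling is undone; the resulting primitive depends on \<open>n\<close> and
      thus on \<open>F\<close>.\<close>
    have "\<theta> g h = real (Suc n) * \<psi> h - real (Suc n) * \<psi> (g \<otimes>\<^bsub>\<Gamma>\<^esub> h) + real (Suc n) * \<psi> g"
      if gh: "g \<in> F" "h \<in> F" for g h
    proof -
      have G: "g \<in> carrier \<Gamma>" "h \<in> carrier \<Gamma>" using gh F by auto
      have "g \<in> F'" "h \<in> F'" "g \<otimes>\<^bsub>\<Gamma>\<^esub> h \<in> F'" using gh by (auto simp: F'_def)
      from this[THEN n(1), THEN less_imp_le] have "\<theta>n n g h = \<psi> h - \<psi> (g \<otimes>\<^bsub>\<Gamma>\<^esub> h) + \<psi> g"
        using \<psi> G order_trans[OF \<theta>n_bound[OF G] less_imp_le[OF n(2)]] by blast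
      moreover have "\<theta> g h = real (Suc n) * \<theta>n n g h" by (simp add: \<theta>n_def)
      ultimately show ?thesis by (simp only: distrib_left right_diff_distrib)
    qed
    then show "\<exists>\<psi>. \<forall>g\<in>F. \<forall>h\<in>F. \<theta> g h = \<psi> h - \<psi> (g \<otimes>\<^bsub>\<Gamma>\<^esub> h) + \<psi> g"
      by (intro exI[of _ "\<lambda>g. real (Suc n) * \<psi> g"]) blast
  qed
  then obtain \<psi> where \<psi>: "\<And>g h. \<lbrakk>g \<in> carrier \<Gamma>; h \<in> carrier \<Gamma>\<rbrakk> \<Longrightarrow> \<theta> g h = \<psi> h - \<psi> (g \<otimes>\<^bsub>\<Gamma>\<^esub> h) + \<psi> g" by blast
  have "c p = coboundary1 \<Gamma> (\<lambda>g. \<psi> g - \<phi> g) p" for p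
  proof (cases "p \<in> carrier \<Gamma> \<times> carrier \<Gamma>")
    case True
    then show ?thesis using \<theta>[of "fst p" "snd p"] \<psi>[of "fst p" "snd p"] by (auto simp: coboundary1_def)
  next
    \<comment> \<open>Cochains and coboundaries are extensional, so outside the group both sides are
      \<open>undefined\<close>.\<close>
    case False
    then show ?thesis using c(1)
      by (cases p) (auto simp: coboundary1_def cocycles2_def cochains2_def PiE_def extensional_def)
  qed
  then have "c = coboundary1 \<Gamma> (\<lambda>g. \<psi> g - \<phi> g)" by (rule ext)
  then show False using c(2) by blast
qed

end
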